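(* If a structure $\mathcal{N}$ trace defines a structure $\mathcal{M}$ then $\mathrm{RM}(\mathcal{M})<\mathrm{RM}(\mathcal{N})^\omega$. If a theory $T$ has finite Morley rank then any theory trace definable in $T$ has finite Morley rank.
   Context: Conventions: structures and theories are first order; theories are complete and consistent; "definable" means definable with parameters. $\mathcal{N}$ trace defines $\mathcal{M}$ if for some $n\ge 1$ there is a map $\tau\colon M\to N^n$ such that for every $m\ge 1$ and every $\mathcal{M}$-definable $X\subseteq M^m$ there is an $\mathcal{N}$-definable $Y\subseteq N^{mn}$ with $X=\{(a_1,\dots,a_m)\in M^m : (\tau(a_1),\dots,\tau(a_m))\in Y\}$. A theory $T^*$ is trace definable in $T$ if every (equivalently, some) model of $T^*$ is trace definable in some model of $T$. $\mathrm{RM}(\mathcal{M})$ is the Morley rank of the formula $x=x$ in one variable (computed in a sufficiently saturated elementary extension), and is $\infty$ if not an ordinal; the Morley rank of a theory is that of its models. The power is the usual ordinal power.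
   Formalization: The inequality is proved for ordinal RM(N) ≥ 2; for RM(N) = 1, where it fails (M = N an infinite set gives 1 < 1^ω = 1), RM(M) is shown finite, and for RM(N) = 0, RM(M) = 0. RM(N) = ∞ is left out. The rank of a theory is read off models of size at most that of the language plus ℵ₀. *)

theory Defs
  imports Main
begin

unbundle cardinal_syntax

section \<open>First-order logic\<close>

text \<open>A signature is a set of function symbols and a set of relation symbols, each paired with its
  arity; constants are function symbols of arity 0.\<close>

record ('f, 'r) signature =
  funs :: "('f \<times> nat) set"
  rels :: "('r \<times> nat) set"

datatype 'f tm = Var nat | Fn 'f "'f tm list"

datatype ('f, 'r) fm =
    Eql "'f tm" "'f tm"
  | Rl 'r "'f tm list"
  | Neg "('f, 'r) fm"
  | Conj "('f, 'r) fm" "('f, 'r) fm"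
  | Ex nat "('f, 'r) fm"

fun wf_tm :: "('f, 'r) signature \<Rightarrow> 'f tm \<Rightarrow> bool" where
  "wf_tm L (Var i) \<longleftrightarrow> True"
| "wf_tm L (Fn f ts) \<longleftrightarrow> (f, length ts) \<in> funs L \<and> (\<forall>t\<in>set ts. wf_tm L t)"

fun wf_fm :: "('f, 'r) signature \<Rightarrow> ('f, 'r) fm \<Rightarrow> bool" where
  "wf_fm L (Eql s t) \<longleftrightarrow> wf_tm L s \<and> wf_tm L t"
| "wf_fm L (Rl p ts) \<longleftrightarrow> (p, length ts) \<in> rels L \<and> (\<forall>t\<in>set ts. wf_tm L t)"
| "wf_fm L (Neg \<phi>) \<longleftrightarrow> wf_fm L \<phi>"
| "wf_fm L (Conj \<phi> \<psi>) \<longleftrightarrow> wf_fm L \<phi> \<and> wf_fm L \<psi>"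
| "wf_fm L (Ex i \<phi>) \<longleftrightarrow> wf_fm L \<phi>"

fun fv_tm :: "'f tm \<Rightarrow> nat set" where
  "fv_tm (Var i) = {i}"
| "fv_tm (Fn f ts) = (\<Union>t\<in>set ts. fv_tm t)"

fun fv :: "('f, 'r) fm \<Rightarrow> nat set" where
  "fv (Eql s t) = fv_tm s \<union> fv_tm t"
| "fv (Rl p ts) = (\<Union>t\<in>set ts. fv_tm t)"
| "fv (Neg \<phi>) = fv \<phi>"
| "fv (Conj \<phi> \<psi>) = fv \<phi> \<union> fv \<psi>"
| "fv (Ex i \<phi>) = fv \<phi> - {i}"

record ('f, 'r, 'a) fostruct =
  univ :: "'a set"
  func :: "'f \<Rightarrow> 'a list \<Rightarrow> 'a"
  pred :: "'r \<Rightarrow> 'a list \<Rightarrow> bool"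

definition is_fostruct :: "('f, 'r) signature \<Rightarrow> ('f, 'r, 'a) fostruct \<Rightarrow> bool" where
  "is_fostruct L M \<longleftrightarrow> univ M \<noteq> {} \<and>
     (\<forall>(f, n)\<in>funs L. \<forall>xs. length xs = n \<and> set xs \<subseteq> univ M \<longrightarrow> func M f xs \<in> univ M)"

fun eval_tm :: "('f, 'r, 'a) fostruct \<Rightarrow> (nat \<Rightarrow> 'a) \<Rightarrow> 'f tm \<Rightarrow> 'a" where
  "eval_tm M e (Var i) = e i"
| "eval_tm M e (Fn f ts) = func M f (map (eval_tm M e) ts)"

fun sat :: "('f, 'r, 'a) fostruct \<Rightarrow> (nat \<Rightarrow> 'a) \<Rightarrow> ('f, 'r) fm \<Rightarrow> bool" where
  "sat M e (Eql s t) \<longleftrightarrow> eval_tm M e s = eval_tm M e t"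
| "sat M e (Rl p ts) \<longleftrightarrow> pred M p (map (eval_tm M e) ts)"
| "sat M e (Neg \<phi>) \<longleftrightarrow> \<not> sat M e \<phi>"
| "sat M e (Conj \<phi> \<psi>) \<longleftrightarrow> sat M e \<phi> \<and> sat M e \<psi>"
| "sat M e (Ex i \<phi>) \<longleftrightarrow> (\<exists>a\<in>univ M. sat M (e(i := a)) \<phi>)"

definition sentences :: "('f, 'r) signature \<Rightarrow> ('f, 'r) fm set" where
  "sentences L = {\<phi>. wf_fm L \<phi> \<and> fv \<phi> = {}}"

definition holds :: "('f, 'r, 'a) fostruct \<Rightarrow> ('f, 'r) fm \<Rightarrow> bool" where
  "holds M \<phi> \<longleftrightarrow> (\<forall>e. range e \<subseteq> univ M \<longrightarrow> sat M e \<phi>)"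

definition models :: "('f, 'r) signature \<Rightarrow> ('f, 'r, 'a) fostruct \<Rightarrow> ('f, 'r) fm set \<Rightarrow> bool" where
  "models L M T \<longleftrightarrow> is_fostruct L M \<and> (\<forall>\<phi>\<in>T. holds M \<phi>)"

text \<open>HOL cannot quantify over the types in which models live. The type of all formulas has the
  cardinality of the language plus \<open>\<aleph>\<^sub>0\<close>, so by the Loewenheim-Skolem theorem every structure is
  elementarily equivalent to one whose universe is a set of formulas. Restricting to universes in
  that type therefore affects neither consistency nor entailment.\<close>

definition entails :: "('f, 'r) signature \<Rightarrow> ('f, 'r) fm set \<Rightarrow> ('f, 'r) fm \<Rightarrow> bool" where
  "entails L T \<phi> \<longleftrightarrow>
     (\<forall>M :: ('f, 'r, ('f, 'r) fm) fostruct. models L M T \<longrightarrow> holds M \<phi>)"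

definition consistent :: "('f, 'r) signature \<Rightarrow> ('f, 'r) fm set \<Rightarrow> bool" where
  "consistent L T \<longleftrightarrow> (\<exists>M :: ('f, 'r, ('f, 'r) fm) fostruct. models L M T)"

definition complete_theory :: "('f, 'r) signature \<Rightarrow> ('f, 'r) fm set \<Rightarrow> bool" where
  "complete_theory L T \<longleftrightarrow> T \<subseteq> sentences L \<and> consistent L T \<and>
     (\<forall>\<phi>\<in>sentences L. entails L T \<phi> \<or> entails L T (Neg \<phi>))"

definition elementary_embedding ::
    "('f, 'r) signature \<Rightarrow> ('f, 'r, 'a) fostruct \<Rightarrow> ('f, 'r, 'b) fostruct \<Rightarrow> ('a \<Rightarrow> 'b) \<Rightarrow> bool" where
  "elementary_embedding L M M' h \<longleftrightarrow> h ` univ M \<subseteq> univ M' \<and>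
     (\<forall>\<phi> e. wf_fm L \<phi> \<and> range e \<subseteq> univ M \<longrightarrow> (sat M e \<phi> \<longleftrightarrow> sat M' (h \<circ> e) \<phi>))"

text \<open>Realisation of finitely satisfiable 1-types over finite parameter sets: the type variable is
  0, and the values of \<open>e\<close> at \<open>1, \<dots>, k\<close> are the parameters.\<close>

definition aleph0_saturated :: "('f, 'r) signature \<Rightarrow> ('f, 'r, 'a) fostruct \<Rightarrow> bool" where
  "aleph0_saturated L M \<longleftrightarrow>
     (\<forall>e k \<Phi>. range e \<subseteq> univ M \<and> (\<forall>\<phi>\<in>\<Phi>. wf_fm L \<phi> \<and> fv \<phi> \<subseteq> {0..k}) \<and>
        (\<forall>\<Psi>\<subseteq>\<Phi>. finite \<Psi> \<longrightarrow> (\<exists>a\<in>univ M. \<forall>\<phi>\<in>\<Psi>. sat M (e(0 := a)) \<phi>)) \<longrightarrow>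
        (\<exists>a\<in>univ M. \<forall>\<phi>\<in>\<Phi>. sat M (e(0 := a)) \<phi>))"


section \<open>Definable sets and trace definability\<close>

definition tuples :: "'a set \<Rightarrow> nat \<Rightarrow> 'a list set" where
  "tuples A n = {xs. length xs = n \<and> set xs \<subseteq> A}"

text \<open>Definability with parameters: the variables \<open>0, \<dots>, m - 1\<close> carry the tuple and \<open>e\<close> assigns
  parameters to the remaining variables, only finitely many of which occur in \<open>\<phi>\<close>.\<close>

definition definable ::
    "('f, 'r) signature \<Rightarrow> ('f, 'r, 'a) fostruct \<Rightarrow> nat \<Rightarrow> 'a list set \<Rightarrow> bool" where
  "definable L M m X \<longleftrightarrow>
     (\<exists>\<phi> e. wf_fm L \<phi> \<and> range e \<subseteq> univ M \<and>
        X = {xs \<in> tuples (univ M) m. sat M (\<lambda>i. if i < m then xs ! i else e i) \<phi>})"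

definition trace_defines ::
    "('g, 's) signature \<Rightarrow> ('g, 's, 'b) fostruct \<Rightarrow> ('f, 'r) signature \<Rightarrow> ('f, 'r, 'a) fostruct \<Rightarrow> bool"
  where
  "trace_defines K N L M \<longleftrightarrow>
     (\<exists>n\<ge>1. \<exists>\<tau>. (\<forall>a\<in>univ M. \<tau> a \<in> tuples (univ N) n) \<and>
        (\<forall>m\<ge>1. \<forall>X. definable L M m X \<longrightarrow>
           (\<exists>Y. definable K N (m * n) Y \<and>
                X = {as \<in> tuples (univ M) m. concat (map \<tau> as) \<in> Y})))"

text \<open>Some model of \<open>T\<close> is trace definable in some model of \<open>S\<close>. The two type arguments only name
  the types in which the models live; a statement in which they are type variables speaks about
  models of arbitrary size.\<close>

definition theory_trace_definable ::
    "'a itself \<Rightarrow> 'b itself \<Rightarrow> ('f, 'r) signature \<Rightarrow> ('f, 'r) fm set \<Rightarrow>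
     ('g, 's) signature \<Rightarrow> ('g, 's) fm set \<Rightarrow> bool" where
  "theory_trace_definable _ _ L T K S \<longleftrightarrow>
     (\<exists>(M :: ('f, 'r, 'a) fostruct) (N :: ('g, 's, 'b) fostruct).
        models L M T \<and> models K N S \<and> trace_defines K N L M)"


section \<open>Ordinals\<close>

text \<open>Ordinals are represented by well-order relations, compared by \<open>\<le>o\<close>, \<open><o\<close>, \<open>=o\<close>. In particular
  \<open>natLeq_on n\<close> is the ordinal \<open>n\<close> and \<open>natLeq\<close> is \<open>\<omega>\<close>.

  The power \<open>r ^ s\<close> is the set of functions from \<open>s\<close> to \<open>r\<close> taking a value other than the least element
  only finitely often, compared at the largest argument where they differ. In particular
  \<open>1 ^ \<omega> = 1\<close>, and \<open>0 ^ \<omega> = 0\<close> (a matter of convention).\<close>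

definition opow :: "'a rel \<Rightarrow> 'b rel \<Rightarrow> ('b \<Rightarrow> 'a) rel" where
  "opow r s =
     (let F = {f \<in> Func (Field s) (Field r). finite {x \<in> Field s. underS r (f x) \<noteq> {}}}
      in {(f, g). f \<in> F \<and> g \<in> F \<and>
           (f = g \<or> (\<exists>z\<in>Field s. (f z, g z) \<in> r \<and> f z \<noteq> g z \<and>
                       (\<forall>y. (z, y) \<in> s \<and> y \<noteq> z \<longrightarrow> f y = g y)))})"


section \<open>Morley rank\<close>

text \<open>\<open>rank_ge L M m r X\<close>: the definable set \<open>X \<subseteq> M\<^sup>m\<close> has Morley rank at least \<open>r\<close>, computed
  inside \<open>M\<close>. \<open>Restr r (underS r x)\<close> runs through the ordinals below \<open>r\<close>; in the successor rule \<open>x\<close> is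
  the last element of \<open>r\<close>, so that \<open>r\<close> is the successor of \<open>Restr r (underS r x)\<close>.\<close>

inductive rank_ge ::
    "('f, 'r) signature \<Rightarrow> ('f, 'r, 'a) fostruct \<Rightarrow> nat \<Rightarrow> 'o rel \<Rightarrow> 'a list set \<Rightarrow> bool"
  for L M m where
  zero: "definable L M m X \<Longrightarrow> X \<noteq> {} \<Longrightarrow> rank_ge L M m {} X"
| succ: "\<lbrakk>definable L M m X; Well_order r; x \<in> Field r; \<forall>y\<in>Field r. (y, x) \<in> r;
          \<forall>i :: nat. F i \<subseteq> X \<and> rank_ge L M m (Restr r (underS r x)) (F i);
          \<forall>i j. i \<noteq> j \<longrightarrow> F i \<inter> F j = {}\<rbrakk>
         \<Longrightarrow> rank_ge L M m r X"
| lim: "\<lbrakk>definable L M m X; Well_order r; r \<noteq> {}; \<forall>x\<in>Field r. \<exists>y\<in>Field r. (x, y) \<in> r \<and> y \<noteq> x;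
         \<forall>x\<in>Field r. rank_ge L M m (Restr r (underS r x)) X\<rbrakk>
        \<Longrightarrow> rank_ge L M m r X"

text \<open>The Morley rank of \<open>x = x\<close> in one variable, computed in an \<open>\<aleph>\<^sub>0\<close>-saturated elementary extension;
  the choice of the extension does not matter. One exists with universe of size at most
  \<open>|M| + 2\<^sup>\<kappa>\<close>, where \<open>\<kappa>\<close> is the number of formulas, and so in the type used here.\<close>

definition morley_rank_ge :: "('f, 'r) signature \<Rightarrow> ('f, 'r, 'a) fostruct \<Rightarrow> 'o rel \<Rightarrow> bool" where
  "morley_rank_ge L M r \<longleftrightarrow>
     (\<exists>(M' :: ('f, 'r, ('a + ('f, 'r) fm) set) fostruct) h.
        is_fostruct L M' \<and> elementary_embedding L M M' h \<and> aleph0_saturated L M' \<and>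
        rank_ge L M' 1 r (tuples (univ M') 1))"

text \<open>\<open>has_morley_rank L M r\<close>: the Morley rank of \<open>M\<close> is the ordinal \<open>r\<close>. The type \<open>'o option\<close> has room
  for the successor of \<open>r\<close>. The rank is \<open>\<infinity>\<close> iff \<open>has_morley_rank L M r\<close> fails for all \<open>r\<close> in all types.\<close>

definition has_morley_rank :: "('f, 'r) signature \<Rightarrow> ('f, 'r, 'a) fostruct \<Rightarrow> 'o rel \<Rightarrow> bool" where
  "has_morley_rank L M r \<longleftrightarrow> Well_order r \<and> morley_rank_ge L M r \<and>
     (\<forall>s :: 'o option rel. r <o s \<longrightarrow> \<not> morley_rank_ge L M s)"

definition finite_morley_rank :: "('f, 'r) signature \<Rightarrow> ('f, 'r, 'a) fostruct \<Rightarrow> bool" where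
  "finite_morley_rank L M \<longleftrightarrow> (\<exists>n. has_morley_rank L M (natLeq_on n))"

text \<open>All models of a complete theory have the same Morley rank, so it may be read off from the models
  in the type used for \<^const>\<open>consistent\<close>.\<close>

definition theory_has_morley_rank :: "('f, 'r) signature \<Rightarrow> ('f, 'r) fm set \<Rightarrow> 'o rel \<Rightarrow> bool" where
  "theory_has_morley_rank L T r \<longleftrightarrow>
     (\<forall>M :: ('f, 'r, ('f, 'r) fm) fostruct. models L M T \<longrightarrow> has_morley_rank L M r)"

definition theory_finite_morley_rank :: "('f, 'r) signature \<Rightarrow> ('f, 'r) fm set \<Rightarrow> bool" where
  "theory_finite_morley_rank L T \<longleftrightarrow> (\<exists>n. theory_has_morley_rank L T (natLeq_on n))"

end

theory Submission
  imports Defs "HOL-Library.Nat_Bijection"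
begin

text \<open>Iterating an ultrapower with a regular ultrafilter \<open>\<omega>\<close> times, for \<open>M\<close> and \<open>N\<close> simultaneously,
  produces \<open>\<aleph>\<^sub>0\<close>-saturated structures between which the trace \<open>\<tau>\<close> extends. Pulling definable sets back
  along \<open>\<tau> : M \<rightarrow> N\<^sup>n\<close> shows that the rank of \<open>M\<close> is at most the rank of \<open>N\<^sup>n\<close>: disjoint subsets of \<open>M\<close>
  are traces of subsets of \<open>N\<^sup>n\<close> that can be made disjoint. If \<open>N\<close> has rank \<open>\<alpha>\<close>, then \<open>N\<^sup>n\<close> has rank less than
  \<open>(\<alpha> + 1)\<^sup>n\<close> by an inequality of Erimbetov: generic fibers of a set \<open>X \<subseteq> N \<times> N\<^sup>k\<close> of large rank over a
  set of degree one have large rank themselves. That bound is below \<open>\<alpha>\<^sup>\<omega>\<close> for \<open>\<alpha> \<ge> 2\<close> and finite for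
  finite \<open>\<alpha>\<close>. Ranks computed in elementarily equivalent saturated structures agree by a
  back-and-forth argument, and a saturated extension in the prescribed type is cut out of the
  iterated ultrapower as a Skolem hull.\<close>

section \<open>Formulas\<close>

text \<open>One ultrapower by a regular ultrafilter realises types over the original structure, but
  types over its new elements would call for a better ultrafilter. Iteration avoids this: finitely
  many parameters always appear at a finite stage. Both powers use the same index set, because the
  trace is extended by applying \<open>\<tau>\<close> at each index. No ordinal arithmetic is
  carried out. A rank is a position in some well-order, and positions in different orders are
  compared by strictly increasing maps. The product inequality therefore asks only for a map
  \<open>J\<close> on pairs that is strictly increasing in the lexicographic sense; it is realised
  once on natural numbers and once by the coordinates of \<open>\<alpha>^\<omega>\<close>. The bases
  0 and 1 need separate treatment: if \<open>N\<close> has rank 1, its powers reach every finite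
  rank, while \<open>1^\<omega> = 1\<close>, so only finiteness can be claimed there. The bound in
  natural numbers serves these bases and also the statement about theories.\<close>

abbreviation asg :: "('f, 'r, 'a) fostruct \<Rightarrow> (nat \<Rightarrow> 'a) \<Rightarrow> bool" where
  "asg M e \<equiv> range e \<subseteq> univ M"

abbreviation cart :: "('f, 'r, 'a) fostruct \<Rightarrow> nat \<Rightarrow> 'a list set" where
  "cart M n \<equiv> tuples (univ M) n"

lemma finite_fv_tm: "finite (fv_tm t)"
  by (induction t) auto

lemma finite_fv [simp]: "finite (fv \<phi>)"
  by (induction \<phi>) (auto simp: finite_fv_tm)

lemma fv_bounded: obtains K where "m \<le> K" "fv \<phi> \<subseteq> {..<K::nat}"
proof -
  obtain K where "\<forall>i\<in>fv \<phi>. i < K"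
    using finite_nat_set_iff_bounded finite_fv by blast
  then have "fv \<phi> \<subseteq> {..<max m K}" by (auto simp: less_max_iff_disj)
  then show thesis using that[of "max m K"] by simp
qed

lemma eval_tm_cong: "(\<And>i. i \<in> fv_tm t \<Longrightarrow> e i = e' i) \<Longrightarrow> eval_tm M e t = eval_tm M e' t"
proof (induction t)
  case (Fn f ts)
  then have "map (eval_tm M e) ts = map (eval_tm M e') ts" by auto
  then show ?case by (simp only: eval_tm.simps)
qed simp

lemma sat_cong: "(\<And>i. i \<in> fv \<phi> \<Longrightarrow> e i = e' i) \<Longrightarrow> sat M e \<phi> = sat M e' \<phi>"
proof (induction \<phi> arbitrary: e e')
  case (Eql s t)
  then show ?case using eval_tm_cong[of s e e' M] eval_tm_cong[of t e e' M] by simp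
next
  case (Rl p ts)
  then have "map (eval_tm M e) ts = map (eval_tm M e') ts"
    by (auto intro!: eval_tm_cong)
  then show ?case by (simp only: sat.simps)
next
  case (Ex i \<phi>)
  have "sat M (e(i := a)) \<phi> = sat M (e'(i := a)) \<phi>" for a
    using Ex.prems by (intro Ex.IH) auto
  then show ?case by simp
next
  case (Conj \<phi> \<psi>)
  have "sat M e \<phi> = sat M e' \<phi>" "sat M e \<psi> = sat M e' \<psi>"
    by (rule Conj.IH, simp add: Conj.prems)+
  then show ?case by simp
next
  case (Neg \<phi>)
  have "sat M e \<phi> = sat M e' \<phi>" using Neg.prems by (intro Neg.IH) auto
  then show ?case by simp
qed

lemma eval_tm_in_univ:
  assumes "is_fostruct L M"
  shows "wf_tm L t \<Longrightarrow> (\<And>i. i \<in> fv_tm t \<Longrightarrow> e i \<in> univ M) \<Longrightarrow> eval_tm M e t \<in> univ M"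
proof (induction t)
  case (Fn f ts)
  then have "set (map (eval_tm M e) ts) \<subseteq> univ M" by auto
  moreover have "(f, length ts) \<in> funs L" using Fn.prems by simp
  ultimately show ?case
    using assms unfolding is_fostruct_def by (fastforce simp del: set_map)
qed simp

section \<open>Renaming variables and quantifier blocks\<close>

fun ren_tm :: "(nat \<Rightarrow> nat) \<Rightarrow> 'f tm \<Rightarrow> 'f tm" where
  "ren_tm f (Var i) = Var (f i)"
| "ren_tm f (Fn g ts) = Fn g (map (ren_tm f) ts)"

text \<open>Bound variables are renamed as well. For injective \<open>f\<close> nothing can be
  captured, so no substitution apparatus is required.\<close>

fun ren :: "(nat \<Rightarrow> nat) \<Rightarrow> ('f, 'r) fm \<Rightarrow> ('f, 'r) fm" where
  "ren f (Eql s t) = Eql (ren_tm f s) (ren_tm f t)"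
| "ren f (Rl p ts) = Rl p (map (ren_tm f) ts)"
| "ren f (Neg \<phi>) = Neg (ren f \<phi>)"
| "ren f (Conj \<phi> \<psi>) = Conj (ren f \<phi>) (ren f \<psi>)"
| "ren f (Ex i \<phi>) = Ex (f i) (ren f \<phi>)"

lemma eval_ren_tm [simp]: "eval_tm M e (ren_tm f t) = eval_tm M (e \<circ> f) t"
proof (induction t)
  case (Fn g ts)
  then have "map (eval_tm M e) (map (ren_tm f) ts) = map (eval_tm M (e \<circ> f)) ts" by (simp add: comp_def)
  then show ?case by (simp only: eval_tm.simps ren_tm.simps)
qed simp

lemma sat_ren: "inj f \<Longrightarrow> sat M e (ren f \<phi>) = sat M (e \<circ> f) \<phi>"
proof (induction \<phi> arbitrary: e)
  case (Rl p ts)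
  have "map (eval_tm M e) (map (ren_tm f) ts) = map (eval_tm M (e \<circ> f)) ts" by (simp add: comp_def)
  then show ?case by (simp only: sat.simps ren.simps)
next
  case (Ex i \<phi>)
  have "e(f i := a) \<circ> f = (e \<circ> f)(i := a)" for a
    using Ex.prems by (auto simp: fun_eq_iff inj_def)
  then have "sat M (e(f i := a)) (ren f \<phi>) = sat M ((e \<circ> f)(i := a)) \<phi>" for a
    using Ex by metis
  then show ?case by (simp add: comp_def)
qed auto

lemma wf_ren_tm [simp]: "wf_tm L (ren_tm f t) = wf_tm L t"
  by (induction t) auto

lemma wf_ren [simp]: "wf_fm L (ren f \<phi>) = wf_fm L \<phi>"
  by (induction \<phi>) auto

lemma fv_ren_tm [simp]: "fv_tm (ren_tm f t) = f ` fv_tm t"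
  by (induction t) auto

lemma fv_ren: "inj f \<Longrightarrow> fv (ren f \<phi>) = f ` fv \<phi>"
proof (induction \<phi>)
  case (Ex i \<phi>)
  then show ?case by (auto simp: inj_def)
qed (auto simp: image_UN)

definition ovr :: "nat \<Rightarrow> 'a list \<Rightarrow> (nat \<Rightarrow> 'a) \<Rightarrow> nat \<Rightarrow> 'a" where
  "ovr m xs e = (\<lambda>i. if i < m then xs ! i else e i)"

lemma ovr_0 [simp]: "ovr 0 xs e = e"
  by (simp add: ovr_def)

lemma ovr_1 [simp]: "ovr (Suc 0) [a] e = e(0 := a)"
  by (auto simp: ovr_def)

lemma range_ovr: "xs \<in> tuples U m \<Longrightarrow> range e \<subseteq> U \<Longrightarrow> range (ovr m xs e) \<subseteq> U"
  unfolding tuples_def ovr_def by (auto dest: nth_mem)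

lemma tuples_0 [simp]: "tuples U 0 = {[]}"
  by (auto simp: tuples_def)

lemma tuples_Suc: "tuples U (Suc m) = {a # xs | a xs. a \<in> U \<and> xs \<in> tuples U m}"
  by (auto simp: tuples_def length_Suc_conv)

lemma tuples_1: "tuples U (Suc 0) = {[a] | a. a \<in> U}"
  by (auto simp: tuples_Suc)

fun exs :: "nat \<Rightarrow> ('f, 'r) fm \<Rightarrow> ('f, 'r) fm" where
  "exs 0 \<phi> = \<phi>"
| "exs (Suc m) \<phi> = exs m (Ex m \<phi>)"

lemma tuples_snoc: "tuples U (Suc m) = {xs @ [a] | a xs. a \<in> U \<and> xs \<in> tuples U m}" (is "?l = ?r")
proof
  show "?l \<subseteq> ?r"
  proof
    fix ys assume "ys \<in> ?l"
    then have "ys = butlast ys @ [last ys]" "last ys \<in> U" "butlast ys \<in> tuples U m"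
      by (auto simp: tuples_def length_Suc_conv_rev)
    then show "ys \<in> ?r" by blast
  qed
qed (auto simp: tuples_def)

lemma sat_exs: "sat M e (exs m \<phi>) \<longleftrightarrow> (\<exists>xs\<in>cart M m. sat M (ovr m xs e) \<phi>)"
proof (induction m arbitrary: \<phi>)
  case (Suc m)
  have "(ovr m xs e)(m := a) = ovr (Suc m) (xs @ [a]) e" if "xs \<in> cart M m" for xs a
    using that by (auto simp: ovr_def tuples_def fun_eq_iff nth_append)
  then have "sat M e (exs (Suc m) \<phi>) \<longleftrightarrow>
      (\<exists>xs\<in>cart M m. \<exists>a\<in>univ M. sat M (ovr (Suc m) (xs @ [a]) e) \<phi>)"
    using Suc by simp
  also have "\<dots> \<longleftrightarrow> (\<exists>xs\<in>cart M (Suc m). sat M (ovr (Suc m) xs e) \<phi>)"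
    unfolding tuples_snoc by blast
  finally show ?case .
qed auto

lemma wf_exs [simp]: "wf_fm L (exs m \<phi>) = wf_fm L \<phi>"
  by (induction m arbitrary: \<phi>) auto

lemma fv_exs [simp]: "fv (exs m \<phi>) = fv \<phi> - {..<m}"
  by (induction m arbitrary: \<phi>) auto

text \<open>There is no truth constant, so the empty conjunction is \<open>v = v\<close>. The caller
  chooses a \<open>v\<close> that it quantifies anyway, which keeps the free variables under
  control.\<close>

fun conjs :: "nat \<Rightarrow> ('f, 'r) fm list \<Rightarrow> ('f, 'r) fm" where
  "conjs v [] = Eql (Var v) (Var v)"
| "conjs v (\<phi> # \<phi>s) = Conj \<phi> (conjs v \<phi>s)"

lemma sat_conjs [simp]: "sat M e (conjs v \<phi>s) \<longleftrightarrow> (\<forall>\<phi>\<in>set \<phi>s. sat M e \<phi>)"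
  by (induction \<phi>s) auto

lemma wf_conjs [simp]: "wf_fm L (conjs v \<phi>s) \<longleftrightarrow> (\<forall>\<phi>\<in>set \<phi>s. wf_fm L \<phi>)"
  by (induction \<phi>s) auto

lemma fv_conjs [simp]: "fv (conjs v \<phi>s) = insert v (\<Union>\<phi>\<in>set \<phi>s. fv \<phi>)"
  by (induction \<phi>s) auto

section \<open>Definable sets\<close>

definition dset :: "('f, 'r, 'a) fostruct \<Rightarrow> nat \<Rightarrow> ('f, 'r) fm \<Rightarrow> (nat \<Rightarrow> 'a) \<Rightarrow> 'a list set" where
  "dset M m \<phi> e = {xs \<in> cart M m. sat M (ovr m xs e) \<phi>}"

lemma definable_iff:
  "definable L M m X \<longleftrightarrow> (\<exists>\<phi> e. wf_fm L \<phi> \<and> asg M e \<and> X = dset M m \<phi> e)"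
  unfolding definable_def dset_def ovr_def ..

lemma definable_dset: "wf_fm L \<phi> \<Longrightarrow> asg M e \<Longrightarrow> definable L M m (dset M m \<phi> e)"
  by (auto simp: definable_iff)

lemma definable_subset: "definable L M m X \<Longrightarrow> X \<subseteq> cart M m"
  by (auto simp: definable_iff dset_def)

lemma dset_cong: "(\<And>i. i \<in> fv \<phi> \<Longrightarrow> m \<le> i \<Longrightarrow> e i = e' i) \<Longrightarrow> dset M m \<phi> e = dset M m \<phi> e'"
  unfolding dset_def by (intro Collect_cong conj_cong refl sat_cong) (auto simp: ovr_def)

lemma dset_ren:
  assumes "inj f" "\<And>i. i < m \<Longrightarrow> f i = i" "\<And>i. m \<le> i \<Longrightarrow> m \<le> f i" "\<And>i. m \<le> i \<Longrightarrow> E (f i) = e i"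
  shows "dset M m (ren f \<phi>) E = dset M m \<phi> e"
proof -
  have "ovr m xs E \<circ> f = ovr m xs e" for xs
    using assms(2-4) by (simp add: fun_eq_iff ovr_def not_less) (metis leD not_le)
  then show ?thesis by (simp add: dset_def sat_ren[OF assms(1)])
qed

text \<open>Countably many definable sets can share one assignment: the pairing function gives the
  parameters of each \<open>F i\<close> variables of their own from \<open>K\<close> on, and the
  variables below \<open>K\<close> keep the values of \<open>e0\<close>.\<close>

lemma definable_common:
  fixes F :: "nat \<Rightarrow> 'a list set" and e0 :: "nat \<Rightarrow> 'a"
  assumes "\<And>i. definable L M m (F i)" "asg M e0" "m \<le> K"
  obtains \<psi> E where "\<And>i. wf_fm L (\<psi> i)" "asg M E" "\<And>i. i < K \<Longrightarrow> E i = e0 i"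
    "\<And>i. F i = dset M m (\<psi> i) E"
proof -
  have "\<forall>i. \<exists>\<phi> e. wf_fm L \<phi> \<and> asg M e \<and> F i = dset M m \<phi> e"
    using assms(1) by (simp add: definable_iff)
  then obtain \<phi> e where *: "\<And>i. wf_fm L (\<phi> i)" "\<And>i. asg M (e i)"
    "\<And>i. F i = dset M m (\<phi> i) (e i)" by metis
  define f where "f i j = (if j < m then j else K + prod_encode (i, j))" for i j
  define E where "E j = (if j < K then e0 j else case prod_decode (j - K) of (i, j) \<Rightarrow> e i j)" for j
  have "inj (f i)" for i
    using assms(3) by (auto simp: inj_def f_def dest: prod_encode_eq[THEN iffD1])
  then have "F i = dset M m (ren (f i) (\<phi> i)) E" for i
    unfolding *(3) using assms(3) by (intro dset_ren[symmetric]) (auto simp: f_def E_def)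
  moreover have "asg M E"
    using *(2) assms(2) by (auto simp: E_def image_subset_iff split: prod.split)
  ultimately show thesis
    using that[of "\<lambda>i. ren (f i) (\<phi> i)" E] *(1) by (simp add: E_def)
qed

lemma definable_pair:
  fixes X Y :: "'a list set"
  assumes "definable L M m X" "definable L M m Y"
  obtains \<phi> \<psi> E where "wf_fm L \<phi>" "wf_fm L \<psi>" "asg M E"
    "X = dset M m \<phi> E" "Y = dset M m \<psi> E"
proof -
  obtain e0 :: "nat \<Rightarrow> 'a" where e0: "asg M e0" using assms(1) by (auto simp: definable_iff)
  define F where "F i = (if i = 0 then X else Y)" for i :: nat
  have "definable L M m (F i)" for i using assms by (simp add: F_def)
  then show thesis
  proof (rule definable_common[OF _ e0 order.refl])
    fix \<psi> E
    assume *: "\<And>i. wf_fm L (\<psi> i)" "asg M E" "\<And>i. F i = dset M m (\<psi> i) E"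
    show thesis
      using that[OF *(1)[of 0] *(1)[of 1] *(2)] *(3)[of 0] *(3)[of 1] by (simp add: F_def)
  qed
qed

lemma dset_Conj: "dset M m (Conj \<phi> \<psi>) E = dset M m \<phi> E \<inter> dset M m \<psi> E"
  by (auto simp: dset_def)

lemma dset_Diff: "dset M m (Conj \<phi> (Neg \<psi>)) E = dset M m \<phi> E - dset M m \<psi> E"
  by (auto simp: dset_def)

lemma dset_Un: "dset M m (Neg (Conj (Neg \<phi>) (Neg \<psi>))) E = dset M m \<phi> E \<union> dset M m \<psi> E"
  by (auto simp: dset_def)

lemma definable_Int: "definable L M m X \<Longrightarrow> definable L M m Y \<Longrightarrow> definable L M m (X \<inter> Y)"
  by (rule definable_pair[of L M m X Y]) (simp_all add: dset_Conj[symmetric] definable_dset)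

lemma definable_Diff: "definable L M m X \<Longrightarrow> definable L M m Y \<Longrightarrow> definable L M m (X - Y)"
  by (rule definable_pair[of L M m X Y]) (simp_all add: dset_Diff[symmetric] definable_dset)

lemma definable_Un: "definable L M m X \<Longrightarrow> definable L M m Y \<Longrightarrow> definable L M m (X \<union> Y)"
  by (rule definable_pair[of L M m X Y]) (simp_all add: dset_Un[symmetric] definable_dset)

lemma definable_tuples:
  assumes "is_fostruct L M"
  shows "definable L M m (cart M m)"
proof -
  obtain a where "a \<in> univ M" using assms by (auto simp: is_fostruct_def)
  moreover have "cart M m = dset M m (Eql (Var 0) (Var 0)) (\<lambda>_. a)"
    by (auto simp: dset_def)
  ultimately show ?thesis by (auto intro: definable_dset)
qed

section \<open>Rank along a well-order\<close>

text \<open>For a strict well-order \<open>S\<close>, \<open>mr D S w X\<close> says that the rank of \<open>X\<close>, computed with the sets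
  satisfying \<open>D\<close>, is at least the order type of the elements below \<open>w\<close>. The zero, successor and limit
  clauses of \<^const>\<open>rank_ge\<close> are merged into one.\<close>

inductive mr :: "('x set \<Rightarrow> bool) \<Rightarrow> 'w rel \<Rightarrow> 'w \<Rightarrow> 'x set \<Rightarrow> bool" for D S where
  mrI: "\<lbrakk>D X; X \<noteq> {};
         \<And>v. (v, w) \<in> S \<Longrightarrow> \<exists>F :: nat \<Rightarrow> 'x set.
           (\<forall>i. F i \<subseteq> X \<and> mr D S v (F i)) \<and> (\<forall>i j. i \<noteq> j \<longrightarrow> F i \<inter> F j = {})\<rbrakk>
        \<Longrightarrow> mr D S w X"

text \<open>For definable \<open>X\<close> this is rank at least \<open>v + 1\<close>. It makes
  sense even when \<open>v\<close> is the greatest element of \<open>S\<close>, so no larger order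
  has to be supplied to express the successor.\<close>

definition split :: "('x set \<Rightarrow> bool) \<Rightarrow> 'w rel \<Rightarrow> 'w \<Rightarrow> 'x set \<Rightarrow> bool" where
  "split D S v X \<longleftrightarrow> (\<exists>F :: nat \<Rightarrow> 'x set.
     (\<forall>i. F i \<subseteq> X \<and> mr D S v (F i)) \<and> (\<forall>i j. i \<noteq> j \<longrightarrow> F i \<inter> F j = {}))"

lemma mr_iff: "mr D S w X \<longleftrightarrow> D X \<and> X \<noteq> {} \<and> (\<forall>v. (v, w) \<in> S \<longrightarrow> split D S v X)"
proof
  assume "mr D S w X"
  then show "D X \<and> X \<noteq> {} \<and> (\<forall>v. (v, w) \<in> S \<longrightarrow> split D S v X)"
    by cases (simp add: split_def)
qed (auto intro: mrI simp: split_def)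

lemma mr_imp_D: "mr D S w X \<Longrightarrow> D X"
  and mr_nonempty: "mr D S w X \<Longrightarrow> X \<noteq> {}"
  by (simp_all add: mr_iff[of D S w X])

lemma split_mono: "split D S v X \<Longrightarrow> X \<subseteq> X' \<Longrightarrow> split D S v X'"
  unfolding split_def by (meson order.trans)

lemma mr_mono: "mr D S w X \<Longrightarrow> X \<subseteq> X' \<Longrightarrow> D X' \<Longrightarrow> mr D S w X'"
  unfolding mr_iff[of D S w] by (meson split_mono subset_empty)

lemma mr_downward: "trans S \<Longrightarrow> mr D S w X \<Longrightarrow> (v, w) \<in> S \<Longrightarrow> mr D S v X"
  unfolding mr_iff[of D S] by (meson transD)

lemma split_downward: "trans S \<Longrightarrow> split D S w X \<Longrightarrow> (v, w) \<in> S \<Longrightarrow> split D S v X"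
  unfolding split_def by (meson mr_downward)

lemma mr_imp_splitD: "mr D S w X \<Longrightarrow> (v, w) \<in> S \<Longrightarrow> split D S v X"
  by (simp add: mr_iff[of D S w])

text \<open>A strictly increasing map on the elements up to \<open>w\<close> shows that the order
  type below \<open>w\<close> in \<open>S'\<close> is at most the one below \<open>f w\<close> in
  \<open>S\<close>. The downward closed \<open>P\<close> restricts the demand on \<open>f\<close> to
  that part.\<close>

lemma mr_transport_on:
  assumes "\<And>u v. (u, v) \<in> S' \<Longrightarrow> P v \<Longrightarrow> P u \<and> (f u, f v) \<in> S" "wf S'" "P w" "mr D S (f w) X"
  shows "mr D S' w X"
  using assms(2-4)
proof (induction w arbitrary: X rule: wf_induct_rule)
  case (less w)
  have "split D S' v X" if v: "(v, w) \<in> S'" for v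
  proof -
    note Pv = assms(1)[OF v less.prems(1)]
    then show ?thesis
      using mr_imp_splitD[OF less.prems(2), of "f v"] less.IH[OF v] unfolding split_def by meson
  qed
  then show ?case using less.prems(2) by (subst mr_iff) (simp add: mr_imp_D mr_nonempty)
qed

lemma split_transport_on:
  assumes "\<And>u v. (u, v) \<in> S' \<Longrightarrow> P v \<Longrightarrow> P u \<and> (f u, f v) \<in> S" "wf S'" "P w" "split D S (f w) X"
  shows "split D S' w X"
  using assms(4) mr_transport_on[of S' P f S, OF assms(1,2,3)] unfolding split_def by meson

lemma split_transport:
  "(\<And>u v. (u, v) \<in> S' \<Longrightarrow> (f u, f v) \<in> S) \<Longrightarrow> wf S' \<Longrightarrow> split D S (f w) X \<Longrightarrow> split D S' w X"
  by (rule split_transport_on[where P = "\<lambda>_. True"]) auto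

definition strict_wo :: "'w rel \<Rightarrow> bool" where
  "strict_wo S \<longleftrightarrow> wf S \<and> trans S \<and> total_on (Field S) S"

lemma strict_wo_Well_order: "Well_order r \<Longrightarrow> strict_wo (r - Id)"
proof -
  assume r: "Well_order r"
  then have "trans r" "antisym r" "total_on (Field r) r"
    by (auto simp: order_on_defs)
  moreover from this have "trans (r - Id)"
    by (simp add: trans_diff_Id)
  moreover have "Field (r - Id) \<subseteq> Field r" by (auto simp: Field_def)
  ultimately show ?thesis
    using r unfolding strict_wo_def well_order_on_def total_on_def by (metis DiffI IdD in_mono pair_in_Id_conv)
qed

locale set_algebra =
  fixes D :: "'x set \<Rightarrow> bool"
  assumes D_Int: "D A \<Longrightarrow> D B \<Longrightarrow> D (A \<inter> B)"
    and D_Diff: "D A \<Longrightarrow> D B \<Longrightarrow> D (A - B)"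
    and D_Un: "D A \<Longrightarrow> D B \<Longrightarrow> D (A \<union> B)"
begin

lemma infinite_subfamily:
  fixes F :: "nat \<Rightarrow> 'x set"
  assumes "infinite I" "\<And>i. i \<in> I \<Longrightarrow> F i \<subseteq> X \<and> mr D S v (F i)"
    "\<And>i j. i \<noteq> j \<Longrightarrow> F i \<inter> F j = {}"
  shows "split D S v X"
proof -
  obtain g :: "nat \<Rightarrow> nat" where g: "inj g" "range g \<subseteq> I"
    using assms(1) infinite_countable_subset by blast
  have "F (g i) \<inter> F (g j) = {}" if "i \<noteq> j" for i j
    using g(1) that by (intro assms(3)) (simp add: inj_eq)
  moreover have "F (g i) \<subseteq> X \<and> mr D S v (F (g i))" for i
    using g(2) by (intro assms(2)) auto
  ultimately show ?thesis
    unfolding split_def by (intro exI[of _ "F \<circ> g"]) simp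
qed

text \<open>By induction each of infinitely many pieces of rank \<open>v\<close> keeps rank
  \<open>v\<close> inside \<open>X\<close> or inside \<open>Y\<close>, and one of the two cases
  occurs infinitely often. So for every \<open>v\<close> below \<open>w\<close> one of the sets
  splits at \<open>v\<close>; linearity makes the choice uniform.\<close>

lemma mr_Un:
  assumes "strict_wo S"
  shows "mr D S w (X \<union> Y) \<Longrightarrow> D X \<Longrightarrow> D Y \<Longrightarrow> mr D S w X \<or> mr D S w Y"
  using assms[unfolded strict_wo_def, THEN conjunct1]
proof (induction w arbitrary: X Y rule: wf_induct_rule)
  case (less w)
  have tr: "trans S" and tot: "total_on (Field S) S" using assms by (auto simp: strict_wo_def)
  have key: "split D S v X \<or> split D S v Y" if v: "(v, w) \<in> S" for v
  proof -
    from mr_imp_splitD[OF less.prems(1) v] obtain F :: "nat \<Rightarrow> 'x set" where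
      F: "\<And>i. F i \<subseteq> X \<union> Y" "\<And>i. mr D S v (F i)" "\<And>i j. i \<noteq> j \<Longrightarrow> F i \<inter> F j = {}"
      unfolding split_def by blast
    have "mr D S v (F i \<inter> X) \<or> mr D S v (F i \<inter> Y)" for i
    proof (rule less.IH[OF v])
      have "F i \<inter> X \<union> F i \<inter> Y = F i" using F(1)[of i] by blast
      then show "mr D S v (F i \<inter> X \<union> F i \<inter> Y)" using F(2) by simp
    qed (use F(2) less.prems in \<open>auto intro: D_Int mr_imp_D\<close>)
    then have "UNIV = {i. mr D S v (F i \<inter> X)} \<union> {i. mr D S v (F i \<inter> Y)}" by auto
    then have "infinite {i. mr D S v (F i \<inter> X)} \<or> infinite {i. mr D S v (F i \<inter> Y)}"
      by (metis finite_Un infinite_UNIV_nat)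
    then show ?thesis
    proof
      assume "infinite {i. mr D S v (F i \<inter> X)}"
      then have "split D S v X"
        by (rule infinite_subfamily[where F = "\<lambda>i. F i \<inter> X"]) (use F(3) in auto)
      then show ?thesis ..
    next
      assume "infinite {i. mr D S v (F i \<inter> Y)}"
      then have "split D S v Y"
        by (rule infinite_subfamily[where F = "\<lambda>i. F i \<inter> Y"]) (use F(3) in auto)
      then show ?thesis ..
    qed
  qed
  show ?case
  proof (rule ccontr)
    assume not: "\<not> (mr D S w X \<or> mr D S w Y)"
    show False
    proof (cases "X = {} \<or> Y = {}")
      case True
      then show False using not less.prems by auto
    next
      case False
      then obtain u v where uv: "(u, w) \<in> S" "\<not> split D S u X" "(v, w) \<in> S" "\<not> split D S v Y"
        using not less.prems(2,3) unfolding mr_iff[of D S w] by blast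
      \<comment> \<open>If \<open>X\<close> fails to split at \<open>u\<close> and \<open>Y\<close>
        at \<open>v\<close>, then at the larger of the two points neither splits, against
        \<open>key\<close>.\<close>
      then have "u = v \<or> (u, v) \<in> S \<or> (v, u) \<in> S"
        using tot unfolding total_on_def Field_def by blast
      then show False using key uv split_downward[OF tr] by blast
    qed
  qed
qed

lemma mr_finite_Union:
  assumes "strict_wo S" "finite \<X>" "\<And>X. X \<in> \<X> \<Longrightarrow> D X" "mr D S w Y" "Y \<subseteq> \<Union>\<X>"
  shows "\<exists>X\<in>\<X>. mr D S w (Y \<inter> X)"
  using assms(2-5)
proof (induction \<X> arbitrary: Y)
  case empty
  then show ?case using mr_nonempty[of D S w Y] by simp
next
  case (insert Z \<X>)
  have D: "D Y" "D Z" using insert.prems(1,2) mr_imp_D[of D S w Y] by simp_all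
  have "Y = (Y \<inter> Z) \<union> (Y - Z)" by blast
  then have "mr D S w (Y \<inter> Z) \<or> mr D S w (Y - Z)"
    using mr_Un[OF assms(1), of w "Y \<inter> Z" "Y - Z"] insert.prems(2) D_Int[OF D] D_Diff[OF D] by simp
  then show ?case
  proof
    assume *: "mr D S w (Y - Z)"
    have "Y - Z \<subseteq> \<Union>\<X>" using insert.prems(3) by auto
    from insert.IH[OF _ * this] insert.prems(1)
    obtain X where X: "X \<in> \<X>" "mr D S w ((Y - Z) \<inter> X)" by auto
    have "mr D S w (Y \<inter> X)"
      by (rule mr_mono[OF X(2)]) (use insert.prems(1) X(1) D_Int[OF D(1)] in auto)
    then show ?thesis using X(1) by blast
  next
    assume "mr D S w (Y \<inter> Z)"
    then show ?thesis by simp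
  qed
qed

text \<open>Repeating the step gives a decreasing chain whose successive differences are disjoint
  and of rank at least \<open>w\<close>. The invariant \<open>P\<close> carries whatever allows the
  peeling to go on.\<close>

lemma split_peel:
  assumes P: "P X" and D: "\<And>Z. P Z \<Longrightarrow> D Z"
    and step: "\<And>Z. P Z \<Longrightarrow> Z \<subseteq> X \<Longrightarrow> \<exists>Z'\<subseteq>Z. P Z' \<and> mr D S w (Z - Z')"
  shows "split D S w X"
proof -
  define Z where "Z = rec_nat X (\<lambda>_ Z. SOME Z'. Z' \<subseteq> Z \<and> P Z' \<and> mr D S w (Z - Z'))"
  have Z: "P (Z n) \<and> Z n \<subseteq> X \<and> Z (Suc n) \<subseteq> Z n \<and> mr D S w (Z n - Z (Suc n))" for n
  proof (induction n)
    case 0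
    then show ?case
      using someI_ex[of "\<lambda>Z'. Z' \<subseteq> X \<and> P Z' \<and> mr D S w (X - Z')"] step[OF P] P
      by (auto simp: Z_def)
  next
    case (Suc n)
    have "Z (Suc n) = (SOME Z'. Z' \<subseteq> Z n \<and> P Z' \<and> mr D S w (Z n - Z'))"
      "Z (Suc (Suc n)) = (SOME Z'. Z' \<subseteq> Z (Suc n) \<and> P Z' \<and> mr D S w (Z (Suc n) - Z'))"
      by (simp_all add: Z_def)
    moreover have "\<exists>Z'. Z' \<subseteq> Z n \<and> P Z' \<and> mr D S w (Z n - Z')" using step[of "Z n"] Suc by blast
    ultimately have *: "P (Z (Suc n))" "Z (Suc n) \<subseteq> X"
      using someI_ex[of "\<lambda>Z'. Z' \<subseteq> Z n \<and> P Z' \<and> mr D S w (Z n - Z')"] Suc by auto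
    then have "\<exists>Z'. Z' \<subseteq> Z (Suc n) \<and> P Z' \<and> mr D S w (Z (Suc n) - Z')"
      using step[of "Z (Suc n)"] by blast
    from someI_ex[OF this] * show ?case
      using \<open>Z (Suc (Suc n)) = _\<close> by auto
  qed
  have mono: "Z j \<subseteq> Z i" if "i \<le> j" for i j
    using that by (induction rule: dec_induct) (use Z in blast)+
  have "(Z i - Z (Suc i)) \<inter> (Z j - Z (Suc j)) = {}" if "i < j" for i j
    using mono[of "Suc i" j] that by auto
  then have "(Z i - Z (Suc i)) \<inter> (Z j - Z (Suc j)) = {}" if "i \<noteq> j" for i j
    using that by (metis Int_commute linorder_neqE_nat)
  then show ?thesis
    unfolding split_def using Z by (intro exI[of _ "\<lambda>i. Z i - Z (Suc i)"]) blast
qed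

text \<open>Finiteness of the Morley degree: if \<open>X\<close> did not split infinitely, then of two halves of \<open>X\<close> one
  would again contain arbitrarily many disjoint pieces, and it could be halved again and again.\<close>

lemma split_if_arbitrarily_many:
  assumes S: "strict_wo S" and X: "D X"
    and many: "\<And>n. \<exists>F :: nat \<Rightarrow> 'x set. (\<forall>i<n. F i \<subseteq> X \<and> mr D S w (F i)) \<and>
      (\<forall>i<n. \<forall>j<n. i \<noteq> j \<longrightarrow> F i \<inter> F j = {})"
  shows "split D S w X"
proof -
  \<comment> \<open>Families over an arbitrary finite index set with at least \<open>n\<close>
    elements pass to subfamilies without renumbering.\<close>
  define many where "many n Z \<longleftrightarrow> (\<exists>I (F :: nat \<Rightarrow> 'x set). finite I \<and> n \<le> card I \<and>
      (\<forall>i\<in>I. F i \<subseteq> Z \<and> mr D S w (F i)) \<and> (\<forall>i\<in>I. \<forall>j\<in>I. i \<noteq> j \<longrightarrow> F i \<inter> F j = {}))" for n Z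
  let ?P = "\<lambda>Z. D Z \<and> (\<forall>n. many n Z)"
  have "?P X"
  proof (intro conjI allI)
    fix n
    from assms(3)[of n] obtain F :: "nat \<Rightarrow> 'x set" where "(\<forall>i<n. F i \<subseteq> X \<and> mr D S w (F i)) \<and>
      (\<forall>i<n. \<forall>j<n. i \<noteq> j \<longrightarrow> F i \<inter> F j = {})" ..
    then show "many n X"
      unfolding many_def by (intro exI[of _ "{..<n}"] exI[of _ F]) simp
  qed (rule X)
  have many_mono: "many n Z" if "many n' Z" "n \<le> n'" for n n' Z
    using that unfolding many_def by (meson order.trans)
  have halve: "\<exists>Z'\<subseteq>Z. ?P Z' \<and> mr D S w (Z - Z')" if Z: "?P Z" for Z
  proof -
    from Z have "many 2 Z" by blast
    then obtain I and F :: "nat \<Rightarrow> 'x set" where F: "finite I" "2 \<le> card I"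
      "\<forall>i\<in>I. F i \<subseteq> Z \<and> mr D S w (F i)" "\<forall>i\<in>I. \<forall>j\<in>I. i \<noteq> j \<longrightarrow> F i \<inter> F j = {}"
      unfolding many_def by blast
    have "\<not> card I \<le> Suc 0" using F(2) by simp
    then obtain i j where ij: "i \<in> I" "j \<in> I" "i \<noteq> j"
      using card_le_Suc0_iff_eq[OF F(1)] by auto
    \<comment> \<open>\<open>A\<close> and \<open>Z - A\<close> both have rank at least
      \<open>w\<close>, the latter because it contains \<open>F j\<close>. So either may be peeled
      off; the one to keep is the one that still has arbitrarily many pieces.\<close>
    define A where "A = F i"
    have A: "D A" "A \<subseteq> Z" "mr D S w A" using F(3) ij(1) mr_imp_D[of D S w "F i"] by (auto simp: A_def)
    have DZ: "D Z" using Z by blast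
    have ZA: "mr D S w (Z - A)"
      by (rule mr_mono[of _ _ _ "F j"]) (use F(3) ij F(4)[rule_format, OF ij] D_Diff[OF DZ A(1)] in \<open>auto simp: A_def\<close>)
    have half: "many n A \<or> many n (Z - A)" for n
    proof -
      have "many (2 * n) Z" using Z by blast
      then obtain I and G :: "nat \<Rightarrow> 'x set" where G: "finite I" "2 * n \<le> card I"
        "\<forall>i\<in>I. G i \<subseteq> Z \<and> mr D S w (G i)" "\<forall>i\<in>I. \<forall>j\<in>I. i \<noteq> j \<longrightarrow> G i \<inter> G j = {}"
        unfolding many_def by blast
      define I1 where "I1 = {i \<in> I. mr D S w (G i \<inter> A)}"
      define I2 where "I2 = {i \<in> I. mr D S w (G i - A)}"
      have "mr D S w (G i \<inter> A) \<or> mr D S w (G i - A)" if "i \<in> I" for i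
      proof -
        have "mr D S w (G i)" using G(3) that by blast
        then show ?thesis
          using mr_Un[OF S, of w "G i \<inter> A" "G i - A"] D_Int[of "G i" A] D_Diff[of "G i" A] A(1)
            mr_imp_D[of D S w "G i"] by (simp add: Int_Diff_Un)
      qed
      then have "I = I1 \<union> I2" by (auto simp: I1_def I2_def)
      then have "card I \<le> card I1 + card I2" by (simp add: card_Un_le)
      then have "n \<le> card I1 \<or> n \<le> card I2" using G(2) by linarith
      then show ?thesis
      proof
        assume "n \<le> card I1"
        then have "many n A"
          unfolding many_def
          by (intro exI[of _ I1] exI[of _ "\<lambda>i. G i \<inter> A"] conjI ballI impI)
             (use G(1,3,4) in \<open>simp_all add: I1_def\<close>, blast+)
        then show ?thesis ..
      next
        assume "n \<le> card I2"
        then have "many n (Z - A)"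
          unfolding many_def
          by (intro exI[of _ I2] exI[of _ "\<lambda>i. G i - A"] conjI ballI impI)
             (use G(1,3,4) in \<open>simp_all add: I2_def\<close>, blast+)
        then show ?thesis ..
      qed
    qed
    \<comment> \<open>Failure at some \<open>n\<close> persists for all larger numbers, so the two
      sides cannot both fail.\<close>
    have "(\<forall>n. many n A) \<or> (\<forall>n. many n (Z - A))"
      using half many_mono by (meson le_cases)
    then show ?thesis
    proof
      assume "\<forall>n. many n A"
      then show ?thesis using A ZA by (intro exI[of _ A]) auto
    next
      assume "\<forall>n. many n (Z - A)"
      moreover have "Z - (Z - A) = A" using A(2) by blast
      ultimately show ?thesis using A D_Diff[OF DZ A(1)] by (intro exI[of _ "Z - A"]) auto
    qed
  qed
  show ?thesis by (rule split_peel[of ?P, OF \<open>?P X\<close>]) (use halve in auto)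
qed

end

abbreviation dmr :: "('f, 'r) signature \<Rightarrow> ('f, 'r, 'a) fostruct \<Rightarrow> nat \<Rightarrow> 'w rel \<Rightarrow> 'w \<Rightarrow> 'a list set \<Rightarrow> bool"
  where "dmr L M m \<equiv> mr (definable L M m)"

abbreviation dsplit :: "('f, 'r) signature \<Rightarrow> ('f, 'r, 'a) fostruct \<Rightarrow> nat \<Rightarrow> 'w rel \<Rightarrow> 'w \<Rightarrow> 'a list set \<Rightarrow> bool"
  where "dsplit L M m \<equiv> split (definable L M m)"

lemma set_algebra_definable: "set_algebra (definable L M m)"
  by unfold_locales (auto intro: definable_Int definable_Diff definable_Un)

section \<open>Pulling back along a trace\<close>

text \<open>The induction runs over every \<open>Y\<close> that contains the image of
  \<open>X\<close>, because of the disjoint sets built in the target it is only known that they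
  contain the images of the pieces.\<close>

lemma mr_trace:
  fixes t :: "'x \<Rightarrow> 'y"
  assumes E: "set_algebra E" and U: "\<And>X. D X \<Longrightarrow> X \<subseteq> U"
    and tr: "\<And>X. D X \<Longrightarrow> \<exists>Y. E Y \<and> X = {x \<in> U. t x \<in> Y}"
  shows "mr D S w X \<Longrightarrow> E Y \<Longrightarrow> t ` X \<subseteq> Y \<Longrightarrow> mr E S w Y"
proof (induction arbitrary: Y rule: mr.induct)
  case (mrI X w)
  interpret set_algebra E by (rule E)
  have "split E S v Y" if "(v, w) \<in> S" for v
  proof -
    from mrI.IH[OF that] obtain F :: "nat \<Rightarrow> 'x set" where
      F0: "\<forall>i. F i \<subseteq> X \<and> mr D S v (F i) \<and> (\<forall>Y. E Y \<longrightarrow> t ` F i \<subseteq> Y \<longrightarrow> mr E S v Y)"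
        "\<forall>i j. i \<noteq> j \<longrightarrow> F i \<inter> F j = {}"
      by blast
    then have F: "\<And>i. F i \<subseteq> X" "\<And>i. mr D S v (F i)"
      "\<And>i Y. E Y \<Longrightarrow> t ` F i \<subseteq> Y \<Longrightarrow> mr E S v Y" "\<And>i j. i \<noteq> j \<Longrightarrow> F i \<inter> F j = {}"
      by simp_all
    have "\<forall>i. \<exists>G. E G \<and> F i = {x \<in> U. t x \<in> G}" using tr mr_imp_D[OF F(2)] by blast
    then obtain G where G: "\<And>i. E (G i)" "\<And>i. F i = {x \<in> U. t x \<in> G i}" by metis
    \<comment> \<open>The \<open>G i\<close> may overlap, but not on the images of the pieces: a
      point of \<open>F i\<close> lies in no other \<open>F j\<close>, so its image lies in no other
      \<open>G j\<close>. Removing the earlier \<open>G j\<close> thus keeps the image of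
      \<open>F i\<close>.\<close>
    define H where "H i = Y \<inter> G i - (\<Union>j<i. G j)" for i
    have DH: "E (Y \<inter> G i - (\<Union>j<n. G j))" for i n
    proof (induction n)
      case (Suc n)
      have "Y \<inter> G i - (\<Union>j<Suc n. G j) = (Y \<inter> G i - (\<Union>j<n. G j)) - G n"
        by (auto simp: less_Suc_eq)
      then show ?case using Suc G(1) D_Diff by simp
    qed (simp add: D_Int mrI.prems G)
    have "t ` F i \<subseteq> H i" for i
    proof
      fix y assume "y \<in> t ` F i"
      then obtain x where x: "x \<in> F i" "y = t x" by blast
      have "t x \<notin> G j" if "j < i" for j
        using F(4)[of i j] that x(1) G(2)[of j] G(2)[of i] by auto
      moreover have "t x \<in> Y" using x F(1) mrI.prems by blast
      ultimately show "y \<in> H i" using x G(2)[of i] by (auto simp: H_def)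
    qed
    then have "mr E S v (H i)" for i
      using F(3)[of "H i" i] DH[of i i] by (simp add: H_def)
    moreover have "H i \<inter> H j = {}" if "i \<noteq> j" for i j
    proof (cases "i < j")
      case True
      then show ?thesis by (auto simp: H_def)
    next
      case False
      then have "j < i" using that by simp
      then show ?thesis by (auto simp: H_def)
    qed
    ultimately show ?thesis unfolding split_def by (intro exI[of _ H]) (auto simp: H_def)
  qed
  moreover have "Y \<noteq> {}" using mrI by blast
  ultimately show ?case using mrI.prems by (subst mr_iff) simp
qed

section \<open>Saturation and invariance of the rank\<close>

text \<open>Saturation is stated for the type variable 0. Conjugating with this transposition allows
  any variable \<open>k\<close> in that role.\<close>

definition swap :: "nat \<Rightarrow> nat \<Rightarrow> nat" where
  "swap k i = (if i = 0 then k else if i = k then 0 else i)"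

lemma inj_swap: "inj (swap k)"
  by (auto simp: inj_def swap_def split: if_splits)

lemma upd_swap: "((e \<circ> swap k)(0 := a)) \<circ> swap k = e(k := a)"
  by (auto simp: fun_eq_iff swap_def)

lemma sat_ren_swap: "sat M ((e \<circ> swap k)(0 := a)) (ren (swap k) \<phi>) = sat M (e(k := a)) \<phi>"
  by (simp add: sat_ren[OF inj_swap] upd_swap)

lemma saturated_realize:
  assumes "aleph0_saturated L M" "asg M e" "\<And>\<phi>. \<phi> \<in> \<Phi> \<Longrightarrow> wf_fm L \<phi> \<and> fv \<phi> \<subseteq> {..<K}"
    and fin: "\<And>\<Psi>. finite \<Psi> \<Longrightarrow> \<Psi> \<subseteq> \<Phi> \<Longrightarrow> \<exists>a\<in>univ M. \<forall>\<phi>\<in>\<Psi>. sat M (e(k := a)) \<phi>"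
  shows "\<exists>a\<in>univ M. \<forall>\<phi>\<in>\<Phi>. sat M (e(k := a)) \<phi>"
proof -
  have e: "asg M (e \<circ> swap k)" using assms(2) by auto
  have wf: "\<forall>\<phi>\<in>ren (swap k) ` \<Phi>. wf_fm L \<phi> \<and> fv \<phi> \<subseteq> {0..K + k}"
  proof
    fix \<phi> assume "\<phi> \<in> ren (swap k) ` \<Phi>"
    then obtain \<psi> where \<psi>: "\<psi> \<in> \<Phi>" "\<phi> = ren (swap k) \<psi>" by blast
    have "swap k i \<le> K + k" if "i < K" for i using that by (auto simp: swap_def)
    then have "swap k ` fv \<psi> \<subseteq> {0..K + k}" using assms(3)[OF \<psi>(1)] by auto
    then show "wf_fm L \<phi> \<and> fv \<phi> \<subseteq> {0..K + k}"
      using assms(3)[OF \<psi>(1)] by (simp add: \<psi>(2) fv_ren[OF inj_swap])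
  qed
  have "\<forall>\<Psi>\<subseteq>ren (swap k) ` \<Phi>. finite \<Psi> \<longrightarrow>
      (\<exists>a\<in>univ M. \<forall>\<phi>\<in>\<Psi>. sat M ((e \<circ> swap k)(0 := a)) \<phi>)"
  proof (intro allI impI)
    fix \<Psi> assume "\<Psi> \<subseteq> ren (swap k) ` \<Phi>" "finite \<Psi>"
    then obtain \<Psi>' where "finite \<Psi>'" "\<Psi>' \<subseteq> \<Phi>" "\<Psi> = ren (swap k) ` \<Psi>'"
      by (metis finite_subset_image)
    then show "\<exists>a\<in>univ M. \<forall>\<phi>\<in>\<Psi>. sat M ((e \<circ> swap k)(0 := a)) \<phi>"
      using fin[of \<Psi>'] by (simp add: sat_ren_swap)
  qed
  with e wf assms(1)[unfolded aleph0_saturated_def, rule_format, of "e \<circ> swap k" "ren (swap k) ` \<Phi>" "K + k"]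
  have "\<exists>a\<in>univ M. \<forall>\<phi>\<in>ren (swap k) ` \<Phi>. sat M ((e \<circ> swap k)(0 := a)) \<phi>" by blast
  then show ?thesis by (simp add: sat_ren_swap)
qed

text \<open>In other words, \<open>e i\<close> is sent to \<open>e' i\<close>, for \<open>i\<close>
  in \<open>V\<close>, by a partial elementary map.\<close>

definition eqv :: "('f, 'r) signature \<Rightarrow> nat set \<Rightarrow> ('f, 'r, 'a) fostruct \<Rightarrow> (nat \<Rightarrow> 'a) \<Rightarrow>
    ('f, 'r, 'b) fostruct \<Rightarrow> (nat \<Rightarrow> 'b) \<Rightarrow> bool" where
  "eqv L V A e B e' \<longleftrightarrow> (\<forall>\<phi>. wf_fm L \<phi> \<and> fv \<phi> \<subseteq> V \<longrightarrow> (sat A e \<phi> \<longleftrightarrow> sat B e' \<phi>))"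

lemma eqvD: "eqv L V A e B e' \<Longrightarrow> wf_fm L \<phi> \<Longrightarrow> fv \<phi> \<subseteq> V \<Longrightarrow> sat A e \<phi> \<longleftrightarrow> sat B e' \<phi>"
  by (simp add: eqv_def)

lemma eqv_mono: "eqv L V A e B e' \<Longrightarrow> V' \<subseteq> V \<Longrightarrow> eqv L V' A e B e'"
  by (auto simp: eqv_def)

lemma eqv_cong:
  assumes "eqv L V A e B e'" "\<And>i. i \<in> V \<Longrightarrow> e i = d i" "\<And>i. i \<in> V \<Longrightarrow> e' i = d' i"
  shows "eqv L V A d B d'"
proof -
  have "sat A e \<phi> = sat A d \<phi>" "sat B e' \<phi> = sat B d' \<phi>" if "fv \<phi> \<subseteq> V" for \<phi>
    using assms(2,3) that by (auto intro!: sat_cong)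
  then show ?thesis using assms(1) by (simp add: eqv_def)
qed

text \<open>One step of back-and-forth. A finite part of the type of \<open>e k\<close> over the old
  parameters becomes, after quantifying \<open>k\<close>, a formula about the old parameters alone,
  so it is satisfiable in \<open>B\<close>.\<close>

lemma eqv_extend:
  assumes "eqv L V A e B e'" "finite V" "aleph0_saturated L B" "asg A e" "asg B e'"
  shows "\<exists>b\<in>univ B. eqv L (insert k V) A e B (e'(k := b))"
proof -
  define \<Phi> where "\<Phi> = {\<phi>. wf_fm L \<phi> \<and> fv \<phi> \<subseteq> insert k V \<and> sat A e \<phi>}"
  obtain K where K: "insert k V \<subseteq> {..<K}"
    using finite_nat_set_iff_bounded[of "insert k V"] assms(2) by auto
  have "\<exists>b\<in>univ B. \<forall>\<phi>\<in>\<Phi>. sat B (e'(k := b)) \<phi>"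
  proof (rule saturated_realize[OF assms(3,5)])
    show "wf_fm L \<phi> \<and> fv \<phi> \<subseteq> {..<K}" if "\<phi> \<in> \<Phi>" for \<phi>
      using that K by (auto simp: \<Phi>_def)
    fix \<Psi> assume \<Psi>: "finite \<Psi>" "\<Psi> \<subseteq> \<Phi>"
    show "\<exists>a\<in>univ B. \<forall>\<phi>\<in>\<Psi>. sat B (e'(k := a)) \<phi>"
    proof -
      obtain \<psi>s where \<psi>s: "set \<psi>s = \<Psi>" using finite_list[OF \<Psi>(1)] by blast
      let ?\<chi> = "Ex k (conjs k \<psi>s)"
      have "sat A (e(k := e k)) (conjs k \<psi>s)" using \<Psi>(2) \<psi>s by (auto simp: \<Phi>_def)
      moreover have "e k \<in> univ A" using assms(4) by auto
      ultimately have "sat A e ?\<chi>" unfolding sat.simps by blast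
      moreover have "wf_fm L ?\<chi>" "fv ?\<chi> \<subseteq> V" using \<Psi>(2) \<psi>s by (auto simp: \<Phi>_def)
      ultimately have "sat B e' ?\<chi>" using eqvD[OF assms(1)] by blast
      then show ?thesis using \<psi>s by simp
    qed
  qed
  then obtain b where b: "b \<in> univ B" "\<forall>\<phi>\<in>\<Phi>. sat B (e'(k := b)) \<phi>" by blast
  have "sat A e \<phi> \<longleftrightarrow> sat B (e'(k := b)) \<phi>" if "wf_fm L \<phi>" "fv \<phi> \<subseteq> insert k V" for \<phi>
  proof (cases "sat A e \<phi>")
    case False
    then have "Neg \<phi> \<in> \<Phi>" using that by (simp add: \<Phi>_def)
    then show ?thesis using False b by auto
  qed (use b that in \<open>simp add: \<Phi>_def\<close>)
  then show ?thesis using b(1) by (auto simp: eqv_def)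
qed

text \<open>Infinitely many parameters are matched although \<open>B\<close> is only saturated over
  finite sets: each step sees finitely many of them, and so does each formula.\<close>

lemma eqv_extend_all:
  assumes "eqv L {m..<K} A e B e'" "aleph0_saturated L B" "asg A e" "asg B e'"
    "m \<le> K"
  obtains E where "asg B E" "\<And>i. i < K \<Longrightarrow> E i = e' i" "eqv L {m..} A e B E"
proof -
  define step where
    "step n d = (SOME b. b \<in> univ B \<and> eqv L (insert (K + n) {m..<K + n}) A e B (d(K + n := b)))" for n d
  define d where "d = rec_nat e' (\<lambda>n d. d(K + n := step n d))"
  have d_Suc: "d (Suc n) = (d n)(K + n := step n (d n))" for n by (simp add: d_def)
  have d: "asg B (d n) \<and> eqv L {m..<K + n} A e B (d n)" for n
  proof (induction n)
    case 0
    then show ?case using assms by (simp add: d_def)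
  next
    case (Suc n)
    then have "step n (d n) \<in> univ B \<and>
        eqv L (insert (K + n) {m..<K + n}) A e B ((d n)(K + n := step n (d n)))"
      using eqv_extend[of L "{m..<K + n}" A e B "d n" "K + n"] assms(2,3)
      unfolding step_def by (metis (mono_tags, lifting) finite_atLeastLessThan someI_ex)
    moreover have "insert (K + n) {m..<K + n} = {m..<K + Suc n}" using assms(5) by auto
    ultimately show ?case using Suc by (auto simp: d_Suc simp del: fun_upd_apply) (auto simp: image_subset_iff)
  qed
  have d_stable: "d n i = d n' i" if "n \<le> n'" "i < K + n" for n n' i
    using that by (induction rule: dec_induct) (auto simp: d_Suc)
  \<comment> \<open>Variable \<open>K + n\<close> receives its value at stage \<open>n + 1\<close>
    and is never changed again; the truncated subtraction sends variables below \<open>K\<close> to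
    stage 0.\<close>
  define E where "E i = d (Suc i - K) i" for i
  have E: "E i = d n i" if "i < K + n" for i n
    unfolding E_def using that by (cases "n \<le> Suc i - K") (auto intro: d_stable d_stable[symmetric])
  show thesis
  proof
    show "asg B E" using d by (auto simp: E_def)
    show "E i = e' i" if "i < K" for i using E[of i 0] that by (simp add: d_def)
    show "eqv L {m..} A e B E"
      unfolding eqv_def
    proof (intro allI impI)
      fix \<phi> assume \<phi>: "wf_fm L \<phi> \<and> fv \<phi> \<subseteq> {m..}"
      obtain n where n: "K \<le> n" "fv \<phi> \<subseteq> {..<n}" using fv_bounded .
      have "sat B E \<phi> = sat B (d n) \<phi>" using n by (intro sat_cong E) auto
      moreover have "fv \<phi> \<subseteq> {m..<K + n}" using \<phi> n by fastforce
      ultimately show "sat A e \<phi> \<longleftrightarrow> sat B E \<phi>"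
        using eqvD[OF conjunct2[OF d[of n]], of \<phi>] \<phi> by simp
    qed
  qed
qed

text \<open>Transferring emptiness is enough, since inclusion and disjointness of definable sets are
  emptiness of a difference and of an intersection.\<close>

lemma eqv_dset_empty:
  assumes "eqv L {m..} A e B e'" "wf_fm L \<chi>"
  shows "dset A m \<chi> e = {} \<longleftrightarrow> dset B m \<chi> e' = {}"
proof -
  have "sat A e (exs m \<chi>) \<longleftrightarrow> sat B e' (exs m \<chi>)"
    using assms by (intro eqvD[OF assms(1)]) auto
  then show ?thesis by (auto simp: sat_exs dset_def)
qed

text \<open>A sequence of disjoint definable subsets of \<open>\<phi>(A, e)\<close> uses countably many parameters, which
  are matched one after another by elements of the saturated structure \<open>B\<close>.\<close>

lemma transfer_sequence:
  fixes F :: "nat \<Rightarrow> 'a list set"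
  assumes eqv: "eqv L {m..<K} A e B e'" and B: "aleph0_saturated L B"
    and e: "asg A e" "asg B e'" and \<phi>: "wf_fm L \<phi>" "fv \<phi> \<subseteq> {..<K}" "m \<le> K"
    and F: "\<And>i. definable L A m (F i)" "\<And>i. F i \<subseteq> dset A m \<phi> e"
      "\<And>i j. i \<noteq> j \<Longrightarrow> F i \<inter> F j = {}"
  obtains \<psi> E E' where "\<And>i. wf_fm L (\<psi> i)" "asg A E" "asg B E'" "eqv L {m..} A E B E'"
    "\<And>i. F i = dset A m (\<psi> i) E" "\<And>i. dset B m (\<psi> i) E' \<subseteq> dset B m \<phi> e'"
    "\<And>i j. i \<noteq> j \<Longrightarrow> dset B m (\<psi> i) E' \<inter> dset B m (\<psi> j) E' = {}"
proof (rule definable_common[OF F(1) e(1) \<phi>(3)])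
  fix \<psi> E assume \<psi>: "\<And>i. wf_fm L (\<psi> i)" "asg A E" "\<And>i. i < K \<Longrightarrow> E i = e i"
    "\<And>i. F i = dset A m (\<psi> i) E"
  have "eqv L {m..<K} A E B e'"
    using eqv_cong[OF eqv] \<psi>(3) by auto
  then show thesis
  proof (rule eqv_extend_all[OF _ B \<psi>(2) e(2) \<phi>(3)])
    fix E' assume E': "asg B E'" "\<And>i. i < K \<Longrightarrow> E' i = e' i" "eqv L {m..} A E B E'"
    have \<phi>E: "dset A m \<phi> e = dset A m \<phi> E" "dset B m \<phi> e' = dset B m \<phi> E'"
      using \<phi>(2) \<psi>(3) E'(2) by (auto intro!: dset_cong)
    show thesis
    proof (rule that[OF \<psi>(1,2) E'(1,3) \<psi>(4)])
      fix i
      have "dset A m (Conj (\<psi> i) (Neg \<phi>)) E = {}"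
        using F(2)[of i] \<psi>(4) \<phi>E by (auto simp: dset_Diff)
      then have "dset B m (Conj (\<psi> i) (Neg \<phi>)) E' = {}"
        using eqv_dset_empty[OF E'(3)] \<psi>(1) \<phi>(1) by simp
      then show "dset B m (\<psi> i) E' \<subseteq> dset B m \<phi> e'"
        using \<phi>E by (auto simp: dset_Diff)
    next
      fix i j :: nat assume "i \<noteq> j"
      then have "dset A m (Conj (\<psi> i) (\<psi> j)) E = {}"
        using F(3) \<psi>(4) by (auto simp: dset_Conj)
      then have "dset B m (Conj (\<psi> i) (\<psi> j)) E' = {}"
        using eqv_dset_empty[OF E'(3)] \<psi>(1) by simp
      then show "dset B m (\<psi> i) E' \<inter> dset B m (\<psi> j) E' = {}"
        by (simp add: dset_Conj)
    qed
  qed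
qed

lemma mr_transfer:
  assumes B: "aleph0_saturated L B" and X: "dmr L A m S w (dset A m \<phi> e)"
    and "eqv L {m..<K} A e B e'" "asg A e" "asg B e'"
    "wf_fm L \<phi>" "fv \<phi> \<subseteq> {..<K}" "m \<le> K"
  shows "dmr L B m S w (dset B m \<phi> e')"
proof -
  \<comment> \<open>The induction covers all presentations of \<open>X\<close> by a formula and an
    assignment and all matching assignments in \<open>B\<close>, because the pieces come with new
    formulas and new parameters.\<close>
  define Q where "Q w X \<longleftrightarrow> (\<forall>\<phi> e K e'. X = dset A m \<phi> e \<longrightarrow> eqv L {m..<K} A e B e' \<longrightarrow>
    asg A e \<longrightarrow> asg B e' \<longrightarrow> wf_fm L \<phi> \<longrightarrow> fv \<phi> \<subseteq> {..<K} \<longrightarrow> m \<le> K \<longrightarrow>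
    dmr L B m S w (dset B m \<phi> e'))" for w X
  have "Q w X" if "dmr L A m S w X" for X
    using that
  proof (induction rule: mr.induct)
    case (mrI X w)
    show ?case unfolding Q_def
    proof (intro allI impI)
      fix \<phi> e K e'
      assume prems: "X = dset A m \<phi> e" "eqv L {m..<K} A e B e'" "asg A e"
        "asg B e'" "wf_fm L \<phi>" "fv \<phi> \<subseteq> {..<K}" "m \<le> K"
      have "dsplit L B m S v (dset B m \<phi> e')" if "(v, w) \<in> S" for v
      proof -
        from mrI.IH[OF that] obtain F where
          F0: "\<forall>i::nat. F i \<subseteq> X \<and> dmr L A m S v (F i) \<and> Q v (F i)"
            "\<forall>i j. i \<noteq> j \<longrightarrow> F i \<inter> F j = {}" by (elim exE conjE)
        have F: "\<And>i. definable L A m (F i)" "\<And>i. F i \<subseteq> dset A m \<phi> e" "\<And>i j. i \<noteq> j \<Longrightarrow> F i \<inter> F j = {}"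
          using F0 prems(1) by (simp_all add: mr_imp_D[of _ S v])
        show ?thesis
        proof (rule transfer_sequence[OF prems(2) B prems(3,4,5,6,7) F])
          fix \<psi> E E'
          assume \<psi>: "\<And>i. wf_fm L (\<psi> i)" "asg A E" "asg B E'" "eqv L {m..} A E B E'"
            "\<And>i. F i = dset A m (\<psi> i) E" "\<And>i. dset B m (\<psi> i) E' \<subseteq> dset B m \<phi> e'"
            "\<And>i j. i \<noteq> j \<Longrightarrow> dset B m (\<psi> i) E' \<inter> dset B m (\<psi> j) E' = {}"
          have "dmr L B m S v (dset B m (\<psi> i) E')" for i
          proof -
            obtain K' where K': "m \<le> K'" "fv (\<psi> i) \<subseteq> {..<K'}" using fv_bounded .
            have "eqv L {m..<K'} A E B E'" by (rule eqv_mono[OF \<psi>(4)]) auto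
            moreover have "Q v (F i)" using F0(1) by simp
            ultimately show ?thesis using \<psi>(1,2,3,5) K' unfolding Q_def by metis
          qed
          then show ?thesis
            unfolding split_def using \<psi>(6,7) by (intro exI[of _ "\<lambda>i. dset B m (\<psi> i) E'"]) blast
        qed
      qed
      moreover have "dset B m \<phi> e' \<noteq> {}"
      proof -
        have "sat A e (exs m \<phi>)" using mrI.hyps(2) prems(1) by (auto simp: sat_exs dset_def)
        then have "sat B e' (exs m \<phi>)"
          using eqvD[OF prems(2), of "exs m \<phi>"] prems(5,6) by fastforce
        then show ?thesis by (auto simp: sat_exs dset_def)
      qed
      moreover have "definable L B m (dset B m \<phi> e')" using prems by (intro definable_dset)
      ultimately show "dmr L B m S w (dset B m \<phi> e')" by (subst mr_iff) blast
    qed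
  qed
  from this[OF X] show ?thesis using assms(3-) unfolding Q_def by blast
qed

section \<open>Elementary equivalence of whole structures\<close>

definition elem_equiv ::
    "('f, 'r) signature \<Rightarrow> ('f, 'r, 'a) fostruct \<Rightarrow> ('f, 'r, 'b) fostruct \<Rightarrow> bool" where
  "elem_equiv L A B \<longleftrightarrow> (\<forall>e e'. asg A e \<and> asg B e' \<longrightarrow> eqv L {} A e B e')"

lemma elem_equiv_refl: "elem_equiv L A A"
  unfolding elem_equiv_def eqv_def by (intro allI impI sat_cong) auto

lemma elem_equiv_sym: "elem_equiv L A B \<Longrightarrow> elem_equiv L B A"
  by (auto simp: elem_equiv_def eqv_def)

lemma elem_equiv_trans:
  assumes "elem_equiv L A B" "elem_equiv L B C" "is_fostruct L B"
  shows "elem_equiv L A C"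
proof -
  obtain b where "b \<in> univ B" using assms(3) by (auto simp: is_fostruct_def)
  then have "asg B (\<lambda>_. b)" by auto
  then show ?thesis using assms(1,2) unfolding elem_equiv_def eqv_def by meson
qed

lemma elementary_embedding_elem_equiv:
  assumes "elementary_embedding L A B h"
  shows "elem_equiv L A B"
  unfolding elem_equiv_def eqv_def
proof (intro allI impI)
  fix e :: "nat \<Rightarrow> _" and e' :: "nat \<Rightarrow> _" and \<phi>
  assume *: "asg A e \<and> asg B e'" "wf_fm L \<phi> \<and> fv \<phi> \<subseteq> {}"
  then have "sat A e \<phi> \<longleftrightarrow> sat B (h \<circ> e) \<phi>"
    using assms unfolding elementary_embedding_def by blast
  also have "\<dots> \<longleftrightarrow> sat B e' \<phi>" using *(2) by (intro sat_cong) auto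
  finally show "sat A e \<phi> \<longleftrightarrow> sat B e' \<phi>" .
qed

lemma mr_elem_equiv:
  fixes L :: "('f, 'r) signature"
  assumes "aleph0_saturated L B" "elem_equiv L A B" "is_fostruct L A" "is_fostruct L B"
    "dmr L A m S w (cart A m)"
  shows "dmr L B m S w (cart B m)"
proof -
  obtain a b where ab: "a \<in> univ A" "b \<in> univ B" using assms(3,4) by (auto simp: is_fostruct_def)
  define e where "e = (\<lambda>_::nat. a)"
  define e' where "e' = (\<lambda>_::nat. b)"
  have e: "asg A e" "asg B e'" using ab by (auto simp: e_def e'_def)
  \<comment> \<open>A true sentence defines the full power without parameters, so the partial map to
    start from is empty and agreement on sentences suffices.\<close>
  define \<phi> :: "('f, 'r) fm" where "\<phi> = exs 1 (Eql (Var 0) (Var 0))"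
  have \<phi>: "wf_fm L \<phi>" "fv \<phi> = {}" by (auto simp: \<phi>_def)
  have "sat A d \<phi>" "sat B d' \<phi>" for d d' using ab by (auto simp: \<phi>_def)
  then have t: "dset A m \<phi> e = cart A m" "dset B m \<phi> e' = cart B m"
    by (auto simp: dset_def)
  have "eqv L {m..<m} A e B e'" using assms(2) e by (simp add: elem_equiv_def)
  from mr_transfer[OF assms(1) assms(5)[folded t(1)] this e \<phi>(1)] show ?thesis
    using \<phi>(2) t(2) by simp
qed

section \<open>The rank of a Cartesian power\<close>

text \<open>The cycle moves the first coordinate to the parameter position \<open>k\<close> and the
  other \<open>k\<close> coordinates down to \<open>0, ..., k - 1\<close>, turning a formula for
  \<open>X\<close> into one for its fibers.\<close>

definition cyc :: "nat \<Rightarrow> nat \<Rightarrow> nat" where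
  "cyc k i = (if i = 0 then k else if i \<le> k then i - 1 else i)"

lemma inj_cyc: "inj (cyc k)"
  by (auto simp: inj_def cyc_def split: if_splits)

lemma cyc_less: "i < K \<Longrightarrow> k < K \<Longrightarrow> cyc k i < K"
  by (auto simp: cyc_def)

definition fiber :: "'a list set \<Rightarrow> 'a \<Rightarrow> 'a list set" where
  "fiber X y = {ys. y # ys \<in> X}"

lemma fiber_dset:
  assumes "y \<in> univ A"
  shows "fiber (dset A (Suc k) \<phi> e) y = dset A k (ren (cyc k) \<phi>) (e(k := y))"
proof -
  have "ovr k ys (e(k := y)) \<circ> cyc k = ovr (Suc k) (y # ys) e" for ys
    by (auto simp: fun_eq_iff ovr_def cyc_def nth_Cons')
  then show ?thesis
    using assms by (auto simp: fiber_def dset_def sat_ren[OF inj_cyc] tuples_Suc)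
qed

lemma fiber_subset: "X \<subseteq> tuples U (Suc k) \<Longrightarrow> fiber X y \<subseteq> tuples U k"
  by (auto simp: fiber_def tuples_Suc)

text \<open>The solution variable is \<open>k\<close>, where \<open>cyc\<close> puts the first
  coordinate. The same formula can then be read as a set of points and as a condition on the
  parameter of a fiber.\<close>

definition sol :: "('f, 'r, 'a) fostruct \<Rightarrow> nat \<Rightarrow> ('f, 'r) fm \<Rightarrow> (nat \<Rightarrow> 'a) \<Rightarrow> 'a list set" where
  "sol A k \<chi> e = {[a] | a. a \<in> univ A \<and> sat A (e(k := a)) \<chi>}"

lemma definable_sol:
  assumes "wf_fm L \<chi>" "asg A e"
  shows "definable L A (Suc 0) (sol A k \<chi> e)"
proof -
  have "sol A k \<chi> e = dset A (Suc 0) (ren (swap k) \<chi>) (e \<circ> swap k)"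
    by (auto simp: sol_def dset_def tuples_1 sat_ren_swap)
  then show ?thesis using assms by (auto intro!: definable_dset)
qed

definition proj :: "'a list set \<Rightarrow> 'a list set" where
  "proj X = {[y] | y ys. y # ys \<in> X}"

lemma proj_dset: "proj (dset A (Suc k) \<phi> e) = sol A k (exs k (ren (cyc k) \<phi>)) e"
proof -
  have "(\<exists>ys. y # ys \<in> dset A (Suc k) \<phi> e) \<longleftrightarrow> sat A (e(k := y)) (exs k (ren (cyc k) \<phi>))"
    if "y \<in> univ A" for y
    using fiber_dset[OF that, of k \<phi> e] by (auto simp: sat_exs fiber_def dset_def)
  moreover have "y \<in> univ A" if "y # ys \<in> dset A (Suc k) \<phi> e" for y ys
    using that by (auto simp: dset_def tuples_Suc)
  ultimately show ?thesis unfolding proj_def sol_def by blast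
qed

lemma definable_proj:
  assumes "definable L A (Suc k) X"
  shows "definable L A (Suc 0) (proj X)"
proof -
  obtain \<phi> e where "wf_fm L \<phi>" "asg A e" "X = dset A (Suc k) \<phi> e"
    using assms by (auto simp: definable_iff)
  then show ?thesis by (simp add: proj_dset definable_sol)
qed

definition lift :: "('f, 'r, 'a) fostruct \<Rightarrow> nat \<Rightarrow> 'a list set \<Rightarrow> 'a list set" where
  "lift A k Y = {y # ys | y ys. [y] \<in> Y \<and> ys \<in> cart A k}"

lemma definable_lift:
  assumes "definable L A (Suc 0) Y"
  shows "definable L A (Suc k) (lift A k Y)"
proof -
  obtain \<phi> e where \<phi>: "wf_fm L \<phi>" "asg A e" "Y = dset A (Suc 0) \<phi> e"
    using assms by (auto simp: definable_iff)
  define f where "f i = (if i = 0 then 0 else i + k)" for i :: nat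
  have "inj f" by (auto simp: inj_def f_def split: if_splits)
  moreover have "ovr (Suc k) (y # ys) (\<lambda>j. e (j - k)) \<circ> f = e(0 := y)" for y ys
    by (auto simp: fun_eq_iff ovr_def f_def)
  ultimately have "lift A k Y = dset A (Suc k) (ren f \<phi>) (\<lambda>j. e (j - k))"
    by (auto simp: lift_def \<phi>(3) dset_def sat_ren tuples_Suc)
  then show ?thesis using \<phi>(1,2) by (auto intro!: definable_dset)
qed

text \<open>So the type of \<open>y\<close> over the parameters at the variables strictly between
  \<open>k\<close> and \<open>K\<close> has rank at least \<open>p\<close> on \<open>Y\<close>.
  Variables below \<open>k\<close> are kept free for the coordinates of the fiber.\<close>

definition generic ::
    "('f, 'r) signature \<Rightarrow> ('f, 'r, 'a) fostruct \<Rightarrow> 'w rel \<Rightarrow> 'w \<Rightarrow> 'a list set \<Rightarrow> nat \<Rightarrow> (nat \<Rightarrow> 'a) \<Rightarrow> nat \<Rightarrow> 'a \<Rightarrow> bool"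
  where
  "generic L A S p Y k e K y \<longleftrightarrow> y \<in> univ A \<and>
     (\<forall>\<chi>. wf_fm L \<chi> \<and> fv \<chi> \<subseteq> {k..<K} \<and> sat A (e(k := y)) \<chi> \<longrightarrow>
        dmr L A (Suc 0) S p (Y \<inter> sol A k \<chi> e))"

text \<open>A point is wanted outside all \<open>sol A k \<chi> e\<close> that meet \<open>Y\<close>
  in rank below \<open>p\<close>. If finitely many of these sets left no point, they would cover
  \<open>Y\<close>, and \<open>mr_finite_Union\<close> would give one of them rank \<open>p\<close>
  on \<open>Y\<close>.\<close>

lemma generic_exists:
  assumes "aleph0_saturated L A" "asg A e" "dmr L A (Suc 0) S p Y" "strict_wo S"
  obtains y where "generic L A S p Y k e K y"
proof -
  interpret set_algebra "definable L A (Suc 0)" by (rule set_algebra_definable)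
  define \<Phi> where "\<Phi> = {Neg \<chi> | \<chi>. wf_fm L \<chi> \<and> fv \<chi> \<subseteq> {k..<K} \<and>
    \<not> dmr L A (Suc 0) S p (Y \<inter> sol A k \<chi> e)}"
  have "\<exists>y\<in>univ A. \<forall>\<phi>\<in>\<Phi>. sat A (e(k := y)) \<phi>"
  proof (rule saturated_realize[OF assms(1,2)])
    show "wf_fm L \<phi> \<and> fv \<phi> \<subseteq> {..<K}" if "\<phi> \<in> \<Phi>" for \<phi>
      using that by (fastforce simp: \<Phi>_def)
    fix \<Psi> assume \<Psi>: "finite \<Psi>" "\<Psi> \<subseteq> \<Phi>"
    show "\<exists>a\<in>univ A. \<forall>\<phi>\<in>\<Psi>. sat A (e(k := a)) \<phi>"
    proof (rule ccontr)
      assume no: "\<not> ?thesis"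
      define \<X> where "\<X> = (\<lambda>\<phi>. {[a] | a. a \<in> univ A \<and> \<not> sat A (e(k := a)) \<phi>}) ` \<Psi>"
      have \<X>: "\<exists>\<chi>. X = sol A k \<chi> e \<and> wf_fm L \<chi> \<and>
          \<not> dmr L A (Suc 0) S p (Y \<inter> sol A k \<chi> e)" if X: "X \<in> \<X>" for X
      proof -
        obtain \<phi> where \<phi>: "\<phi> \<in> \<Psi>" "X = {[a] | a. a \<in> univ A \<and> \<not> sat A (e(k := a)) \<phi>}"
          using X by (auto simp: \<X>_def)
        then obtain \<chi> where "\<phi> = Neg \<chi>" "wf_fm L \<chi>"
          "\<not> dmr L A (Suc 0) S p (Y \<inter> sol A k \<chi> e)"
          using \<Psi>(2) by (auto simp: \<Phi>_def)
        then show ?thesis using \<phi>(2) by (intro exI[of _ \<chi>]) (simp add: sol_def)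
      qed
      have "Y \<subseteq> \<Union>\<X>"
      proof
        fix ys assume "ys \<in> Y"
        then obtain a where "ys = [a]" "a \<in> univ A"
          using definable_subset[OF mr_imp_D[OF assms(3)]] by (auto simp: tuples_1)
        then show "ys \<in> \<Union>\<X>" using no by (auto simp: \<X>_def)
      qed
      then have "\<exists>X\<in>\<X>. dmr L A (Suc 0) S p (Y \<inter> X)"
      proof (intro mr_finite_Union[OF assms(4) _ _ assms(3)])
        show "finite \<X>" using \<Psi>(1) by (simp add: \<X>_def)
        show "definable L A (Suc 0) X" if "X \<in> \<X>" for X
          using \<X>[OF that] definable_sol[OF _ assms(2)] by blast
      qed
      then show False using \<X> by blast
    qed
  qed
  then obtain y where y: "y \<in> univ A" "\<forall>\<phi>\<in>\<Phi>. sat A (e(k := y)) \<phi>" by blast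
  have "generic L A S p Y k e K y"
    unfolding generic_def
  proof (intro conjI allI impI)
    fix \<chi> assume "wf_fm L \<chi> \<and> fv \<chi> \<subseteq> {k..<K} \<and> sat A (e(k := y)) \<chi>"
    then show "dmr L A (Suc 0) S p (Y \<inter> sol A k \<chi> e)"
      using y(2) by (force simp: \<Phi>_def)
  qed (rule y(1))
  then show thesis by (rule that)
qed

definition degree_one ::
    "('f, 'r) signature \<Rightarrow> ('f, 'r, 'a) fostruct \<Rightarrow> 'w rel \<Rightarrow> 'w \<Rightarrow> 'a list set \<Rightarrow> bool" where
  "degree_one L A S p Y \<longleftrightarrow> (\<forall>Z. definable L A (Suc 0) Z \<longrightarrow>
     \<not> (dmr L A (Suc 0) S p (Y \<inter> Z) \<and> dmr L A (Suc 0) S p (Y - Z)))"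

text \<open>If \<open>\<chi>\<close> had rank \<open>p\<close> on \<open>Y\<close> and failed at
  \<open>y\<close>, its negation would also have rank \<open>p\<close> on \<open>Y\<close>, against
  degree one. The generic type is thus complete and determined by rank alone.\<close>

lemma generic_sat_iff:
  assumes g: "generic L A S p Y k e K y" and d: "degree_one L A S p Y" and e: "asg A e"
    and Y: "definable L A (Suc 0) Y" and \<chi>: "wf_fm L \<chi>" "fv \<chi> \<subseteq> {k..<K}"
  shows "sat A (e(k := y)) \<chi> \<longleftrightarrow> dmr L A (Suc 0) S p (Y \<inter> sol A k \<chi> e)"
proof
  assume "sat A (e(k := y)) \<chi>"
  then show "dmr L A (Suc 0) S p (Y \<inter> sol A k \<chi> e)"
    using g \<chi> by (simp add: generic_def)
next
  assume m: "dmr L A (Suc 0) S p (Y \<inter> sol A k \<chi> e)"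
  show "sat A (e(k := y)) \<chi>"
  proof (rule ccontr)
    assume "\<not> sat A (e(k := y)) \<chi>"
    then have "dmr L A (Suc 0) S p (Y \<inter> sol A k (Neg \<chi>) e)"
      using g \<chi> by (simp add: generic_def)
    moreover have "Y \<inter> sol A k (Neg \<chi>) e = Y - sol A k \<chi> e"
      using definable_subset[OF Y] by (auto simp: sol_def tuples_1)
    ultimately show False
      using d m definable_sol[OF \<chi>(1) e] by (auto simp: degree_one_def)
  qed
qed

lemma generic_eqv:
  assumes "generic L A S p Y k e K y" "generic L A S p Y k e K y'" "degree_one L A S p Y"
    "asg A e" "definable L A (Suc 0) Y"
  shows "eqv L {k..<K} A (e(k := y)) A (e(k := y'))"
  using generic_sat_iff[OF assms(1,3-5)] generic_sat_iff[OF assms(2,3-5)] by (simp add: eqv_def)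

lemma generic_weaken:
  assumes "generic L A S p Y k E K' y" "K \<le> K'" "\<And>i. i < K \<Longrightarrow> E i = e i"
  shows "generic L A S p Y k e K y"
  unfolding generic_def
proof (intro conjI allI impI)
  fix \<chi> assume \<chi>: "wf_fm L \<chi> \<and> fv \<chi> \<subseteq> {k..<K} \<and> sat A (e(k := y)) \<chi>"
  then have eq: "sat A (E(k := a)) \<chi> = sat A (e(k := a)) \<chi>" for a
    by (intro sat_cong) (use assms(3) in fastforce)
  then have "sol A k \<chi> E = sol A k \<chi> e" by (simp add: sol_def)
  then show "dmr L A (Suc 0) S p (Y \<inter> sol A k \<chi> e)"
    using assms(1,2) \<chi> eq unfolding generic_def by fastforce
qed (use assms(1) in \<open>simp add: generic_def\<close>)

text \<open>Infinitely many disjoint pieces of \<open>X\<close> need infinitely many parameters, over which no generic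
  point need exist in an \<open>\<aleph>\<^sub>0\<close>-saturated structure. But a point generic over the parameters of \<open>n\<close> pieces
  yields \<open>n\<close> disjoint pieces of the fiber, for each \<open>n\<close>, and all generic fibers look alike.\<close>

lemma mr_generic_fiber:
  fixes A :: "('f, 'r, 'a) fostruct" and J :: "'v \<Rightarrow> 'w \<Rightarrow> 'u"
  assumes A: "is_fostruct L A" "aleph0_saturated L A" and S: "strict_wo S1" "strict_wo S2"
    and Y: "degree_one L A S1 p Y" "definable L A (Suc 0) Y" "proj X \<subseteq> Y"
    and pr: "\<And>X' \<delta>. X' \<subseteq> X \<Longrightarrow> (\<delta>, dt) \<in> S2\<^sup>= \<Longrightarrow> dmr L A (Suc k) S3 (J p \<delta>) X' \<Longrightarrow>
      dmr L A (Suc 0) S1 p (proj X')"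
    and J: "\<And>\<delta>' \<delta>. (\<delta>', \<delta>) \<in> S2 \<Longrightarrow> (\<delta>, dt) \<in> S2\<^sup>= \<Longrightarrow> (J p \<delta>', J p \<delta>) \<in> S3"
  shows "\<lbrakk>(\<delta>, dt) \<in> S2\<^sup>=; wf_fm L \<phi>; asg A e; fv \<phi> \<subseteq> {..<K}; Suc k \<le> K;
    dset A (Suc k) \<phi> e \<subseteq> X; dmr L A (Suc k) S3 (J p \<delta>) (dset A (Suc k) \<phi> e);
    generic L A S1 p Y k e K y\<rbrakk> \<Longrightarrow>
    dmr L A k S2 \<delta> (fiber (dset A (Suc k) \<phi> e) y)"
  using S(2)[unfolded strict_wo_def, THEN conjunct1]
proof (induction \<delta> arbitrary: \<phi> e K y rule: wf_induct_rule)
  case (less \<delta>)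
  note \<phi> = less.prems(2-5) and X' = less.prems(6,7) and gen = less.prems(8)
  interpret Dk: set_algebra "definable L A k" by (rule set_algebra_definable)
  let ?X = "dset A (Suc k) \<phi> e" and ?\<rho> = "ren (cyc k) \<phi>"
  have y: "y \<in> univ A" using gen by (simp add: generic_def)
  have \<rho>: "wf_fm L ?\<rho>" "fv ?\<rho> \<subseteq> {..<K}"
    using \<phi> cyc_less[of _ K k] by (auto simp: fv_ren[OF inj_cyc])
  have fib: "fiber ?X z = dset A k ?\<rho> (e(k := z))" if "z \<in> univ A" for z
    by (rule fiber_dset[OF that])
  have upd: "asg A (e(k := z))" if "z \<in> univ A" for z
    using \<phi>(2) that by auto
  have Dfib: "definable L A k (fiber ?X y)"
    unfolding fib[OF y] by (rule definable_dset[OF \<rho>(1) upd[OF y]])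
  \<comment> \<open>By \<open>pr\<close> the projection has rank at least \<open>p\<close> and lies
    in \<open>Y\<close>. Hence the formula saying that the fiber is nonempty has rank
    \<open>p\<close> on \<open>Y\<close> and holds at the generic \<open>y\<close>.\<close>
  have "fiber ?X y \<noteq> {}"
  proof -
    have "dmr L A (Suc 0) S1 p (proj ?X)"
      using pr[OF X'(1) less.prems(1) X'(2)] .
    moreover have "proj ?X = Y \<inter> sol A k (exs k ?\<rho>) e"
      using Y(3) X'(1) by (auto simp: proj_dset[symmetric] proj_def)
    moreover have "fv (exs k ?\<rho>) \<subseteq> {k..<K}" using \<rho>(2) by fastforce
    ultimately have "sat A (e(k := y)) (exs k ?\<rho>)"
      using generic_sat_iff[OF gen Y(1) \<phi>(2) Y(2), of "exs k ?\<rho>"] \<rho>(1) by simp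
    then show ?thesis unfolding fib[OF y] by (auto simp: sat_exs dset_def)
  qed
  moreover have "dsplit L A k S2 \<delta>' (fiber ?X y)" if \<delta>': "(\<delta>', \<delta>) \<in> S2" for \<delta>'
  proof (rule Dk.split_if_arbitrarily_many[OF S(2) Dfib])
    fix n :: nat
    have "(\<delta>', dt) \<in> S2\<^sup>="
      using \<delta>' less.prems(1) S(2) unfolding strict_wo_def by (auto dest: transD)
    note IH = less.IH[OF \<delta>' this]
    obtain F :: "nat \<Rightarrow> _" where F: "\<forall>i. F i \<subseteq> ?X \<and> dmr L A (Suc k) S3 (J p \<delta>') (F i)"
      "\<forall>i j. i \<noteq> j \<longrightarrow> F i \<inter> F j = {}"
      using mr_imp_splitD[OF X'(2) J[OF \<delta>' less.prems(1)]] unfolding split_def by blast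
    have DF: "definable L A (Suc k) (F i)" for i
      using F(1) by (simp add: mr_imp_D[of _ S3 "J p \<delta>'"])
    show "\<exists>G :: nat \<Rightarrow> _. (\<forall>i<n. G i \<subseteq> fiber ?X y \<and> dmr L A k S2 \<delta>' (G i)) \<and>
        (\<forall>i<n. \<forall>j<n. i \<noteq> j \<longrightarrow> G i \<inter> G j = {})"
    proof (rule definable_common[OF DF \<phi>(2,4)])
      fix \<psi> E
      assume \<psi>: "\<And>i. wf_fm L (\<psi> i)" "asg A E" "\<And>i. i < K \<Longrightarrow> E i = e i"
        "\<And>i. F i = dset A (Suc k) (\<psi> i) E"
      have "finite (\<Union>i<n. fv (\<psi> i))" by simp
      then obtain K0 where K0: "\<forall>j\<in>(\<Union>i<n. fv (\<psi> i)). j < K0"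
        using finite_nat_set_iff_bounded by blast
      define K' where "K' = max K K0"
      have K': "K \<le> K'" "\<And>i. i < n \<Longrightarrow> fv (\<psi> i) \<subseteq> {..<K'}"
        using K0 by (auto simp: K'_def less_max_iff_disj)
      have "dmr L A (Suc 0) S1 p Y"
        using mr_mono[OF pr[OF X'(1) less.prems(1) X'(2)] _ Y(2)] Y(3) X'(1)
        by (auto simp: proj_def)
      \<comment> \<open>The given \<open>y\<close> is generic only over the old parameters, while
        the pieces \<open>F i\<close> need \<open>y'\<close>, generic over theirs too. Being also
        generic over the old ones, \<open>y'\<close> can be compared with \<open>y\<close>
        afterwards.\<close>
      then obtain y' where y': "generic L A S1 p Y k E K' y'"
        using generic_exists[OF A(2) \<psi>(2) _ S(1)] by blast
      have genK: "generic L A S1 p Y k e K y'" by (rule generic_weaken[OF y' K'(1) \<psi>(3)])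
      have y'U: "y' \<in> univ A" using y' by (simp add: generic_def)
      have mrF: "dmr L A k S2 \<delta>' (fiber (F i) y')" if "i < n" for i
        unfolding \<psi>(4)[of i]
      proof (rule IH[OF \<psi>(1,2) K'(2)[OF that] _ _ _ y'])
        show "Suc k \<le> K'" using K'(1) \<phi>(4) by simp
        show "dset A (Suc k) (\<psi> i) E \<subseteq> X"
          using F(1) X'(1) unfolding \<psi>(4)[symmetric] by blast
        show "dmr L A (Suc k) S3 (J p \<delta>') (dset A (Suc k) (\<psi> i) E)"
          using F(1) unfolding \<psi>(4)[symmetric] by blast
      qed
      \<comment> \<open>Empty sets fill up the \<open>n\<close> fibers, since
        \<open>transfer_sequence\<close> takes an infinite sequence.\<close>
      define H where "H i = (if i < n then fiber (F i) y' else {})" for i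
      have H1: "definable L A k (H i)" for i
        using mr_imp_D[OF mrF, of i] Dk.D_Diff[OF Dfib Dfib] by (auto simp: H_def)
      have H2: "H i \<subseteq> dset A k ?\<rho> (e(k := y'))" for i
        using F(1) unfolding fib[OF y'U, symmetric] by (auto simp: H_def fiber_def)
      have H3: "H i \<inter> H j = {}" if "i \<noteq> j" for i j
        using F(2) that by (auto simp: H_def fiber_def)
      show ?thesis
      proof (rule transfer_sequence[OF generic_eqv[OF genK gen Y(1) \<phi>(2) Y(2)] A(2) upd[OF y'U]
            upd[OF y] \<rho> Suc_leD[OF \<phi>(4)] H1 H2 H3])
        fix \<theta> E1 E2
        assume \<theta>: "asg A E1" "asg A E2" "eqv L {k..} A E1 A E2"
          "\<And>i. wf_fm L (\<theta> i)" "\<And>i. H i = dset A k (\<theta> i) E1"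
          "\<And>i. dset A k (\<theta> i) E2 \<subseteq> dset A k ?\<rho> (e(k := y))"
          "\<And>i j. i \<noteq> j \<Longrightarrow> dset A k (\<theta> i) E2 \<inter> dset A k (\<theta> j) E2 = {}"
        have "dmr L A k S2 \<delta>' (dset A k (\<theta> i) E2)" if "i < n" for i
        proof -
          obtain K1 where K1: "k \<le> K1" "fv (\<theta> i) \<subseteq> {..<K1}" using fv_bounded .
          have "eqv L {k..<K1} A E1 A E2" by (rule eqv_mono[OF \<theta>(3)]) auto
          moreover have "dmr L A k S2 \<delta>' (dset A k (\<theta> i) E1)"
            using mrF[OF that] \<theta>(5)[of i] that by (simp add: H_def)
          ultimately show ?thesis
            by (intro mr_transfer[OF A(2) _ _ \<theta>(1,2,4) K1(2,1)])
        qed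
        then show ?thesis
          using \<theta>(6,7) unfolding fib[OF y] by (intro exI[of _ "\<lambda>i. dset A k (\<theta> i) E2"]) simp
      qed
    qed
  qed
  ultimately show ?case using Dfib by (subst mr_iff) blast
qed

text \<open>An inequality of Erimbetov: if \<open>Y\<close> has rank at most \<open>p\<close> and \<open>M\<^sup>k\<close> has rank less than \<open>\<delta>\<close>, then
  \<open>X \<subseteq> Y \<times> M\<^sup>k\<close> has rank less than \<open>\<delta> \<sqdot> (p + 1)\<close>; \<open>J p \<delta>\<close> is an upper bound for \<open>\<delta> \<sqdot> p + \<delta>\<close>.\<close>

lemma mr_product:
  fixes A :: "('f, 'r, 'a) fostruct" and J :: "'v \<Rightarrow> 'w \<Rightarrow> 'u"
  assumes A: "is_fostruct L A" "aleph0_saturated L A"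
    and S: "strict_wo S1" "strict_wo S2" "strict_wo S3"
    and J1: "\<And>p \<delta>' \<delta>. (\<delta>', \<delta>) \<in> S2 \<Longrightarrow> (\<delta>, dt) \<in> S2\<^sup>= \<Longrightarrow> (J p \<delta>', J p \<delta>) \<in> S3"
    and J2: "\<And>p' p \<delta>. (p', p) \<in> S1 \<Longrightarrow> (\<delta>, dt) \<in> S2\<^sup>= \<Longrightarrow> (J p' dt, J p \<delta>) \<in> S3"
    and k: "\<not> dmr L A k S2 dt (cart A k)"
  shows "\<lbrakk>definable L A (Suc 0) Y; \<not> dsplit L A (Suc 0) S1 p Y;
    definable L A (Suc k) X; proj X \<subseteq> Y\<rbrakk> \<Longrightarrow> \<not> dmr L A (Suc k) S3 (J p dt) X"
  using S(1)[unfolded strict_wo_def, THEN conjunct1]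
proof (induction p arbitrary: X Y rule: wf_induct_rule)
  case (less p)
  interpret D1: set_algebra "definable L A (Suc 0)" by (rule set_algebra_definable)
  interpret Dk: set_algebra "definable L A (Suc k)" by (rule set_algebra_definable)
  have tr: "trans S3" using S(3) by (simp add: strict_wo_def)
  \<comment> \<open>If the projection did not split at some \<open>p'\<close> below
    \<open>p\<close>, the induction hypothesis with the projection as \<open>Y\<close> would bound
    the rank of \<open>X'\<close> below \<open>J p' dt\<close>, which is smaller than
    \<open>J p \<delta>\<close>.\<close>
  have pr: "dmr L A (Suc 0) S1 p (proj X')"
    if X': "(\<delta>, dt) \<in> S2\<^sup>=" "dmr L A (Suc k) S3 (J p \<delta>) X'" for X' \<delta>
  proof -
    have D: "definable L A (Suc k) X'" by (rule mr_imp_D[OF X'(2)])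
    have "dsplit L A (Suc 0) S1 p' (proj X')" if p': "(p', p) \<in> S1" for p'
      using less.IH[OF p' definable_proj[OF D] _ D order.refl]
        mr_downward[OF tr X'(2) J2[OF p' X'(1)]] by blast
    moreover have "proj X' \<noteq> {}"
    proof -
      obtain xs where "xs \<in> X'" using mr_nonempty[OF X'(2)] by blast
      then show ?thesis using definable_subset[OF D] by (fastforce simp: proj_def tuples_Suc)
    qed
    ultimately show ?thesis using definable_proj[OF D] by (subst mr_iff) blast
  qed
  show ?case
  proof
    assume mrX: "dmr L A (Suc k) S3 (J p dt) X"
    let ?P = "\<lambda>Z. definable L A (Suc 0) Z \<and> Z \<subseteq> Y \<and> dmr L A (Suc k) S3 (J p dt) (X \<inter> lift A k Z)"
    \<comment> \<open>Otherwise every admissible \<open>Z\<close> divides into two parts of rank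
      \<open>p\<close>. By \<open>mr_Un\<close> the large rank of \<open>X\<close> survives over one
      part; the other is peeled off. Repeating this would make \<open>Y\<close> split at
      \<open>p\<close>.\<close>
    have "\<exists>Z. ?P Z \<and> degree_one L A S1 p Z"
    proof (rule ccontr)
      assume no: "\<nexists>Z. ?P Z \<and> degree_one L A S1 p Z"
      have "dsplit L A (Suc 0) S1 p Y"
      proof (rule D1.split_peel[of ?P])
        have "xs \<in> lift A k Y" if xs: "xs \<in> X" for xs
        proof -
          obtain y ys where ys: "xs = y # ys" "ys \<in> cart A k"
            using definable_subset[OF less.prems(3)] xs by (auto simp: tuples_Suc)
          then have "[y] \<in> proj X" using xs by (auto simp: proj_def)
          then show ?thesis using less.prems(4) ys by (auto simp: lift_def)
        qed
        then have "X \<inter> lift A k Y = X" by blast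
        then show "?P Y" using mrX less.prems(1) by simp
        show "\<exists>Z'\<subseteq>Z. ?P Z' \<and> dmr L A (Suc 0) S1 p (Z - Z')" if Z: "?P Z" for Z
        proof -
          obtain W where W: "definable L A (Suc 0) W" "dmr L A (Suc 0) S1 p (Z \<inter> W)"
            "dmr L A (Suc 0) S1 p (Z - W)"
            using no Z by (auto simp: degree_one_def)
          have D: "definable L A (Suc 0) (Z \<inter> W)" "definable L A (Suc 0) (Z - W)"
            by (rule mr_imp_D[OF W(2)], rule mr_imp_D[OF W(3)])
          have "X \<inter> lift A k Z = (X \<inter> lift A k (Z \<inter> W)) \<union> (X \<inter> lift A k (Z - W))"
            by (auto simp: lift_def)
          then have "dmr L A (Suc k) S3 (J p dt) (X \<inter> lift A k (Z \<inter> W)) \<or>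
              dmr L A (Suc k) S3 (J p dt) (X \<inter> lift A k (Z - W))"
            using Z less.prems(3) D by (intro Dk.mr_Un[OF S(3)] Dk.D_Int definable_lift) simp_all
          then show ?thesis
          proof
            assume "dmr L A (Suc k) S3 (J p dt) (X \<inter> lift A k (Z \<inter> W))"
            moreover have "Z - Z \<inter> W = Z - W" by blast
            ultimately show ?thesis
              using Z D W(3) by (intro exI[of _ "Z \<inter> W"]) auto
          next
            assume "dmr L A (Suc k) S3 (J p dt) (X \<inter> lift A k (Z - W))"
            moreover have "Z - (Z - W) = Z \<inter> W" by blast
            ultimately show ?thesis
              using Z D W(2) by (intro exI[of _ "Z - W"]) auto
          qed
        qed
      qed simp
      then show False using less.prems(2) by contradiction
    qed
    then obtain Z where Z: "definable L A (Suc 0) Z" "degree_one L A S1 p Z"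
      "dmr L A (Suc k) S3 (J p dt) (X \<inter> lift A k Z)" by blast
    have prZ: "proj (X \<inter> lift A k Z) \<subseteq> Z" by (auto simp: proj_def lift_def)
    obtain \<phi> e where \<phi>: "wf_fm L \<phi>" "asg A e" "X \<inter> lift A k Z = dset A (Suc k) \<phi> e"
      using mr_imp_D[OF Z(3)] by (auto simp: definable_iff)
    obtain K where K: "Suc k \<le> K" "fv \<phi> \<subseteq> {..<K}" using fv_bounded .
    have "dmr L A (Suc 0) S1 p Z"
      by (rule mr_mono[OF pr[OF _ Z(3)] prZ Z(1)]) simp
    then obtain y where "generic L A S1 p Z k e K y"
      using generic_exists[OF A(2) \<phi>(2) _ S(1)] by blast
    \<comment> \<open>The generic fiber inherits rank \<open>dt\<close>, yet it lies in the
      \<open>k\<close>-th power, which does not have that rank.\<close>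
    then have "dmr L A k S2 dt (fiber (dset A (Suc k) \<phi> e) y)"
      using Z(3) unfolding \<phi>(3)
      by (intro mr_generic_fiber[OF A S(1,2) Z(2,1) prZ[unfolded \<phi>(3)] pr J1 _ \<phi>(1,2) K(2,1)]) auto
    moreover have "fiber (dset A (Suc k) \<phi> e) y \<subseteq> cart A k"
      by (rule fiber_subset[OF definable_subset[OF definable_dset[OF \<phi>(1,2)]]])
    ultimately show False
      using mr_mono[of "definable L A k" S2 dt _ "cart A k"] definable_tuples[OF A(1)] k by blast
  qed
qed

section \<open>Ultrafilters\<close>

definition fip :: "'i set set \<Rightarrow> bool" where
  "fip G \<longleftrightarrow> (\<forall>H\<subseteq>G. finite H \<longrightarrow> \<Inter>H \<noteq> {})"

locale ultrafilter =
  fixes U :: "'i set set"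
  assumes empty: "{} \<notin> U"
    and Int: "A \<in> U \<Longrightarrow> B \<in> U \<Longrightarrow> A \<inter> B \<in> U"
    and up: "A \<in> U \<Longrightarrow> A \<subseteq> B \<Longrightarrow> B \<in> U"
    and ultra: "A \<in> U \<or> - A \<in> U"
begin

lemma UNIV_in: "UNIV \<in> U"
  using ultra[of UNIV] empty by simp

lemma Int_iff: "A \<inter> B \<in> U \<longleftrightarrow> A \<in> U \<and> B \<in> U"
  using Int up by blast

lemma Compl_iff: "- A \<in> U \<longleftrightarrow> A \<notin> U"
  using ultra[of A] Int[of A "- A"] empty by auto

end

lemma ultrafilter_exists:
  assumes "fip F"
  obtains U where "F \<subseteq> U" "ultrafilter U"
proof -
  define \<A> where "\<A> = {G. F \<subseteq> G \<and> fip G}"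
  have "\<exists>G\<in>\<A>. \<forall>X\<in>\<A>. G \<subseteq> X \<longrightarrow> X = G"
  proof (rule subset_Zorn_nonempty)
    show "\<A> \<noteq> {}" using assms by (auto simp: \<A>_def)
    fix C assume C: "C \<noteq> {}" "subset.chain \<A> C"
    have "fip (\<Union>C)"
      unfolding fip_def
    proof (intro allI impI)
      fix H assume H: "H \<subseteq> \<Union>C" "finite H"
      obtain G where "G \<in> C" "H \<subseteq> G"
        using finite_subset_Union_chain[OF H(2,1) C] .
      then show "\<Inter>H \<noteq> {}"
        using C(2) H(2) by (auto simp: subset_chain_def \<A>_def fip_def)
    qed
    moreover obtain G where "G \<in> C" using C(1) by blast
    ultimately show "\<Union>C \<in> \<A>"
      using C(2) by (auto simp: subset_chain_def \<A>_def)
  qed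
  then obtain G where G: "F \<subseteq> G" "fip G" and max: "\<And>X. fip X \<Longrightarrow> G \<subseteq> X \<Longrightarrow> X = G"
    by (auto simp: \<A>_def)
  have ex: "\<exists>H\<subseteq>G. finite H \<and> \<Inter>H \<inter> A = {}" if "A \<notin> G" for A
  proof -
    have "\<not> fip (insert A G)" using max[of "insert A G"] that by auto
    then obtain H where H: "H \<subseteq> insert A G" "finite H" "\<Inter>H = {}" by (auto simp: fip_def)
    then have "\<Inter>(H - {A}) \<inter> A = {}" by auto
    then show ?thesis using H by (intro exI[of _ "H - {A}"]) auto
  qed
  have no: "\<Inter>H \<noteq> {}" if "H \<subseteq> G" "finite H" for H
    using G(2) that by (simp add: fip_def)
  have ultra: "A \<in> G \<or> - A \<in> G" for A
  proof (rule ccontr)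
    assume "\<not> ?thesis"
    then obtain H H' where "H \<subseteq> G" "finite H" "\<Inter>H \<inter> A = {}" "H' \<subseteq> G" "finite H'" "\<Inter>H' \<inter> - A = {}"
      using ex[of A] ex[of "- A"] by blast
    moreover from this have "\<Inter>(H \<union> H') = {}" by blast
    ultimately show False using no[of "H \<union> H'"] by simp
  qed
  have "ultrafilter G"
  proof
    show "{} \<notin> G" using no[of "{{}}"] by auto
    show "A \<inter> B \<in> G" if "A \<in> G" "B \<in> G" for A B
      using ultra[of "A \<inter> B"] no[of "{A, B, - (A \<inter> B)}"] that by auto
    show "B \<in> G" if "A \<in> G" "A \<subseteq> B" for A B
      using ultra[of B] no[of "{A, - B}"] that by auto
  qed (rule ultra)
  then show thesis using G(1) that by blast
qed

text \<open>For finite \<open>X\<close> the index \<open>X\<close> itself lies in all sets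
  \<open>{j. x \<in> d j}\<close> with \<open>x\<close> in \<open>X\<close>, so these sets have the
  finite intersection property. Infinite indices get the dummy value \<open>{}\<close>.\<close>

lemma regular_ultrafilter:
  "\<exists>U (d :: 'x set \<Rightarrow> 'x set). ultrafilter U \<and> (\<forall>j. finite (d j)) \<and> (\<forall>x. {j. x \<in> d j} \<in> U)"
proof -
  define d :: "'x set \<Rightarrow> 'x set" where "d j = (if finite j then j else {})" for j
  define F where "F = range (\<lambda>x. {j. x \<in> d j})"
  have "fip F"
    unfolding fip_def
  proof (intro allI impI)
    fix H assume "H \<subseteq> F" "finite H"
    then obtain X where "finite X" "H = (\<lambda>x. {j. x \<in> d j}) ` X"
      unfolding F_def by (meson finite_subset_image)
    then have "X \<in> \<Inter>H" by (auto simp: d_def)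
    then show "\<Inter>H \<noteq> {}" by blast
  qed
  then obtain U where "F \<subseteq> U" "ultrafilter U" by (rule ultrafilter_exists)
  then show ?thesis by (intro exI[of _ U] exI[of _ d]) (auto simp: F_def d_def)
qed

section \<open>Iterated ultrapowers\<close>

text \<open>Functions of the first \<open>n\<close> coordinates represent stage \<open>n\<close> of
  the iteration, and \<open>fin\<close> describes the union of all stages.\<close>

definition dep :: "nat \<Rightarrow> ((nat \<Rightarrow> 'i) \<Rightarrow> 'c) \<Rightarrow> bool" where
  "dep n f \<longleftrightarrow> (\<forall>x y. (\<forall>i<n. x i = y i) \<longrightarrow> f x = f y)"

definition fin :: "((nat \<Rightarrow> 'i) \<Rightarrow> 'c) \<Rightarrow> bool" where
  "fin f \<longleftrightarrow> (\<exists>n. dep n f)"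

lemma dep_mono: "dep n f \<Longrightarrow> n \<le> m \<Longrightarrow> dep m f"
  unfolding dep_def by (meson order.strict_trans2)

lemma dep_fin: "dep n f \<Longrightarrow> fin f"
  by (auto simp: fin_def)

lemma fin_const [simp]: "fin (\<lambda>_. c)"
  by (auto simp: fin_def dep_def)

lemma fin_comp: "fin f \<Longrightarrow> fin (\<lambda>x. h (f x))"
  unfolding fin_def dep_def by metis

lemma fin_comp2:
  assumes "fin f" "fin g" shows "fin (\<lambda>x. h (f x) (g x))"
proof -
  obtain n m where "dep n f" "dep m g" using assms by (auto simp: fin_def)
  then have "dep (max n m) f" "dep (max n m) g" by (auto intro: dep_mono)
  then have "dep (max n m) (\<lambda>x. h (f x) (g x))" unfolding dep_def by metis
  then show ?thesis by (rule dep_fin)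
qed

lemma fin_uniform:
  "finite V \<Longrightarrow> (\<And>i. i \<in> V \<Longrightarrow> fin (e i)) \<Longrightarrow> \<exists>n. \<forall>i\<in>V. dep n (e i)"
proof (induction V rule: finite_induct)
  case (insert j V)
  then obtain n where "\<forall>i\<in>V. dep n (e i)" by auto
  moreover obtain m where "dep m (e j)" using insert.prems[of j] by (auto simp: fin_def)
  ultimately show ?case
    by (intro exI[of _ "max n m"]) (auto intro: dep_mono[of n] dep_mono[of m])
qed simp

lemma fin_list: "(\<And>g. g \<in> set gs \<Longrightarrow> fin g) \<Longrightarrow> fin (\<lambda>x. map (\<lambda>g. g x) gs)"
proof (induction gs)
  case (Cons g gs)
  then have "fin (\<lambda>x. map (\<lambda>g. g x) gs)" "fin g" by simp_all
  from fin_comp2[OF this(2,1), of Cons] show ?case by simp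
qed simp

lemma dep_sat:
  assumes "\<And>i. i \<in> fv \<phi> \<Longrightarrow> dep n (e i)"
  shows "dep n (\<lambda>x. sat M (\<lambda>i. e i x) \<phi>)"
  unfolding dep_def
proof (intro allI impI)
  fix x y :: "nat \<Rightarrow> 'c" assume "\<forall>i<n. x i = y i"
  then show "sat M (\<lambda>i. e i x) \<phi> = sat M (\<lambda>i. e i y) \<phi>"
    using assms by (intro sat_cong) (simp add: dep_def)
qed

lemma fin_sat: "(\<And>i. fin (e i)) \<Longrightarrow> fin (\<lambda>x. sat M (\<lambda>i. e i x) \<phi>)"
  using fin_uniform[of "fv \<phi>" e] by (auto intro: dep_sat dep_fin)

context ultrafilter
begin

text \<open>Fubini powers of the ultrafilter. Later coordinates are quantified first, so that a coordinate
  can be fixed before the elements of the earlier stages are evaluated.\<close>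

fun Q :: "nat \<Rightarrow> ((nat \<Rightarrow> 'i) \<Rightarrow> bool) \<Rightarrow> bool" where
  "Q 0 P = P (\<lambda>_. undefined)"
| "Q (Suc n) P = ({j. Q n (\<lambda>x. P (x(n := j)))} \<in> U)"

lemma Q_conj: "Q n (\<lambda>x. P x \<and> R x) \<longleftrightarrow> Q n P \<and> Q n R"
  by (induction n arbitrary: P R) (simp_all add: Collect_conj_eq Int_iff)

lemma Q_not: "Q n (\<lambda>x. \<not> P x) \<longleftrightarrow> \<not> Q n P"
  by (induction n arbitrary: P) (simp_all add: Collect_neg_eq Compl_iff)

lemma Q_mono: "Q n P \<Longrightarrow> (\<And>x. P x \<Longrightarrow> R x) \<Longrightarrow> Q n R"
proof (induction n arbitrary: P R)
  case (Suc n)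
  have "{j. Q n (\<lambda>x. P (x(n := j)))} \<subseteq> {j. Q n (\<lambda>x. R (x(n := j)))}"
    by (intro Collect_mono impI) (rule Suc.IH, assumption, rule Suc.prems(2))
  then show ?case using Suc.prems(1) up by simp
qed simp

lemma Q_indep: "dep n P \<Longrightarrow> n \<le> m \<Longrightarrow> Q m P = Q n P"
proof (induction m)
  case (Suc m)
  show ?case
  proof (cases "n = Suc m")
    case False
    then have nm: "n \<le> m" using Suc.prems by simp
    have "P (x(m := j)) = P x" for x j
      using Suc.prems(1) nm unfolding dep_def by (metis fun_upd_apply leD)
    then have "Q (Suc m) P \<longleftrightarrow> {j. Q m P} \<in> U" by simp
    also have "\<dots> \<longleftrightarrow> Q m P" using UNIV_in empty by (cases "Q m P") auto
    finally show ?thesis using Suc.IH[OF Suc.prems(1) nm] by simp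
  qed simp
qed simp

text \<open>By \<open>Q_indep\<close> the choice of \<open>n\<close> does not matter. Predicates
  that depend on infinitely many coordinates are never large, hence the side conditions
  \<open>fin\<close> when passing to a negation or a superset.\<close>

definition large :: "((nat \<Rightarrow> 'i) \<Rightarrow> bool) \<Rightarrow> bool" where
  "large P \<longleftrightarrow> (\<exists>n. dep n P \<and> Q n P)"

lemma large_iff: "dep n P \<Longrightarrow> large P \<longleftrightarrow> Q n P"
  unfolding large_def using Q_indep by (metis le_cases)

lemma large_fin: "large P \<Longrightarrow> fin P"
  by (auto simp: large_def fin_def)

lemma large_conj: "fin P \<Longrightarrow> fin R \<Longrightarrow> large (\<lambda>x. P x \<and> R x) \<longleftrightarrow> large P \<and> large R"
proof -
  assume "fin P" "fin R"
  then obtain n m where nm: "dep n P" "dep m R" by (auto simp: fin_def)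
  let ?N = "max n m"
  have d: "dep ?N P" "dep ?N R" using nm by (auto intro: dep_mono)
  then have "dep ?N (\<lambda>x. P x \<and> R x)" unfolding dep_def by metis
  then show ?thesis using d by (simp add: large_iff Q_conj)
qed

lemma large_conjI: "large P \<Longrightarrow> large R \<Longrightarrow> large (\<lambda>x. P x \<and> R x)"
  by (simp add: large_conj large_fin)

lemma large_not: "fin P \<Longrightarrow> large (\<lambda>x. \<not> P x) \<longleftrightarrow> \<not> large P"
proof -
  assume "fin P"
  then obtain n where n: "dep n P" by (auto simp: fin_def)
  then have "dep n (\<lambda>x. \<not> P x)" unfolding dep_def by metis
  then show ?thesis using n by (simp add: large_iff Q_not)
qed

lemma large_mono: "large P \<Longrightarrow> fin R \<Longrightarrow> (\<And>x. P x \<Longrightarrow> R x) \<Longrightarrow> large R"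
proof -
  assume a: "large P" "fin R" "\<And>x. P x \<Longrightarrow> R x"
  then obtain n m where nm: "dep n P" "dep m R" by (auto simp: fin_def large_def)
  let ?N = "max n m"
  have d: "dep ?N P" "dep ?N R" using nm by (auto intro: dep_mono)
  then show ?thesis using a(1,3) Q_mono[of ?N P R] by (simp add: large_iff)
qed

lemma large_True: "large (\<lambda>_. True)"
  unfolding large_def by (intro exI[of _ 0]) (simp add: dep_def)

lemma large_const [simp]: "large (\<lambda>_. P) \<longleftrightarrow> P"
  using large_True large_not[of "\<lambda>_. True"] by (cases P) auto

lemma large_ball:
  "finite V \<Longrightarrow> (\<And>i. i \<in> V \<Longrightarrow> large (P i)) \<Longrightarrow> large (\<lambda>x. \<forall>i\<in>V. P i x)"
  by (induction V rule: finite_induct) (simp_all add: large_conjI)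

lemma large_cong:
  assumes "large (\<lambda>x. P x = R x)" "fin P" "fin R"
  shows "large P \<longleftrightarrow> large R"
proof
  assume "large P"
  from large_conjI[OF assms(1) this] show "large R"
    by (rule large_mono) (use assms(3) in auto)
next
  assume "large R"
  from large_conjI[OF assms(1) this] show "large P"
    by (rule large_mono) (use assms(2) in auto)
qed

section \<open>The limit of the ultrapowers as a structure, and the theorem of Los\<close>

definition FS :: "'a set \<Rightarrow> ((nat \<Rightarrow> 'i) \<Rightarrow> 'a) set" where
  "FS A = {f. range f \<subseteq> A \<and> fin f}"

text \<open>Chosen representatives replace equivalence classes, so that elements of the ultrapower
  remain functions and can be evaluated at an index.\<close>

definition rep :: "'a set \<Rightarrow> ((nat \<Rightarrow> 'i) \<Rightarrow> 'a) \<Rightarrow> (nat \<Rightarrow> 'i) \<Rightarrow> 'a" where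
  "rep A f = (SOME g. g \<in> FS A \<and> large (\<lambda>x. f x = g x))"

lemma fin_eq: "fin f \<Longrightarrow> fin g \<Longrightarrow> fin (\<lambda>x. f x = g x)"
  by (rule fin_comp2)

lemma rep:
  assumes "f \<in> FS A"
  shows "rep A f \<in> FS A" "large (\<lambda>x. f x = rep A f x)"
proof -
  have "\<exists>g. g \<in> FS A \<and> large (\<lambda>x. f x = g x)"
    using assms by (intro exI[of _ f]) simp
  from someI_ex[OF this] show "rep A f \<in> FS A" "large (\<lambda>x. f x = rep A f x)"
    by (simp_all add: rep_def)
qed

lemma rep_eqI:
  assumes "f \<in> FS A" "g \<in> FS A" "large (\<lambda>x. f x = g x)"
  shows "rep A f = rep A g"
proof -
  have "large (\<lambda>x. f x = h x) \<longleftrightarrow> large (\<lambda>x. g x = h x)" if "h \<in> FS A" for h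
  proof (rule large_cong)
    have "fin f" "fin g" "fin h" using assms that by (simp_all add: FS_def)
    then show *: "fin (\<lambda>x. f x = h x)" "fin (\<lambda>x. g x = h x)" by (simp_all add: fin_eq)
    show "large (\<lambda>x. (f x = h x) = (g x = h x))"
      by (rule large_mono[OF assms(3) fin_comp2[OF *, of "(=)"]]) auto
  qed
  then show ?thesis unfolding rep_def by (metis (no_types, lifting))
qed

definition upow :: "('f, 'r, 'a) fostruct \<Rightarrow> ('f, 'r, (nat \<Rightarrow> 'i) \<Rightarrow> 'a) fostruct" where
  "upow M = \<lparr>univ = rep (univ M) ` FS (univ M),
     func = \<lambda>f xs. rep (univ M) (\<lambda>x. func M f (map (\<lambda>g. g x) xs)),
     pred = \<lambda>p xs. large (\<lambda>x. pred M p (map (\<lambda>g. g x) xs))\<rparr>"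

lemma rep_in_upow: "f \<in> FS (univ M) \<Longrightarrow> rep (univ M) f \<in> univ (upow M)"
  by (simp add: upow_def)

lemma upow_FS: "g \<in> univ (upow M) \<Longrightarrow> g \<in> FS (univ M)"
  using rep(1) by (auto simp: upow_def)

lemma upow_fin: "g \<in> univ (upow M) \<Longrightarrow> fin g"
  using upow_FS by (auto simp: FS_def)

lemma upow_apply: "g \<in> univ (upow M) \<Longrightarrow> g x \<in> univ M"
  using upow_FS[of g M] by (auto simp: FS_def)

lemma upow_eq_iff:
  assumes "g \<in> univ (upow M)" "h \<in> univ (upow M)"
  shows "g = h \<longleftrightarrow> large (\<lambda>x. g x = h x)"
proof
  obtain f f' where f: "f \<in> FS (univ M)" "g = rep (univ M) f" "f' \<in> FS (univ M)" "h = rep (univ M) f'"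
    using assms by (auto simp: upow_def)
  have r: "rep (univ M) k = rep (univ M) (rep (univ M) k)" if "k \<in> FS (univ M)" for k
    by (rule rep_eqI[OF that rep(1)[OF that] rep(2)[OF that]])
  assume "large (\<lambda>x. g x = h x)"
  then have "rep (univ M) g = rep (univ M) h"
    using rep_eqI upow_FS assms by blast
  then show "g = h" using f r by metis
qed simp

lemma upow_list:
  assumes "set xs \<subseteq> univ (upow M)"
  shows "fin (\<lambda>x. map (\<lambda>g. g x) xs)" "set (map (\<lambda>g. g x) xs) \<subseteq> univ M"
proof -
  have "g \<in> univ (upow M)" if "g \<in> set xs" for g using assms that by blast
  note this[THEN upow_fin] this[THEN upow_apply]
  then show "fin (\<lambda>x. map (\<lambda>g. g x) xs)" "set (map (\<lambda>g. g x) xs) \<subseteq> univ M"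
    by (auto intro: fin_list)
qed

lemma func_FS:
  assumes "is_fostruct L M" "set xs \<subseteq> univ (upow M)" "(f, length xs) \<in> funs L"
  shows "(\<lambda>x. func M f (map (\<lambda>g. g x) xs)) \<in> FS (univ M)"
proof -
  have "func M f (map (\<lambda>g. g x) xs) \<in> univ M" for x
    using assms(1,3) upow_list(2)[OF assms(2), of x] unfolding is_fostruct_def
    by (metis (mono_tags, lifting) case_prodD length_map)
  then show ?thesis using fin_comp[OF upow_list(1)[OF assms(2)], of "func M f"] by (auto simp: FS_def)
qed

lemma is_fostruct_upow:
  assumes "is_fostruct L M"
  shows "is_fostruct L (upow M)"
  unfolding is_fostruct_def
proof (intro conjI ballI, safe)
  assume "univ (upow M) = {}"
  moreover obtain a where "a \<in> univ M" using assms by (auto simp: is_fostruct_def)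
  then have "(\<lambda>_. a) \<in> FS (univ M)" by (auto simp: FS_def)
  ultimately show False using rep_in_upow by blast
next
  fix f xs assume "(f, length xs) \<in> funs L" "set xs \<subseteq> univ (upow M)"
  then show "func (upow M) f xs \<in> univ (upow M)"
    using func_FS[OF assms] rep_in_upow by (fastforce simp: upow_def)
qed

lemma upow_eval:
  assumes M: "is_fostruct L M" and e: "asg (upow M) e"
  shows "wf_tm L t \<Longrightarrow> large (\<lambda>x. eval_tm (upow M) e t x = eval_tm M (\<lambda>i. e i x) t)"
proof (induction t)
  case (Fn f ts)
  let ?xs = "map (eval_tm (upow M) e) ts"
  have wf: "(f, length ?xs) \<in> funs L" "\<And>t. t \<in> set ts \<Longrightarrow> wf_tm L t" using Fn.prems by auto
  have "eval_tm (upow M) e t \<in> univ (upow M)" if "t \<in> set ts" for t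
    using eval_tm_in_univ[OF is_fostruct_upow[OF M] wf(2)[OF that]] e by blast
  then have xs: "set ?xs \<subseteq> univ (upow M)" by auto
  have fs: "(\<lambda>x. func M f (map (\<lambda>g. g x) ?xs)) \<in> FS (univ M)" by (rule func_FS[OF M xs wf(1)])
  have ev: "eval_tm (upow M) e (Fn f ts) = rep (univ M) (\<lambda>x. func M f (map (\<lambda>g. g x) ?xs))"
    by (simp add: upow_def)
  have "large (\<lambda>x. \<forall>t\<in>set ts. eval_tm (upow M) e t x = eval_tm M (\<lambda>i. e i x) t)"
    using Fn.IH wf(2) by (intro large_ball) auto
  from large_conjI[OF rep(2)[OF fs] this]
  show ?case
  proof (rule large_mono)
    have "fin (eval_tm (upow M) e (Fn f ts))"
      using rep(1)[OF fs] unfolding ev by (simp add: FS_def)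
    moreover have "fin (\<lambda>x. eval_tm M (\<lambda>i. e i x) (Fn f ts))"
    proof -
      have "fin (e i)" for i using upow_fin e by blast
      then obtain n where "\<forall>i\<in>fv_tm (Fn f ts). dep n (e i)"
        using fin_uniform[OF finite_fv_tm, of "Fn f ts" e] by blast
      then have "dep n (\<lambda>x. eval_tm M (\<lambda>i. e i x) (Fn f ts))"
        unfolding dep_def by (intro allI impI eval_tm_cong) blast
      then show ?thesis by (rule dep_fin)
    qed
    ultimately show "fin (\<lambda>x. eval_tm (upow M) e (Fn f ts) x = eval_tm M (\<lambda>i. e i x) (Fn f ts))"
      by (rule fin_eq)
  next
    fix x
    assume *: "func M f (map (\<lambda>g. g x) ?xs) = rep (univ M) (\<lambda>x. func M f (map (\<lambda>g. g x) ?xs)) x \<and>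
      (\<forall>t\<in>set ts. eval_tm (upow M) e t x = eval_tm M (\<lambda>i. e i x) t)"
    then have "map (\<lambda>g. g x) ?xs = map (eval_tm M (\<lambda>i. e i x)) ts" by simp
    then show "eval_tm (upow M) e (Fn f ts) x = eval_tm M (\<lambda>i. e i x) (Fn f ts)"
      using * unfolding ev eval_tm.simps(2)[of M] by metis
  qed
qed simp

text \<open>The choice operator sees \<open>x\<close> only through \<open>R x\<close>, so the chosen
  function depends on no further coordinates and stays in the ultrapower.\<close>

lemma choice_FS:
  assumes "\<And>x. \<exists>a\<in>A. R x a" "dep n R"
  obtains w where "w \<in> FS A" "\<And>x. R x (w x)" "dep n w"
proof -
  define w where "w x = (SOME a. a \<in> A \<and> R x a)" for x
  have w: "w x \<in> A \<and> R x (w x)" for x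
    using someI_ex[of "\<lambda>a. a \<in> A \<and> R x a"] assms(1)[of x] unfolding w_def Bex_def by simp
  moreover have "dep n w"
    using assms(2) unfolding dep_def w_def by metis
  ultimately show thesis by (intro that[of w]) (auto simp: FS_def dep_fin)
qed

theorem los:
  assumes M: "is_fostruct L M"
  shows "asg (upow M) e \<Longrightarrow> wf_fm L \<phi> \<Longrightarrow>
    sat (upow M) e \<phi> \<longleftrightarrow> large (\<lambda>x. sat M (\<lambda>i. e i x) \<phi>)"
proof (induction \<phi> arbitrary: e)
  case (Eql s t)
  let ?s = "\<lambda>x. eval_tm M (\<lambda>i. e i x) s" and ?t = "\<lambda>x. eval_tm M (\<lambda>i. e i x) t"
  let ?s' = "eval_tm (upow M) e s" and ?t' = "eval_tm (upow M) e t"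
  have U: "?s' \<in> univ (upow M)" "?t' \<in> univ (upow M)"
    using Eql.prems by (auto intro!: eval_tm_in_univ[OF is_fostruct_upow[OF M]])
  have f: "fin (e i)" for i using upow_fin Eql.prems(1) by blast
  have fin: "fin (\<lambda>x. ?s x = ?t x)"
    using fin_sat[OF f, where M = M and \<phi> = "Eql s t"] by simp
  have fin': "fin (\<lambda>x. ?s' x = ?t' x)" by (intro fin_eq upow_fin[OF U(1)] upow_fin[OF U(2)])
  have "large (\<lambda>x. ?s' x = ?s x \<and> ?t' x = ?t x)"
    using Eql.prems by (intro large_conjI upow_eval[OF M]) auto
  then have "large (\<lambda>x. (?s' x = ?t' x) = (?s x = ?t x))"
    by (rule large_mono) (use fin_comp2[OF fin' fin, of "(=)"] in auto)
  then have "large (\<lambda>x. ?s' x = ?t' x) \<longleftrightarrow> large (\<lambda>x. ?s x = ?t x)"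
    by (rule large_cong[OF _ fin' fin])
  then show ?case using upow_eq_iff[OF U] by simp
next
  case (Rl p ts)
  let ?xs = "map (eval_tm (upow M) e) ts"
  have xs: "set ?xs \<subseteq> univ (upow M)"
    using Rl.prems by (auto intro!: eval_tm_in_univ[OF is_fostruct_upow[OF M]])
  have f: "fin (e i)" for i using upow_fin Rl.prems(1) by blast
  let ?P = "\<lambda>x. pred M p (map (\<lambda>g. g x) ?xs)" and ?R = "\<lambda>x. sat M (\<lambda>i. e i x) (Rl p ts)"
  have fin: "fin ?P" "fin ?R"
    by (rule fin_comp[OF upow_list(1)[OF xs], of "pred M p"], rule fin_sat[OF f])
  have "large (\<lambda>x. \<forall>t\<in>set ts. eval_tm (upow M) e t x = eval_tm M (\<lambda>i. e i x) t)"
    using Rl.prems by (intro large_ball upow_eval[OF M]) auto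
  then have "large (\<lambda>x. ?P x = ?R x)"
  proof (rule large_mono)
    fix x assume "\<forall>t\<in>set ts. eval_tm (upow M) e t x = eval_tm M (\<lambda>i. e i x) t"
    then have "map (\<lambda>g. g x) ?xs = map (eval_tm M (\<lambda>i. e i x)) ts" by simp
    then show "?P x = ?R x" by (simp only: sat.simps)
  qed (rule fin_comp2[OF fin])
  then have "large ?P \<longleftrightarrow> large ?R" by (rule large_cong[OF _ fin])
  then show ?case by (simp add: upow_def)
next
  case (Neg \<phi>)
  have "fin (e i)" for i using upow_fin Neg.prems(1) by blast
  then show ?case using Neg by (simp add: large_not fin_sat)
next
  case (Conj \<phi> \<psi>)
  have "fin (e i)" for i using upow_fin Conj.prems(1) by blast
  then show ?case using Conj by (simp add: large_conj fin_sat)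
next
  case (Ex i \<phi>)
  have f: "fin (e k)" for k using upow_fin Ex.prems(1) by blast
  have upd: "(\<lambda>k. (e(i := a)) k x) = (\<lambda>k. e k x)(i := a x)" for a x by auto
  have IH: "sat (upow M) (e(i := a)) \<phi> \<longleftrightarrow> large (\<lambda>x. sat M ((\<lambda>k. e k x)(i := a x)) \<phi>)"
    if "a \<in> univ (upow M)" for a
  proof -
    have "asg (upow M) (e(i := a))" using Ex.prems(1) that by auto
    from Ex.IH[OF this] Ex.prems(2) show ?thesis unfolding upd wf_fm.simps by blast
  qed
  have fs: "fin (\<lambda>x. sat M ((\<lambda>k. e k x)(i := a x)) \<phi>)" if "fin a" for a
    using fin_sat[of "e(i := a)" M \<phi>] f that unfolding upd by simp
  show ?case
  proof
    assume "sat (upow M) e (Ex i \<phi>)"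
    then obtain a where a: "a \<in> univ (upow M)" "large (\<lambda>x. sat M ((\<lambda>k. e k x)(i := a x)) \<phi>)"
      using IH by auto
    show "large (\<lambda>x. sat M (\<lambda>k. e k x) (Ex i \<phi>))"
      by (rule large_mono[OF a(2) fin_sat[OF f]]) (use upow_apply[OF a(1)] in auto)
  next
    assume large: "large (\<lambda>x. sat M (\<lambda>k. e k x) (Ex i \<phi>))"
    obtain n where n: "\<forall>k\<in>fv \<phi>. dep n (e k)"
      using fin_uniform[of "fv \<phi>" e] f by auto
    obtain c where "c \<in> univ M" using M by (auto simp: is_fostruct_def)
    \<comment> \<open>The implication makes a witness available at every index, also where the
      existential formula fails.\<close>
    define R where "R x a \<longleftrightarrow> sat M (\<lambda>k. e k x) (Ex i \<phi>) \<longrightarrow> sat M ((\<lambda>k. e k x)(i := a)) \<phi>" for x a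
    have "dep n R"
      unfolding dep_def
    proof (intro allI impI)
      fix x y :: "nat \<Rightarrow> 'i" assume "\<forall>k<n. x k = y k"
      then have "e k x = e k y" if "k \<in> fv \<phi>" for k
        using n that by (simp add: dep_def)
      then have "sat M ((\<lambda>k. e k x)(i := a)) \<phi> = sat M ((\<lambda>k. e k y)(i := a)) \<phi>" for a
        by (intro sat_cong) auto
      then show "R x = R y" by (simp add: R_def fun_eq_iff)
    qed
    moreover have "\<exists>a\<in>univ M. R x a" for x using \<open>c \<in> univ M\<close> by (auto simp: R_def)
    ultimately obtain w where w: "w \<in> FS (univ M)" "\<And>x. R x (w x)"
      using choice_FS by metis
    let ?a = "rep (univ M) w"
    have a: "?a \<in> univ (upow M)" by (rule rep_in_upow[OF w(1)])
    have "large (\<lambda>x. sat M ((\<lambda>k. e k x)(i := ?a x)) \<phi>)"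
      by (rule large_mono[OF large_conjI[OF large rep(2)[OF w(1)]] fs[OF upow_fin[OF a]]])
         (use w(2) in \<open>metis R_def\<close>)
    then have "sat (upow M) (e(i := ?a)) \<phi>" using IH[OF a] by simp
    then show "sat (upow M) e (Ex i \<phi>)" using a by auto
  qed
qed

lemma upow_embedding:
  assumes "is_fostruct L M"
  shows "elementary_embedding L M (upow M) (\<lambda>a. rep (univ M) (\<lambda>_. a))"
  unfolding elementary_embedding_def
proof (intro conjI allI impI)
  have c: "(\<lambda>_. a) \<in> FS (univ M)" if "a \<in> univ M" for a using that by (auto simp: FS_def)
  then show sub: "(\<lambda>a. rep (univ M) (\<lambda>_. a)) ` univ M \<subseteq> univ (upow M)"
    using rep_in_upow by blast
  fix \<phi> and e :: "nat \<Rightarrow> _" assume \<phi>: "wf_fm L \<phi> \<and> asg M e"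
  let ?e = "(\<lambda>a. rep (univ M) (\<lambda>_. a)) \<circ> e"
  have e: "asg (upow M) ?e" using sub \<phi> by auto
  have f: "fin (?e i)" for i using e upow_fin by blast
  have "large (\<lambda>x. e i = ?e i x)" for i
  proof -
    have "e i \<in> univ M" using \<phi> by auto
    from rep(2)[OF c[OF this]] show ?thesis by simp
  qed
  then have "large (\<lambda>x. \<forall>i\<in>fv \<phi>. e i = ?e i x)" by (intro large_ball) auto
  then have "large (\<lambda>x. sat M e \<phi> = sat M (\<lambda>i. ?e i x) \<phi>)"
  proof (rule large_mono)
    show "fin (\<lambda>x. sat M e \<phi> = sat M (\<lambda>i. ?e i x) \<phi>)" by (rule fin_comp[OF fin_sat[OF f]])
  qed (rule sat_cong, blast)
  then have "large (\<lambda>_. sat M e \<phi>) \<longleftrightarrow> large (\<lambda>x. sat M (\<lambda>i. ?e i x) \<phi>)"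
    by (rule large_cong[OF _ fin_const fin_sat[OF f]])
  then show "sat M e \<phi> \<longleftrightarrow> sat (upow M) ?e \<phi>"
    using los[OF assms e] \<phi> by simp
qed

text \<open>A type over parameters from stage \<open>n\<close> is realised at stage \<open>n + 1\<close>: at \<open>x\<close> one realises the
  finitely many formulas of the type that belong to \<open>d (x n)\<close>.\<close>

lemma upow_saturated:
  fixes M :: "('f, 'r, 'a) fostruct" and d :: "'i \<Rightarrow> ('f, 'r) fm set"
  assumes M: "is_fostruct L M" and d: "\<And>j. finite (d j)" "\<And>\<phi>. {j. \<phi> \<in> d j} \<in> U"
  shows "aleph0_saturated L (upow M)"
  unfolding aleph0_saturated_def
proof (intro allI impI, elim conjE)
  fix e k \<Phi>
  assume e: "asg (upow M) e" and \<Phi>: "\<forall>\<phi>\<in>\<Phi>. wf_fm L \<phi> \<and> fv \<phi> \<subseteq> {0..k}"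
    and fs: "\<forall>\<Psi>\<subseteq>\<Phi>. finite \<Psi> \<longrightarrow> (\<exists>a\<in>univ (upow M). \<forall>\<phi>\<in>\<Psi>. sat (upow M) (e(0 := a)) \<phi>)"
  have f: "fin (e i)" for i using e upow_fin by blast
  have upd: "(\<lambda>i. (e(0 := a)) i x) = (\<lambda>i. e i x)(0 := a x)" for a x by auto
  have los': "sat (upow M) (e(0 := a)) \<phi> \<longleftrightarrow> large (\<lambda>x. sat M ((\<lambda>i. e i x)(0 := a x)) \<phi>)"
    if "a \<in> univ (upow M)" "\<phi> \<in> \<Phi>" for a \<phi>
  proof -
    have "asg (upow M) (e(0 := a))" using e that by auto
    from los[OF M this, of \<phi>] \<Phi> that(2) show ?thesis unfolding upd by blast
  qed
  have fs': "fin (\<lambda>x. sat M ((\<lambda>i. e i x)(0 := a x)) \<phi>)" if "fin a" for a \<phi>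
    using fin_sat[of "e(0 := a)" M \<phi>] f that unfolding upd by simp
  obtain n where n: "\<forall>i\<in>{0..k}. dep n (e i)"
    using fin_uniform[of "{0..k}" e] f by auto
  define T where "T j x a \<longleftrightarrow> (\<forall>\<phi>\<in>d j \<inter> \<Phi>. sat M ((\<lambda>i. e i x)(0 := a)) \<phi>)" for j x a
  have depT: "T j x = T j y" if "\<forall>i<n. x i = y i" for j x y
  proof -
    have "e i x = e i y" if "i \<le> k" for i
      using n that \<open>\<forall>i<n. x i = y i\<close> by (simp add: dep_def)
    then have "sat M ((\<lambda>i. e i x)(0 := a)) \<phi> = sat M ((\<lambda>i. e i y)(0 := a)) \<phi>" if "\<phi> \<in> \<Phi>" for a \<phi>
      using \<Phi> that by (intro sat_cong) fastforce
    then show ?thesis unfolding T_def fun_eq_iff by simp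
  qed
  define R where "R j x \<longleftrightarrow> (\<exists>a\<in>univ M. T j x a)" for j x
  have depR: "dep n (R j)" for j
    unfolding dep_def R_def
  proof (intro allI impI)
    fix x y :: "nat \<Rightarrow> 'i" assume "\<forall>i<n. x i = y i"
    from depT[OF this] show "(\<exists>a\<in>univ M. T j x a) = (\<exists>a\<in>univ M. T j y a)" by simp
  qed
  \<comment> \<open>With \<open>j\<close> fixed only a finite part of the type matters. One element
    of the ultrapower realises it, and the values of that element witness \<open>R j\<close> at
    almost all indices.\<close>
  have QR: "Q n (R j)" for j
  proof -
    have "d j \<inter> \<Phi> \<subseteq> \<Phi>" "finite (d j \<inter> \<Phi>)" using d(1) by auto
    then obtain a where a: "a \<in> univ (upow M)" "\<forall>\<phi>\<in>d j \<inter> \<Phi>. sat (upow M) (e(0 := a)) \<phi>"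
      using fs by blast
    then have "large (\<lambda>x. \<forall>\<phi>\<in>d j \<inter> \<Phi>. sat M ((\<lambda>i. e i x)(0 := a x)) \<phi>)"
      using d(1) los' by (intro large_ball) auto
    then have "large (R j)"
      by (rule large_mono[OF _ dep_fin[OF depR]]) (use upow_apply[OF a(1)] in \<open>auto simp: R_def T_def\<close>)
    then show ?thesis using large_iff[OF depR] by simp
  qed
  obtain c where c: "c \<in> univ M" using M by (auto simp: is_fostruct_def)
  define V where "V x a \<longleftrightarrow> (R (x n) x \<longrightarrow> T (x n) x a)" for x a
  have "dep (Suc n) V"
    unfolding dep_def
  proof (intro allI impI)
    fix x y :: "nat \<Rightarrow> 'i" assume xy: "\<forall>i<Suc n. x i = y i"
    then have "T j x = T j y" for j by (intro depT) simp
    then show "V x = V y" using xy by (simp add: V_def R_def fun_eq_iff)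
  qed
  moreover have "\<exists>a\<in>univ M. V x a" for x using c by (auto simp: V_def R_def)
  ultimately obtain w where w: "w \<in> FS (univ M)" "\<And>x. V x (w x)"
    using choice_FS by metis
  let ?a = "rep (univ M) w"
  have a: "?a \<in> univ (upow M)" by (rule rep_in_upow[OF w(1)])
  have "sat (upow M) (e(0 := ?a)) \<phi>" if \<phi>: "\<phi> \<in> \<Phi>" for \<phi>
  proof -
    let ?P = "\<lambda>x. \<phi> \<in> d (x n) \<and> R (x n) x"
    have "R j (x(n := j)) = R j x" for j x
      using depR[of j] unfolding dep_def by (metis fun_upd_apply less_irrefl)
    \<comment> \<open>Coordinate \<open>n\<close> is quantified first: for each \<open>j\<close>
      with \<open>\<phi>\<close> in \<open>d j\<close> the remaining statement is \<open>QR\<close>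
      for that fixed \<open>j\<close>, and regularity says that almost all \<open>j\<close> are of
      this kind.\<close>
    then have "Q n (\<lambda>x. ?P (x(n := j)))" if "\<phi> \<in> d j" for j using QR[of j] that by simp
    then have "{j. \<phi> \<in> d j} \<subseteq> {j. Q n (\<lambda>x. ?P (x(n := j)))}" by blast
    then have "Q (Suc n) ?P" using up[OF d(2)[of \<phi>]] by simp
    moreover have "dep (Suc n) ?P"
      unfolding dep_def
    proof (intro allI impI)
      fix x y :: "nat \<Rightarrow> 'i" assume xy: "\<forall>i<Suc n. x i = y i"
      then have "R (x n) x = R (x n) y" using depR[of "x n"] by (simp add: dep_def)
      then show "?P x = ?P y" using xy by simp
    qed
    ultimately have "large ?P" by (simp add: large_iff)
    then have "large (\<lambda>x. sat M ((\<lambda>i. e i x)(0 := ?a x)) \<phi>)"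
    proof (rule large_mono[OF large_conjI[OF _ rep(2)[OF w(1)]] fs'[OF upow_fin[OF a]]])
      fix x assume x: "(\<phi> \<in> d (x n) \<and> R (x n) x) \<and> w x = ?a x"
      then have "T (x n) x (w x)" using w(2)[of x] by (simp add: V_def)
      then show "sat M ((\<lambda>i. e i x)(0 := ?a x)) \<phi>" using x \<phi> by (simp add: T_def)
    qed
    then show ?thesis using los'[OF a \<phi>] by simp
  qed
  then show "\<exists>a\<in>univ (upow M). \<forall>\<phi>\<in>\<Phi>. sat (upow M) (e(0 := a)) \<phi>" using a by blast
qed

end

section \<open>Small elementary substructures\<close>

lemma card_of_tuples:
  assumes "infinite (UNIV :: 't set)" "|A| \<le>o |UNIV :: 't set|"
  shows "|tuples A n| \<le>o |UNIV :: 't set|"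
proof (induction n)
  case 0
  then show ?case by (simp add: card_of_singl_ordLeq)
next
  case (Suc n)
  have "tuples A (Suc n) = (\<lambda>(a, xs). a # xs) ` (A \<times> tuples A n)"
    by (auto simp: tuples_Suc)
  then have "|tuples A (Suc n)| \<le>o |A \<times> tuples A n|" by (simp only: card_of_image)
  also have "|A \<times> tuples A n| \<le>o |UNIV :: 't set|"
    by (rule card_of_Times_ordLeq_infinite_Field) (simp_all add: assms Suc card_of_card_order_on Field_card_of)
  finally show ?case .
qed

lemma card_of_lists:
  assumes "infinite (UNIV :: 't set)" "|A| \<le>o |UNIV :: 't set|"
  shows "|lists A| \<le>o |UNIV :: 't set|"
proof -
  have "lists A = (\<Union>n\<in>UNIV. tuples A n)" by (auto simp: tuples_def)
  moreover have "|UNIV :: nat set| \<le>o |UNIV :: 't set|"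
    using assms(1) infinite_iff_card_of_nat by blast
  ultimately show ?thesis
    using card_of_UNION_ordLeq_infinite[OF assms(1), of UNIV "tuples A"] card_of_tuples[OF assms] by simp
qed

text \<open>The hull is closed under witnesses for whole sets of formulas from \<open>\<C>\<close>.
  Singletons alone give the usual theorem by the Tarski-Vaught criterion; taking all sets of
  formulas makes the hull inherit saturation.\<close>

lemma downward_loewenheim_skolem:
  fixes A :: "('f, 'r, 'x) fostruct" and \<C> :: "('f, 'r) fm set set"
  assumes A: "is_fostruct L A" and X: "X \<subseteq> univ A" and \<C>: "\<And>\<phi>. {\<phi>} \<in> \<C>"
    and card: "infinite (UNIV :: 't set)" "|X| \<le>o |UNIV :: 't set|" "|\<C>| \<le>o |UNIV :: 't set|"
  obtains B :: "('f, 'r, 't) fostruct" and g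
  where "is_fostruct L B" "elementary_embedding L B A g" "inj_on g (univ B)" "X \<subseteq> g ` univ B"
    "\<And>\<Phi> e k. \<Phi> \<in> \<C> \<Longrightarrow> asg B e \<Longrightarrow> (\<And>\<phi>. \<phi> \<in> \<Phi> \<Longrightarrow> wf_fm L \<phi> \<and> fv \<phi> \<subseteq> {0..k}) \<Longrightarrow>
      \<exists>a\<in>univ A. \<forall>\<phi>\<in>\<Phi>. sat A ((g \<circ> e)(0 := a)) \<phi> \<Longrightarrow>
      \<exists>b\<in>univ B. \<forall>\<phi>\<in>\<Phi>. sat B (e(0 := b)) \<phi>"
proof -
  obtain c where c: "c \<in> univ A" using A by (auto simp: is_fostruct_def)
  \<comment> \<open>As in the definition of saturation, parameters start at variable 1;
    \<open>c\<close> fills all other variables.\<close>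
  define env where "env ps i = (if 1 \<le> i \<and> i \<le> length ps then ps ! (i - 1) else c)" for ps i
  define wit where "wit \<Phi> ps = (SOME a. a \<in> univ A \<and> ((\<exists>a\<in>univ A. \<forall>\<phi>\<in>\<Phi>. sat A ((env ps)(0 := a)) \<phi>) \<longrightarrow>
    (\<forall>\<phi>\<in>\<Phi>. sat A ((env ps)(0 := a)) \<phi>)))" for \<Phi> ps
  have wit: "wit \<Phi> ps \<in> univ A \<and> ((\<exists>a\<in>univ A. \<forall>\<phi>\<in>\<Phi>. sat A ((env ps)(0 := a)) \<phi>) \<longrightarrow>
    (\<forall>\<phi>\<in>\<Phi>. sat A ((env ps)(0 := wit \<Phi> ps)) \<phi>))" for \<Phi> ps
    unfolding wit_def by (rule someI_ex) (use c in blast)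
  define C where "C = rec_nat (insert c X) (\<lambda>_ C. C \<union> (\<lambda>(\<Phi>, ps). wit \<Phi> ps) ` (\<C> \<times> lists C))"
  have C0: "C 0 = insert c X" and CS: "C (Suc n) = C n \<union> (\<lambda>(\<Phi>, ps). wit \<Phi> ps) ` (\<C> \<times> lists (C n))" for n
    by (simp_all add: C_def)
  have CA: "C n \<subseteq> univ A" for n
    by (induction n) (use c X wit in \<open>auto simp: C0 CS\<close>)
  have "|C n| \<le>o |UNIV :: 't set|" for n
  proof (induction n)
    case 0
    have "|{c}| \<le>o |UNIV :: 't set|"
      by (rule card_of_singl_ordLeq) simp
    then have "|{c} \<union> X| \<le>o |UNIV :: 't set|"
      using card_of_Un_ordLeq_infinite_Field[of "|UNIV :: 't set|" "{c}" X] card(1,2)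
      by (simp add: card_of_card_order_on Field_card_of)
    then show ?case by (simp add: C0)
  next
    case (Suc n)
    have "|(\<lambda>(\<Phi>, ps). wit \<Phi> ps) ` (\<C> \<times> lists (C n))| \<le>o |\<C> \<times> lists (C n)|" by (rule card_of_image)
    also have "|\<C> \<times> lists (C n)| \<le>o |UNIV :: 't set|"
      by (rule card_of_Times_ordLeq_infinite_Field)
         (simp_all add: card card_of_lists[OF card(1) Suc] card_of_card_order_on Field_card_of)
    finally show ?case
      unfolding CS using card_of_Un_ordLeq_infinite_Field[of "|UNIV :: 't set|"] card(1) Suc
      by (simp add: card_of_card_order_on Field_card_of)
  qed
  moreover have "|UNIV :: nat set| \<le>o |UNIV :: 't set|"
    using card(1) infinite_iff_card_of_nat by blast
  ultimately have "|\<Union>n. C n| \<le>o |UNIV :: 't set|"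
    using card_of_UNION_ordLeq_infinite[OF card(1), of UNIV C] by blast
  then obtain h :: "'x \<Rightarrow> 't" where h: "inj_on h (\<Union>n. C n)"
    using card_of_ordLeq[of "\<Union>n. C n" "UNIV :: 't set"] by blast
  define D where "D = (\<Union>n. C n)"
  note h = h[folded D_def]
  have DA: "D \<subseteq> univ A" using CA by (auto simp: D_def)
  have Cmono: "C n \<subseteq> C m" if "n \<le> m" for n m
    using that by (rule lift_Suc_mono_le[rotated]) (simp add: CS)
  have witD: "wit \<Phi> ps \<in> D" if "\<Phi> \<in> \<C>" "set ps \<subseteq> D" for \<Phi> ps
  proof -
    have "\<exists>n. set ps \<subseteq> C n"
      using that(2)
    proof (induction ps)
      case (Cons p ps)
      then obtain n m where "set ps \<subseteq> C n" "p \<in> C m" by (auto simp: D_def)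
      then show ?case
        using Cmono[of n "max n m"] Cmono[of m "max n m"] by (intro exI[of _ "max n m"]) auto
    qed simp
    then obtain n where "ps \<in> lists (C n)" by auto
    then have "wit \<Phi> ps \<in> C (Suc n)" using that(1) by (auto simp: CS)
    then show ?thesis by (auto simp: D_def)
  qed
  \<comment> \<open>The type variable \<open>k\<close> is swapped to 0. The swapped formulas use
    variables up to \<open>K + k\<close> only, so a finite list \<open>ps\<close> holds all
    parameters.\<close>
  have realize: "\<exists>b\<in>D. \<forall>\<phi>\<in>\<Phi>. sat A (e(k := b)) \<phi>"
    if \<Phi>: "ren (swap k) ` \<Phi> \<in> \<C>" and e: "range e \<subseteq> D" and fv: "\<And>\<phi>. \<phi> \<in> \<Phi> \<Longrightarrow> fv \<phi> \<subseteq> {0..K}"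
      and ex: "\<exists>a\<in>univ A. \<forall>\<phi>\<in>\<Phi>. sat A (e(k := a)) \<phi>" for \<Phi> e k K
  proof -
    define ps where "ps = map (e \<circ> swap k) [1..<Suc (K + k)]"
    have eq: "sat A ((env ps)(0 := a)) (ren (swap k) \<phi>) = sat A (e(k := a)) \<phi>" if "\<phi> \<in> \<Phi>" for a \<phi>
    proof -
      have "((env ps)(0 := a)) i = ((e \<circ> swap k)(0 := a)) i" if i: "i \<in> fv (ren (swap k) \<phi>)" for i
      proof -
        obtain j where "i = swap k j" "j \<le> K"
          using i fv[OF \<open>\<phi> \<in> \<Phi>\<close>] by (auto simp: fv_ren[OF inj_swap])
        then have "i \<le> K + k" by (auto simp: swap_def)
        then show ?thesis by (auto simp: env_def ps_def simp del: upt_Suc)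
      qed
      then have "sat A ((env ps)(0 := a)) (ren (swap k) \<phi>) = sat A ((e \<circ> swap k)(0 := a)) (ren (swap k) \<phi>)"
        by (rule sat_cong)
      then show ?thesis by (simp add: sat_ren_swap)
    qed
    have "set ps \<subseteq> D" using e by (auto simp: ps_def)
    with witD[OF \<Phi> this] wit[of "ren (swap k) ` \<Phi>" ps] ex eq show ?thesis by auto
  qed
  \<comment> \<open>The value is the only witness of the formula that equates variable 0 with the
    function term, so closure under functions is a case of closure under witnesses.\<close>
  have func: "func A f ps \<in> D" if f: "(f, length ps) \<in> funs L" "set ps \<subseteq> D" for f ps
  proof -
    define \<phi> :: "('f, 'r) fm" where "\<phi> = Eql (Var 0) (Fn f (map Var [1..<Suc (length ps)]))"
    have "map (\<lambda>i. eval_tm A ((env ps)(0 := a)) (Var i)) [1..<Suc (length ps)] = ps" for a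
      by (rule nth_equalityI) (auto simp: env_def simp del: upt_Suc)
    then have *: "sat A ((env ps)(0 := a)) \<phi> \<longleftrightarrow> a = func A f ps" for a
      unfolding \<phi>_def sat.simps eval_tm.simps(2) map_map comp_def by simp
    have "func A f ps \<in> univ A"
      using A f DA unfolding is_fostruct_def by fastforce
    then have "wit {\<phi>} ps = func A f ps" using wit[of "{\<phi>}" ps] * by auto
    then show ?thesis using witD[OF \<C> f(2), of \<phi>] by simp
  qed
  define g where "g = inv_into D h"
  have gh: "g (h a) = a" if "a \<in> D" for a using that h by (simp add: g_def)
  \<comment> \<open>The hull \<open>D\<close> is moved into the small type along the injection
    \<open>h\<close>, with \<open>g\<close> as its inverse.\<close>
  define B where "B = \<lparr>univ = h ` D, func = \<lambda>f xs. h (func A f (map g xs)),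
    pred = \<lambda>p xs. pred A p (map g xs)\<rparr>"
  have gB: "g b \<in> D" if "b \<in> univ B" for b using that gh by (auto simp: B_def)
  have B: "is_fostruct L B"
    unfolding is_fostruct_def
  proof (intro conjI ballI, safe)
    assume "univ B = {}"
    then show False using C0 by (auto simp: B_def D_def)
  next
    fix f xs assume f: "(f, length xs) \<in> funs L" "set xs \<subseteq> univ B"
    then have "set (map g xs) \<subseteq> D" using gB by auto
    then show "func B f xs \<in> univ B" using func[of f "map g xs"] f(1) by (simp add: B_def)
  qed
  have eval: "g (eval_tm B e t) = eval_tm A (g \<circ> e) t" if "asg B e" "wf_tm L t" for e t
    using that(2)
  proof (induction t)
    case (Fn f ts)
    have "eval_tm B e t \<in> univ B" if "t \<in> set ts" for t
      using Fn.prems that \<open>asg B e\<close> by (auto intro!: eval_tm_in_univ[OF B])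
    then have "set (map g (map (eval_tm B e) ts)) \<subseteq> D" using gB by auto
    then have "g (eval_tm B e (Fn f ts)) = func A f (map g (map (eval_tm B e) ts))"
      using func[of f "map g (map (eval_tm B e) ts)"] Fn.prems gh by (simp add: B_def comp_def)
    also have "map g (map (eval_tm B e) ts) = map (eval_tm A (g \<circ> e)) ts"
      using Fn by (simp add: comp_def)
    finally show ?case by (simp only: eval_tm.simps)
  qed simp
  have inj: "inj_on g (univ B)" using gh by (auto simp: inj_on_def B_def)
  have sat: "sat B e \<phi> \<longleftrightarrow> sat A (g \<circ> e) \<phi>" if "asg B e" "wf_fm L \<phi>" for e \<phi>
    using that
  proof (induction \<phi> arbitrary: e)
    case (Eql s t)
    have "eval_tm B e s \<in> univ B" "eval_tm B e t \<in> univ B"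
      using Eql.prems by (auto intro!: eval_tm_in_univ[OF B])
    from inj_on_eq_iff[OF inj this] show ?case
      using Eql.prems eval[OF Eql.prems(1)] by (simp add: comp_def)
  next
    case (Rl p ts)
    have "map g (map (eval_tm B e) ts) = map (eval_tm A (g \<circ> e)) ts"
      using Rl.prems eval[OF Rl.prems(1)] by simp
    then have "pred A p (map g (map (eval_tm B e) ts)) = pred A p (map (eval_tm A (g \<circ> e)) ts)"
      by (rule arg_cong)
    moreover have "pred B p = (\<lambda>xs. pred A p (map g xs))" by (simp add: B_def)
    ultimately show ?case by (simp only: sat.simps)
  next
    case (Ex i \<phi>)
    have upd: "g \<circ> e(i := b) = (g \<circ> e)(i := g b)" for b by auto
    have IH: "sat B (e(i := b)) \<phi> \<longleftrightarrow> sat A ((g \<circ> e)(i := g b)) \<phi>" if "b \<in> univ B" for b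
    proof -
      have "asg B (e(i := b))" using Ex.prems(1) that by auto
      from Ex.IH[OF this] Ex.prems(2) show ?thesis unfolding upd wf_fm.simps by blast
    qed
    show ?case
    proof
      assume "sat B e (Ex i \<phi>)"
      then obtain b where "b \<in> univ B" "sat A ((g \<circ> e)(i := g b)) \<phi>" using IH by auto
      then show "sat A (g \<circ> e) (Ex i \<phi>)" using gB DA by auto
    next
      assume a: "sat A (g \<circ> e) (Ex i \<phi>)"
      obtain K where K: "fv \<phi> \<subseteq> {..<K}" by (rule fv_bounded[of 0 \<phi>])
      have "\<exists>b\<in>D. \<forall>\<psi>\<in>{\<phi>}. sat A ((g \<circ> e)(i := b)) \<psi>"
      proof (rule realize)
        show "ren (swap i) ` {\<phi>} \<in> \<C>" using \<C> by simp
        show "range (g \<circ> e) \<subseteq> D" using gB Ex.prems(1) by auto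
        show "fv \<psi> \<subseteq> {0..K}" if "\<psi> \<in> {\<phi>}" for \<psi> using that K by fastforce
      qed (use a in simp)
      then obtain b where "b \<in> D" "sat A ((g \<circ> e)(i := b)) \<phi>" by blast
      then have "h b \<in> univ B" "sat B (e(i := h b)) \<phi>"
        using IH[of "h b"] gh by (simp_all add: B_def)
      then show "sat B e (Ex i \<phi>)" by auto
    qed
  qed simp_all
  show thesis
  proof (rule that[OF B _ inj])
    show "elementary_embedding L B A g"
      unfolding elementary_embedding_def using gB DA sat by blast
    show "X \<subseteq> g ` univ B"
    proof
      fix a assume "a \<in> X"
      then have "a \<in> D" using C0 by (auto simp: D_def)
      then show "a \<in> g ` univ B" using gh by (force simp: B_def)
    qed
    fix \<Phi> e k assume \<Phi>: "\<Phi> \<in> \<C>" and e: "asg B e"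
      and wf: "\<And>\<phi>. \<phi> \<in> \<Phi> \<Longrightarrow> wf_fm L \<phi> \<and> fv \<phi> \<subseteq> {0..k}"
      and ex: "\<exists>a\<in>univ A. \<forall>\<phi>\<in>\<Phi>. sat A ((g \<circ> e)(0 := a)) \<phi>"
    have "swap 0 = id" by (auto simp: swap_def fun_eq_iff)
    have "ren_tm id t = t" for t :: "'f tm"
      by (induction t) (simp_all add: map_idI)
    then have "ren id \<phi> = \<phi>" for \<phi> :: "('f, 'r) fm"
      by (induction \<phi>) (simp_all add: map_idI)
    then have "ren (swap 0) ` \<Phi> \<in> \<C>" using \<Phi> \<open>swap 0 = id\<close> by simp
    then obtain b where b: "b \<in> D" "\<forall>\<phi>\<in>\<Phi>. sat A ((g \<circ> e)(0 := b)) \<phi>"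
      using realize[of 0 \<Phi> "g \<circ> e" k] wf ex gB e by (auto simp: image_subset_iff)
    have "(g \<circ> e)(0 := b) = g \<circ> e(0 := h b)" using gh[OF b(1)] by auto
    moreover have hb: "h b \<in> univ B" using b(1) by (simp add: B_def)
    moreover have "asg B (e(0 := h b))" using e hb by auto
    note sat[OF this]
    ultimately show "\<exists>b\<in>univ B. \<forall>\<phi>\<in>\<Phi>. sat B (e(0 := b)) \<phi>"
      using wf b(2) by (intro bexI[of _ "h b"] ballI) simp_all
  qed
qed

lemma infinite_UNIV_fm: "infinite (UNIV :: ('f, 'r) fm set)"
proof
  assume "finite (UNIV :: ('f, 'r) fm set)"
  then have "finite (range (\<lambda>n. Eql (Var n) (Var n) :: ('f, 'r) fm))" by (rule finite_subset[rotated]) simp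
  moreover have "inj (\<lambda>n. Eql (Var n) (Var n) :: ('f, 'r) fm)" by (simp add: inj_def)
  ultimately show False using finite_imageD infinite_UNIV_nat by blast
qed

lemma small_elem_equiv:
  fixes M :: "('f, 'r, 'x) fostruct"
  assumes "is_fostruct L M"
  obtains B :: "('f, 'r, ('f, 'r) fm) fostruct" where "is_fostruct L B" "elem_equiv L B M"
proof (rule downward_loewenheim_skolem[where A = M and X = "{}" and \<C> = "range (\<lambda>\<phi>. {\<phi>})" and 't = "('f, 'r) fm"])
  show "is_fostruct L M" by (rule assms)
  show "|range (\<lambda>\<phi> :: ('f, 'r) fm. {\<phi>})| \<le>o |UNIV :: ('f, 'r) fm set|" by (rule card_of_image)
  show "|{} :: 'x set| \<le>o |UNIV :: ('f, 'r) fm set|" by (rule card_of_empty)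
  fix B :: "('f, 'r, ('f, 'r) fm) fostruct" and g
  assume "is_fostruct L B" "elementary_embedding L B M g"
  then show thesis using that elementary_embedding_elem_equiv by blast
qed (simp_all add: infinite_UNIV_fm)

text \<open>A type finitely satisfiable in the hull is so in the ultrapower, is realised there, and
  then has a witness in the hull. The number of sets of formulas, not of formulas, governs the size
  of the hull; hence the type of sets.\<close>

lemma saturated_extension:
  fixes M :: "('f, 'r, 'x) fostruct"
  assumes M: "is_fostruct L M"
  obtains M' :: "('f, 'r, ('x + ('f, 'r) fm) set) fostruct" and h
  where "is_fostruct L M'" "elementary_embedding L M M' h" "aleph0_saturated L M'"
proof -
  obtain U :: "('f, 'r) fm set set set" and d :: "('f, 'r) fm set \<Rightarrow> ('f, 'r) fm set"
    where "ultrafilter U" and d: "\<And>j. finite (d j)" "\<And>x. {j. x \<in> d j} \<in> U"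
    using regular_ultrafilter[where 'x = "('f, 'r) fm"] by blast
  then interpret ultrafilter U by simp
  let ?A = "upow M" and ?h = "\<lambda>a. rep (univ M) (\<lambda>_. a)"
  let ?X = "?h ` univ M"
  note A = is_fostruct_upow[OF M] and emb = upow_embedding[OF M] and satu = upow_saturated[OF M d]
  show thesis
  proof (rule downward_loewenheim_skolem[OF A, where X = ?X and \<C> = UNIV and 't = "('x + ('f, 'r) fm) set"])
    show "?X \<subseteq> univ ?A" using emb by (simp add: elementary_embedding_def)
    have i: "inj (\<lambda>a :: 'x. {Inl a :: 'x + ('f, 'r) fm})" by (simp add: inj_def)
    have j: "inj (\<lambda>\<Phi> :: ('f, 'r) fm set. Inr ` \<Phi> :: ('x + ('f, 'r) fm) set)"
      by (rule injI) (simp add: inj_image_eq_iff)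
    have "|?X| \<le>o |univ M|" by (rule card_of_image)
    also have "|univ M| \<le>o |UNIV :: ('x + ('f, 'r) fm) set set|"
      using inj_on_subset[OF i, of "univ M"] by (intro card_of_ordLeq[THEN iffD1]) auto
    finally show "|?X| \<le>o |UNIV :: ('x + ('f, 'r) fm) set set|" .
    show "|UNIV :: ('f, 'r) fm set set| \<le>o |UNIV :: ('x + ('f, 'r) fm) set set|"
      using j by (intro card_of_ordLeq[THEN iffD1]) auto
    show "infinite (UNIV :: ('x + ('f, 'r) fm) set set)"
      using infinite_UNIV_fm[where 'f = 'f and 'r = 'r] by (simp add: Finite_Set.finite_set)
    fix B :: "('f, 'r, ('x + ('f, 'r) fm) set) fostruct" and g
    assume B: "is_fostruct L B" "elementary_embedding L B ?A g" "inj_on g (univ B)" "?X \<subseteq> g ` univ B"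
      and real: "\<And>\<Phi> e k. \<Phi> \<in> UNIV \<Longrightarrow> asg B e \<Longrightarrow> (\<And>\<phi>. \<phi> \<in> \<Phi> \<Longrightarrow> wf_fm L \<phi> \<and> fv \<phi> \<subseteq> {0..k}) \<Longrightarrow>
      \<exists>a\<in>univ ?A. \<forall>\<phi>\<in>\<Phi>. sat ?A ((g \<circ> e)(0 := a)) \<phi> \<Longrightarrow>
      \<exists>b\<in>univ B. \<forall>\<phi>\<in>\<Phi>. sat B (e(0 := b)) \<phi>"
    define k where "k = inv_into (univ B) g \<circ> ?h"
    have k: "k a \<in> univ B" "g (k a) = ?h a" if "a \<in> univ M" for a
      using B(4) that by (auto simp: k_def image_subset_iff intro: inv_into_into f_inv_into_f)
    have "elementary_embedding L M B k"
      unfolding elementary_embedding_def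
    proof (intro conjI allI impI)
      show "k ` univ M \<subseteq> univ B" using k by auto
      fix \<phi> and e :: "nat \<Rightarrow> 'x" assume \<phi>: "wf_fm L \<phi> \<and> asg M e"
      have "asg B (k \<circ> e)" using k(1) \<phi> by auto
      then have "sat B (k \<circ> e) \<phi> \<longleftrightarrow> sat ?A (g \<circ> (k \<circ> e)) \<phi>"
        using B(2) \<phi> by (simp add: elementary_embedding_def)
      also have "g \<circ> (k \<circ> e) = ?h \<circ> e" using k(2) \<phi> by (auto simp: fun_eq_iff)
      finally show "sat M e \<phi> \<longleftrightarrow> sat B (k \<circ> e) \<phi>"
        using emb \<phi> by (simp add: elementary_embedding_def comp_def)
    qed
    moreover have "aleph0_saturated L B"
      unfolding aleph0_saturated_def
    proof (intro allI impI, elim conjE)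
      fix e k \<Phi> assume e: "asg B e" and \<Phi>: "\<forall>\<phi>\<in>\<Phi>. wf_fm L \<phi> \<and> fv \<phi> \<subseteq> {0..k}"
        and fs: "\<forall>\<Psi>\<subseteq>\<Phi>. finite \<Psi> \<longrightarrow> (\<exists>b\<in>univ B. \<forall>\<phi>\<in>\<Psi>. sat B (e(0 := b)) \<phi>)"
      have gA: "g b \<in> univ ?A" if "b \<in> univ B" for b
        using B(2) that by (auto simp: elementary_embedding_def)
      have "\<exists>a\<in>univ ?A. \<forall>\<phi>\<in>\<Psi>. sat ?A ((g \<circ> e)(0 := a)) \<phi>" if \<Psi>: "\<Psi> \<subseteq> \<Phi>" "finite \<Psi>" for \<Psi>
      proof -
        obtain b where b: "b \<in> univ B" "\<forall>\<phi>\<in>\<Psi>. sat B (e(0 := b)) \<phi>" using fs \<Psi> by blast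
        have "asg B (e(0 := b))" using e b(1) by auto
        then have "sat B (e(0 := b)) \<phi> \<longleftrightarrow> sat ?A (g \<circ> e(0 := b)) \<phi>" if "\<phi> \<in> \<Psi>" for \<phi>
          using B(2) \<Phi> \<Psi>(1) that by (auto simp: elementary_embedding_def)
        moreover have "g \<circ> e(0 := b) = (g \<circ> e)(0 := g b)" by auto
        ultimately show ?thesis using b gA by (intro bexI[of _ "g b"]) auto
      qed
      moreover have "asg ?A (g \<circ> e)" using gA e by auto
      ultimately have "\<exists>a\<in>univ ?A. \<forall>\<phi>\<in>\<Phi>. sat ?A ((g \<circ> e)(0 := a)) \<phi>"
        using satu \<Phi> unfolding aleph0_saturated_def by blast
      then show "\<exists>b\<in>univ B. \<forall>\<phi>\<in>\<Phi>. sat B (e(0 := b)) \<phi>"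
        using real[of \<Phi> e k] e \<Phi> by blast
    qed
    ultimately show thesis using that B(1) by blast
  qed simp
qed

section \<open>Morley rank\<close>

lemma wf_option_extend:
  fixes S :: "'w rel"
  assumes "wf S" "T \<subseteq> {(Some a, Some b) | a b. (a, b) \<in> S} \<union> {(Some a, None) | a. True}"
  shows "wf T"
proof (rule wfI_min)
  fix x :: "'w option" and Q assume x: "x \<in> Q"
  show "\<exists>z\<in>Q. \<forall>y. (y, z) \<in> T \<longrightarrow> y \<notin> Q"
  proof (cases "\<exists>a. Some a \<in> Q")
    case True
    then obtain a where "a \<in> {a. Some a \<in> Q}" by blast
    then obtain b where "b \<in> {a. Some a \<in> Q}" "\<And>y. (y, b) \<in> S \<Longrightarrow> y \<notin> {a. Some a \<in> Q}"
      using wfE_min[OF assms(1)] by metis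
    then show ?thesis using assms(2) by (intro bexI[of _ "Some b"]) auto
  next
    case False
    then show ?thesis using x assms(2) by (intro bexI[of _ x]) auto
  qed
qed

text \<open>A split along \<open>v\<close> is the rank of a new point directly above \<open>v\<close>.\<close>

lemma split_elem_equiv:
  fixes S :: "'w rel"
  assumes S: "wf S" and B: "aleph0_saturated L B" "elem_equiv L A B" "is_fostruct L A" "is_fostruct L B"
    and sp: "dsplit L A m S v (cart A m)"
  shows "dsplit L B m S v (cart B m)"
proof -
  define T where "T = {(Some a, Some b) | a b. (a, b) \<in> S} \<union> {(Some v, None)}"
  have "wf T" by (rule wf_option_extend[OF S]) (auto simp: T_def)
  have "dmr L A m T None (cart A m)"
  proof -
    have "cart A m \<noteq> {}"
      using sp mr_nonempty[of "definable L A m" S v] unfolding split_def by fastforce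
    moreover have "dsplit L A m T (Some v) (cart A m)"
      by (rule split_transport_on[where P = "\<lambda>p. p \<noteq> None" and f = the and S = S])
         (use \<open>wf T\<close> sp in \<open>auto simp: T_def\<close>)
    ultimately show ?thesis
      using definable_tuples[OF B(3)] by (subst mr_iff) (auto simp: T_def)
  qed
  then have "dmr L B m T None (cart B m)" by (rule mr_elem_equiv[OF B])
  then have "dsplit L B m T (Some v) (cart B m)"
    by (rule mr_imp_splitD) (simp add: T_def)
  then show ?thesis
    by (rule split_transport[rotated 2]) (auto simp: T_def S)
qed

section \<open>The prescribed rank in terms of splitting\<close>

lemma Field_Restr_underS: "Well_order r \<Longrightarrow> Field (Restr r (underS r x)) = underS r x"
  by (simp add: Field_Restr_ofilter wo_rel.underS_ofilter wo_rel_def)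

text \<open>The successor clause gives splitting at the last element, and the smaller ones follow by
  \<open>split_downward\<close>. In the limit clause each \<open>v\<close> lies below some
  \<open>y\<close>, and the segment below \<open>y\<close> already gives splitting at
  \<open>v\<close>.\<close>

lemma rank_ge_imp_split:
  "rank_ge L M m r X \<Longrightarrow> definable L M m X \<and> X \<noteq> {} \<and> (\<forall>v\<in>Field r. dsplit L M m (r - Id) v X)"
proof (induction rule: rank_ge.induct)
  case (zero X)
  then show ?case by simp
next
  case (succ X r x F)
  have swo: "strict_wo (r - Id)" by (rule strict_wo_Well_order[OF succ.hyps(2)])
  have r: "trans r" "antisym r" using succ.hyps(2) by (auto simp: order_on_defs)
  have F: "dmr L M m (r - Id) x (F i)" for i
  proof (subst mr_iff, intro conjI allI impI)
    show "definable L M m (F i)" "F i \<noteq> {}" using succ.IH by simp_all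
    fix v assume v: "(v, x) \<in> r - Id"
    have sp: "dsplit L M m (Restr r (underS r x) - Id) v (F i)"
      using succ.IH v Field_Restr_underS[OF succ.hyps(2)] by (auto simp: underS_def)
    have vx: "v \<in> underS r x" using v by (auto simp: underS_def)
    show "dsplit L M m (r - Id) v (F i)"
      by (rule split_transport_on[where P = "\<lambda>u. u \<in> underS r x" and f = "\<lambda>u. u" and S = "Restr r (underS r x) - Id"])
         (use swo r sp vx in \<open>auto simp: underS_def strict_wo_def dest: transD antisymD\<close>)
  qed
  have "dsplit L M m (r - Id) x X"
    unfolding split_def using F succ.IH succ.hyps(5) by (intro exI[of _ F]) simp
  moreover have "v = x \<or> (v, x) \<in> r - Id" if "v \<in> Field r" for v using succ.hyps(4) that by auto
  ultimately have "dsplit L M m (r - Id) v X" if "v \<in> Field r" for v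
    using split_downward[of "r - Id"] swo that unfolding strict_wo_def by blast
  moreover have "X \<noteq> {}" using succ.IH by blast
  ultimately show ?case using succ.hyps(1) by blast
next
  case (lim X r)
  have swo: "strict_wo (r - Id)" by (rule strict_wo_Well_order[OF lim.hyps(2)])
  have r: "trans r" "antisym r" using lim.hyps(2) by (auto simp: order_on_defs)
  have "dsplit L M m (r - Id) v X" if v: "v \<in> Field r" for v
  proof -
    obtain y where y: "y \<in> Field r" "(v, y) \<in> r" "y \<noteq> v" using lim.hyps(4) v by blast
    then have vx: "v \<in> underS r y" by (auto simp: underS_def)
    then have sp: "dsplit L M m (Restr r (underS r y) - Id) v X"
      using lim.IH y(1) Field_Restr_underS[OF lim.hyps(2)] by blast
    show ?thesis
      by (rule split_transport_on[where P = "\<lambda>u. u \<in> underS r y" and f = "\<lambda>u. u" and S = "Restr r (underS r y) - Id"])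
         (use swo r sp vx in \<open>auto simp: underS_def strict_wo_def dest: transD antisymD\<close>)
  qed
  moreover have "X \<noteq> {}"
  proof -
    obtain x where "x \<in> Field r" using lim.hyps(3) by (auto simp: Field_def)
    then show ?thesis using lim.IH by blast
  qed
  ultimately show ?case using lim.hyps(1) by blast
qed

text \<open>Induction on the ordinal itself, along \<open><o\<close>, since the clauses of
  \<open>rank_ge\<close> refer to restrictions of \<open>r\<close> to proper initial
  segments.\<close>

lemma split_imp_rank_ge:
  fixes r :: "'o rel"
  shows "Well_order r \<Longrightarrow> definable L M m X \<Longrightarrow> X \<noteq> {} \<Longrightarrow>
    (\<And>v. v \<in> Field r \<Longrightarrow> dsplit L M m (r - Id) v X) \<Longrightarrow> rank_ge L M m r X"
  using wf_ordLess[where 'a = 'o]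
proof (induction r arbitrary: X rule: wf_induct_rule)
  case (less r)
  have below: "rank_ge L M m (Restr r (underS r x)) Y"
    if x: "x \<in> Field r" and Y: "dmr L M m (r - Id) x Y" for x Y
  proof (rule less.IH)
    show "Restr r (underS r x) <o r" using underS_Restr_ordLess[OF less.prems(1)] x by blast
    show wo: "Well_order (Restr r (underS r x))" by (rule Well_order_Restr[OF less.prems(1)])
    show "definable L M m Y" "Y \<noteq> {}" by (rule mr_imp_D[OF Y], rule mr_nonempty[OF Y])
    fix v assume "v \<in> Field (Restr r (underS r x))"
    then have "(v, x) \<in> r - Id"
      using Field_Restr_underS[OF less.prems(1)] by (auto simp: underS_def)
    then have "dsplit L M m (r - Id) v Y" by (rule mr_imp_splitD[OF Y])
    then show "dsplit L M m (Restr r (underS r x) - Id) v Y"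
      by (rule split_transport[rotated 2])
         (use strict_wo_Well_order[OF wo] in \<open>auto simp: strict_wo_def\<close>)
  qed
  consider "r = {}" | x where "x \<in> Field r" "\<forall>y\<in>Field r. (y, x) \<in> r"
    | "r \<noteq> {}" "\<forall>x\<in>Field r. \<exists>y\<in>Field r. (x, y) \<in> r \<and> y \<noteq> x"
  proof -
    have "total_on (Field r) r" "refl_on (Field r) r" using less.prems(1) by (auto simp: order_on_defs)
    then have "\<forall>x\<in>Field r. \<forall>y\<in>Field r. (y, x) \<notin> r \<longrightarrow> (x, y) \<in> r \<and> y \<noteq> x"
      unfolding total_on_def refl_on_def by metis
    then show thesis using that by blast
  qed
  then show ?case
  proof cases
    case 1
    then show ?thesis using less.prems by (simp add: rank_ge.zero)
  next
    case (2 x)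
    obtain F :: "nat \<Rightarrow> _" where F: "\<forall>i. F i \<subseteq> X \<and> dmr L M m (r - Id) x (F i)"
      "\<forall>i j. i \<noteq> j \<longrightarrow> F i \<inter> F j = {}"
      using less.prems(4)[OF 2(1)] unfolding split_def by blast
    show ?thesis
      by (rule rank_ge.succ[OF less.prems(2,1) 2 _ F(2)]) (use F(1) below[OF 2(1)] in blast)
  next
    case 3
    show ?thesis
    proof (rule rank_ge.lim[OF less.prems(2,1) 3], intro ballI)
      fix x assume x: "x \<in> Field r"
      have "dmr L M m (r - Id) x X"
      proof (subst mr_iff, intro conjI allI impI less.prems)
        fix v assume "(v, x) \<in> r - Id"
        then show "v \<in> Field r" by (auto simp: Field_def)
      qed
      then show "rank_ge L M m (Restr r (underS r x)) X" by (rule below[OF x])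
    qed
  qed
qed

lemma rank_ge_iff:
  assumes "Well_order r"
  shows "rank_ge L M m r X \<longleftrightarrow>
    definable L M m X \<and> X \<noteq> {} \<and> (\<forall>v\<in>Field r. dsplit L M m (r - Id) v X)"
  using rank_ge_imp_split[of L M m r X] split_imp_rank_ge[OF assms, of L M m X] by blast

text \<open>The rank is the least \<open>u\<close> at which \<open>X\<close> does not split; the
  failure at \<open>z\<close> guarantees one below \<open>z\<close>.\<close>

lemma rank_exists:
  assumes "strict_wo S" "\<not> mr D S z X" "D X" "X \<noteq> {}"
  obtains u where "(u, z) \<in> S" "mr D S u X" "\<not> split D S u X"
proof -
  obtain u0 where "u0 \<in> {u. (u, z) \<in> S \<and> \<not> split D S u X}"
    using assms(2-4) mr_iff[of D S z X] by auto
  then obtain u where u: "(u, z) \<in> S" "\<not> split D S u X"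
    and min: "\<And>v. (v, u) \<in> S \<Longrightarrow> v \<notin> {u. (u, z) \<in> S \<and> \<not> split D S u X}"
    using wfE_min[of S u0 "{u. (u, z) \<in> S \<and> \<not> split D S u X}"] assms(1)
    unfolding strict_wo_def by blast
  have "mr D S u X"
  proof (subst mr_iff, intro conjI allI impI assms(3,4))
    fix v assume v: "(v, u) \<in> S"
    then have "(v, z) \<in> S" using assms(1) u(1) unfolding strict_wo_def by (meson transD)
    then show "split D S v X" using min[OF v] by blast
  qed
  then show thesis using that u by blast
qed

text \<open>The two conditions on \<open>u\<close> say that the rank computed in \<open>A\<close> is
  exactly the order type below \<open>u\<close>. Both carry over to the saturated extension in the
  prescribed type, because ranks in elementarily equivalent saturated structures agree.\<close>

lemma has_morley_rankI:
  fixes M :: "('f, 'r, 'x) fostruct" and A :: "('f, 'r, 'y) fostruct" and t :: "'w rel"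
  assumes M: "is_fostruct L M" and A: "is_fostruct L A" "aleph0_saturated L A" "elem_equiv L M A"
    and t: "Well_order t" "u \<in> Field t"
    and u: "dmr L A 1 (t - Id) u (cart A 1)"
      "\<not> dsplit L A 1 (t - Id) u (cart A 1)"
  shows "has_morley_rank L M (Restr t (underS t u))"
  unfolding has_morley_rank_def
proof (intro conjI allI impI)
  let ?\<beta> = "Restr t (underS t u)"
  show wo: "Well_order ?\<beta>" by (rule Well_order_Restr[OF t(1)])
  show "morley_rank_ge L M ?\<beta>"
  proof (rule saturated_extension[OF M])
    fix M' :: "('f, 'r, ('x + ('f, 'r) fm) set) fostruct" and h
    assume M': "is_fostruct L M'" "elementary_embedding L M M' h" "aleph0_saturated L M'"
    have "elem_equiv L A M'"
      using elem_equiv_trans[OF elem_equiv_sym[OF A(3)] elementary_embedding_elem_equiv[OF M'(2)] M] .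
    from mr_elem_equiv[OF M'(3) this A(1) M'(1) u(1)]
    have mr: "dmr L M' 1 (t - Id) u (cart M' 1)" .
    have "rank_ge L M' 1 ?\<beta> (cart M' 1)"
      unfolding rank_ge_iff[OF wo]
    proof (intro conjI ballI)
      show "definable L M' 1 (cart M' 1)" "cart M' 1 \<noteq> {}"
        by (rule mr_imp_D[OF mr], rule mr_nonempty[OF mr])
      fix v assume "v \<in> Field ?\<beta>"
      then have "(v, u) \<in> t - Id" using Field_Restr_underS[OF t(1)] by (auto simp: underS_def)
      from mr_imp_splitD[OF mr this] show "dsplit L M' 1 (?\<beta> - Id) v (cart M' 1)"
        by (rule split_transport[rotated 2])
           (use strict_wo_Well_order[OF wo] in \<open>auto simp: strict_wo_def\<close>)
    qed
    then show ?thesis unfolding morley_rank_ge_def using M' by blast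
  qed
  fix s :: "'w option rel" assume s: "?\<beta> <o s"
  show "\<not> morley_rank_ge L M s"
  proof
    assume "morley_rank_ge L M s"
    then obtain M' :: "('f, 'r, ('x + ('f, 'r) fm) set) fostruct" and h
      where M': "is_fostruct L M'" "elementary_embedding L M M' h" "aleph0_saturated L M'"
        and rk: "rank_ge L M' 1 s (cart M' 1)"
      unfolding morley_rank_ge_def by blast
    have ws: "Well_order s" using s by (simp add: ordLess_def)
    then have ss: "strict_wo (s - Id)" by (rule strict_wo_Well_order)
    \<comment> \<open>A longer \<open>s\<close> continues a copy of \<open>?\<beta>\<close> by a
      point \<open>c\<close>; rank at least \<open>s\<close> forces splitting at
      \<open>c\<close>.\<close>
    obtain c where c: "c \<in> Field s" "?\<beta> =o Restr s (underS s c)"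
      using s ordLess_iff_ordIso_Restr[OF ws wo] by blast
    then obtain f where f: "iso ?\<beta> (Restr s (underS s c)) f" by (auto simp: ordIso_def)
    have "elem_equiv L M' A"
      using elem_equiv_trans[OF elem_equiv_sym[OF elementary_embedding_elem_equiv[OF M'(2)]] A(3) M] .
    moreover have "dsplit L M' 1 (s - Id) c (cart M' 1)"
      using rk c(1) unfolding rank_ge_iff[OF ws] by blast
    ultimately have sp: "dsplit L A 1 (s - Id) c (cart A 1)"
      using split_elem_equiv[OF _ A(2) _ M'(1) A(1), of "s - Id" 1 c] ss by (simp add: strict_wo_def)
    \<comment> \<open>Sending \<open>u\<close> to \<open>c\<close> extends the isomorphism of the
      segments, and splitting at \<open>c\<close> is pulled back to splitting at
      \<open>u\<close>.\<close>
    define f' where "f' v = (if v = u then c else f v)" for v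
    have fin: "f v \<in> underS s c" if "v \<in> underS t u" for v
      using f that Field_Restr_underS[OF t(1)] Field_Restr_underS[OF ws]
      by (auto simp: iso_def bij_betw_def)
    have fmono: "(f a, f b) \<in> s - Id" if "(a, b) \<in> t - Id" "a \<in> underS t u" "b \<in> underS t u" for a b
    proof -
      have "(a, b) \<in> ?\<beta>" using that by blast
      from iso_forward[OF this f] have "(f a, f b) \<in> s" by blast
      moreover have "f a \<noteq> f b"
        using f that Field_Restr_underS[OF t(1), of u] unfolding iso_def bij_betw_def inj_on_def by blast
      ultimately show ?thesis by simp
    qed
    have tr: "trans t" "antisym t" using t(1) by (auto simp: order_on_defs)
    have "dsplit L A 1 (t - Id) u (cart A 1)"
    proof (rule split_transport_on[where P = "\<lambda>v. v = u \<or> v \<in> underS t u" and f = f' and S = "s - Id"])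
      fix a b assume ab: "(a, b) \<in> t - Id" "b = u \<or> b \<in> underS t u"
      then have a: "a \<in> underS t u" using tr unfolding underS_def trans_def antisym_def by blast
      then have "a \<noteq> u" by (auto simp: underS_def)
      then have "(f' a, f' b) \<in> s - Id"
        using ab a fin[OF a] fmono[OF ab(1) a] by (auto simp: f'_def underS_def)
      then show "(a = u \<or> a \<in> underS t u) \<and> (f' a, f' b) \<in> s - Id" using a by blast
    qed (use sp strict_wo_Well_order[OF t(1)] in \<open>auto simp: f'_def strict_wo_def\<close>)
    then show False using u(2) by contradiction
  qed
qed

section \<open>Ordinals\<close>

text \<open>This successor lives in the very type in which \<open>has_morley_rank\<close> tests
  maximality, so it is the order to refute.\<close>

definition osucc :: "'o rel \<Rightarrow> 'o option rel" where
  "osucc r = {(Some a, Some b) | a b. (a, b) \<in> r} \<union> {(Some a, None) | a. a \<in> Field r} \<union> {(None, None)}"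

lemma Field_osucc: "Field (osucc r) = insert None (Some ` Field r)"
  by (auto simp: osucc_def Field_def)

lemma Well_order_osucc:
  assumes "Well_order r"
  shows "Well_order (osucc r)"
proof -
  have r: "refl_on (Field r) r" "trans r" "antisym r" "total_on (Field r) r" "wf (r - Id)"
    using assms by (auto simp: order_on_defs well_order_on_def)
  have "refl_on (Field (osucc r)) (osucc r)"
    using r(1) unfolding refl_on_def Field_osucc by (auto simp: osucc_def)
  moreover have "trans (osucc r)"
    using r(2) unfolding trans_def by (auto simp: osucc_def Field_def)
  moreover have "antisym (osucc r)"
    using r(3) unfolding antisym_def by (auto simp: osucc_def)
  moreover have "total_on (Field (osucc r)) (osucc r)"
    using r(4) unfolding total_on_def Field_osucc by (auto simp: osucc_def)
  moreover have "wf (osucc r - Id)"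
    by (rule wf_option_extend[OF r(5)]) (auto simp: osucc_def)
  moreover have "osucc r \<subseteq> Field (osucc r) \<times> Field (osucc r)" by (auto simp: Field_def)
  ultimately show ?thesis by (simp add: order_on_defs well_order_on_def)
qed

lemma ordLess_osucc:
  assumes "Well_order r"
  shows "r <o osucc r"
proof -
  note ws = Well_order_osucc[OF assms]
  have us: "underS (osucc r) None = Some ` Field r" by (auto simp: underS_def osucc_def)
  have "iso r (Restr (osucc r) (underS (osucc r) None)) Some"
    unfolding iso_iff2 Field_Restr_underS[OF ws]
    by (auto simp: us bij_betw_def) (auto simp: osucc_def)
  then have "r =o Restr (osucc r) (underS (osucc r) None)"
    using assms Well_order_Restr[OF ws] by (auto simp: ordIso_def)
  then show ?thesis
    using ordLess_iff_ordIso_Restr[OF ws assms] by (auto simp: Field_osucc)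
qed

text \<open>\<open>z\<close> is the ordinal 0, and \<open>o1\<close> is an arbitrary nonzero digit.
  That it exists is the condition that the base be at least 2.\<close>

locale opow_natLeq =
  fixes r :: "'o rel" and z o1 :: 'o
  assumes r: "Well_order r" and least: "\<And>x. x \<in> Field r \<Longrightarrow> (z, x) \<in> r"
    and o1: "o1 \<in> Field r" "o1 \<noteq> z"
begin

lemma r_props: "trans r" "antisym r" "total_on (Field r) r" "wf (r - Id)" "refl_on (Field r) r"
  using r by (auto simp: order_on_defs well_order_on_def)

lemma z: "z \<in> Field r"
  using least[OF o1(1)] by (auto simp: Field_def)

lemma z_least: "(x, z) \<notin> r - Id"
  using least[of x] r_props(2) by (auto simp: antisym_def Field_def)

definition F :: "(nat \<Rightarrow> 'o) set" where
  "F = {f. range f \<subseteq> Field r \<and> finite {n. f n \<noteq> z}}"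

definition lt :: "(nat \<Rightarrow> 'o) rel" where
  "lt = {(f, g). f \<in> F \<and> g \<in> F \<and> (\<exists>n. (f n, g n) \<in> r - Id \<and> (\<forall>m>n. f m = g m))}"

lemma underS_nonempty: "x \<in> Field r \<Longrightarrow> underS r x \<noteq> {} \<longleftrightarrow> x \<noteq> z"
  using least[of x] z_least unfolding underS_def by (metis (mono_tags, lifting) DiffI IdE empty_iff equals0I mem_Collect_eq pair_in_Id_conv)

lemma opow_eq: "opow r natLeq = lt \<union> {(f, f) | f. f \<in> F}"
proof -
  have eqF: "{f \<in> Func (Field natLeq) (Field r). finite {x \<in> Field natLeq. underS r (f x) \<noteq> {}}} = F"
  proof -
    have "{x \<in> Field natLeq. underS r (f x) \<noteq> {}} = {n. f n \<noteq> z}" if "range f \<subseteq> Field r" for f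
      using underS_nonempty that by (auto simp: Field_natLeq)
    then have "finite {x \<in> Field natLeq. underS r (f x) \<noteq> {}} \<longleftrightarrow> finite {n. f n \<noteq> z}"
      if "range f \<subseteq> Field r" for f using that by simp
    moreover have "f \<in> Func (Field natLeq) (Field r) \<longleftrightarrow> range f \<subseteq> Field r" for f
      by (auto simp: Func_def Field_natLeq)
    ultimately show ?thesis unfolding F_def by blast
  qed
  have q: "(\<forall>y. (n, y) \<in> natLeq \<and> y \<noteq> n \<longrightarrow> f y = g y) \<longleftrightarrow> (\<forall>m>n. f m = g m)" for n f g
    by (auto simp: natLeq_def)
  show ?thesis
    unfolding opow_def Let_def lt_def eqF q unfolding Field_natLeq by auto
qed

lemma Field_opow: "Field (opow r natLeq) = F"
  unfolding opow_eq by (auto simp: Field_def lt_def)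

lemma lt_irrefl: "(f, f) \<notin> lt"
  by (auto simp: lt_def)

lemma opow_diff: "opow r natLeq - Id = lt"
  unfolding opow_eq using lt_irrefl by auto

lemma trans_lt: "trans lt"
proof (rule transI)
  fix f g h assume "(f, g) \<in> lt" "(g, h) \<in> lt"
  then obtain n n' where *: "f \<in> F" "h \<in> F" "(f n, g n) \<in> r - Id" "\<forall>m>n. f m = g m"
    "(g n', h n') \<in> r - Id" "\<forall>m>n'. g m = h m" by (auto simp: lt_def)
  have tr: "trans (r - Id)" using r_props by (simp add: trans_diff_Id)
  have "(f (max n n'), h (max n n')) \<in> r - Id"
  proof (rule linorder_cases[of n n'])
    assume "n = n'"
    then show ?thesis using transD[OF tr *(3), of "h n"] *(5) by simp
  next
    assume "n < n'"
    then show ?thesis using *(4,5) by simp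
  next
    assume "n' < n"
    then show ?thesis using *(3,6) by simp
  qed
  moreover have "\<forall>m>max n n'. f m = h m" using *(4,6) by simp
  ultimately show "(f, h) \<in> lt" using *(1,2) unfolding lt_def by blast
qed

lemma total_lt: "total_on F lt"
  unfolding total_on_def
proof (intro ballI impI)
  fix f g assume fg: "f \<in> F" "g \<in> F" "f \<noteq> g"
  let ?D = "{n. f n \<noteq> g n}"
  have "finite ({n. f n \<noteq> z} \<union> {n. g n \<noteq> z})" using fg by (auto simp: F_def)
  then have fin: "finite ?D" by (rule finite_subset[rotated]) auto
  moreover have "?D \<noteq> {}" using fg(3) by auto
  ultimately have "Max ?D \<in> ?D" by (rule Max_in)
  moreover have "m \<notin> ?D" if "m > Max ?D" for m using Max_ge[OF fin, of m] that leD by blast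
  ultimately obtain d where M: "f d \<noteq> g d" and top: "\<forall>m>d. f m = g m" by blast
  have "f d \<in> Field r" "g d \<in> Field r" using fg by (auto simp: F_def)
  then have "(f d, g d) \<in> r \<or> (g d, f d) \<in> r"
    using r_props(3) M by (simp add: total_on_def)
  then show "(f, g) \<in> lt \<or> (g, f) \<in> lt"
  proof
    assume "(f d, g d) \<in> r"
    then have "(f d, g d) \<in> r - Id \<and> (\<forall>m>d. f m = g m)" using M top by simp
    then show ?thesis using fg(1,2) unfolding lt_def by blast
  next
    assume "(g d, f d) \<in> r"
    then have "(g d, f d) \<in> r - Id \<and> (\<forall>m>d. g m = f m)" using M top by simp
    then show ?thesis using fg(1,2) unfolding lt_def by blast
  qed
qed

text \<open>Among functions that agree from \<open>N\<close> on, the highest coordinate decides: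
  minimise coordinate \<open>N - 1\<close> first, then recurse on the functions attaining that
  value.\<close>

lemma min_exists:
  "Q \<noteq> {} \<Longrightarrow> Q \<subseteq> F \<Longrightarrow> (\<And>f g n. f \<in> Q \<Longrightarrow> g \<in> Q \<Longrightarrow> N \<le> n \<Longrightarrow> f n = g n) \<Longrightarrow>
    \<exists>g\<in>Q. \<forall>f\<in>Q. (f, g) \<notin> lt"
proof (induction N arbitrary: Q)
  case 0
  then obtain g where g: "g \<in> Q" by blast
  have "f = g" if "f \<in> Q" for f using 0(3)[OF that g] by auto
  then show ?case using g lt_irrefl by blast
next
  case (Suc N)
  obtain f0 where "f0 N \<in> (\<lambda>f. f N) ` Q" using Suc.prems(1) by blast
  then obtain v where v: "v \<in> (\<lambda>f. f N) ` Q" "\<And>y. (y, v) \<in> r - Id \<Longrightarrow> y \<notin> (\<lambda>f. f N) ` Q"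
    using wfE_min[OF r_props(4)] by metis
  let ?Q = "{f \<in> Q. f N = v}"
  have "\<exists>g\<in>?Q. \<forall>f\<in>?Q. (f, g) \<notin> lt"
  proof (rule Suc.IH)
    show "f n = g n" if "f \<in> ?Q" "g \<in> ?Q" "N \<le> n" for f g n
      using Suc.prems(3)[of f g n] that by (cases "n = N") auto
  qed (use v(1) Suc.prems in auto)
  then obtain g where g: "g \<in> Q" "g N = v" "\<And>f. f \<in> Q \<Longrightarrow> f N = v \<Longrightarrow> (f, g) \<notin> lt" by blast
  have "(f, g) \<notin> lt" if f: "f \<in> Q" for f
  proof
    assume fg: "(f, g) \<in> lt"
    then obtain n where n: "(f n, g n) \<in> r - Id" "\<forall>m>n. f m = g m" by (auto simp: lt_def)
    have "n < Suc N" using n(1) Suc.prems(3)[OF f g(1), of n] by (cases "n < Suc N") auto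
    moreover have "n \<noteq> N" using n(1) v(2)[of "f N"] f g(2) by auto
    ultimately have "f N = v" using n(2) g(2) by auto
    then show False using g(3)[OF f] fg by blast
  qed
  then show ?case using g(1) by blast
qed

lemma wf_lt: "wf lt"
proof (rule wfI_min)
  fix g0 :: "nat \<Rightarrow> 'o" and Q assume g0: "g0 \<in> Q"
  show "\<exists>g\<in>Q. \<forall>f. (f, g) \<in> lt \<longrightarrow> f \<notin> Q"
  proof (cases "g0 \<in> F")
    case False
    then show ?thesis using g0 by (intro bexI[of _ g0]) (auto simp: lt_def)
  next
    case True
    then obtain N where N: "\<forall>n\<in>{n. g0 n \<noteq> z}. n < N"
      using finite_nat_set_iff_bounded by (auto simp: F_def)
    \<comment> \<open>A function below one that vanishes from \<open>N\<close> on vanishes there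
      too, since no digit is below \<open>z\<close>. So no smaller element of \<open>Q\<close> is
      lost.\<close>
    let ?Q = "{g \<in> Q \<inter> F. \<forall>n\<ge>N. g n = z}"
    have "\<exists>g\<in>?Q. \<forall>f\<in>?Q. (f, g) \<notin> lt"
      by (rule min_exists[where N = N]) (use g0 True N in force)+
    then obtain g where g: "g \<in> ?Q" "\<And>f. f \<in> ?Q \<Longrightarrow> (f, g) \<notin> lt" by blast
    have "f \<notin> Q" if fg: "(f, g) \<in> lt" for f
    proof
      assume f: "f \<in> Q"
      obtain n where n: "(f n, g n) \<in> r - Id" "\<forall>m>n. f m = g m" using fg by (auto simp: lt_def)
      have "n < N" using n(1) g(1) z_least[of "f n"] by (cases "n < N") auto
      then have "\<forall>n\<ge>N. f n = z" using n(2) g(1) by auto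
      moreover have "f \<in> F" using fg by (simp add: lt_def)
      ultimately show False using g(2)[of f] f fg by blast
    qed
    then show ?thesis using g(1) by blast
  qed
qed

lemma Well_order_opow: "Well_order (opow r natLeq)"
proof -
  have "refl_on F (opow r natLeq)" by (auto simp: refl_on_def opow_eq)
  moreover have "trans (opow r natLeq)"
    unfolding opow_eq trans_def using trans_lt by (auto dest: transD)
  moreover have "antisym (opow r natLeq)"
    unfolding opow_eq antisym_def using trans_lt lt_irrefl by (auto dest: transD)
  moreover have "total_on F (opow r natLeq)"
    using total_lt unfolding opow_eq total_on_def by blast
  moreover have "wf (opow r natLeq - Id)" using wf_lt by (simp add: opow_diff)
  moreover have "opow r natLeq \<subseteq> F \<times> F" unfolding opow_eq lt_def by auto
  ultimately show ?thesis unfolding Field_opow by (simp add: order_on_defs well_order_on_def)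
qed

lemma strict_wo_lt: "strict_wo lt"
  using strict_wo_Well_order[OF Well_order_opow] by (simp add: opow_diff)

text \<open>Coordinates \<open>2 k + 1\<close> and \<open>2 k + 2\<close> encode \<open>p \<le> \<alpha>\<close> as an ordinal below \<open>\<alpha> \<sqdot> 2 \<le> \<alpha>\<^sup>2\<close>, so that the
  bound \<open>(\<alpha> + 1)\<^sup>k\<close> for the rank of the \<open>k\<close>-th power is expressed by elements of \<open>\<alpha>\<^sup>\<omega>\<close>.\<close>

definition lo :: "'o option \<Rightarrow> 'o" where
  "lo p = (case p of None \<Rightarrow> z | Some x \<Rightarrow> if x \<in> Field r then x else z)"

definition hi :: "'o option \<Rightarrow> 'o" where
  "hi p = (case p of None \<Rightarrow> o1 | Some x \<Rightarrow> z)"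

definition J :: "nat \<Rightarrow> 'o option \<Rightarrow> (nat \<Rightarrow> 'o) \<Rightarrow> nat \<Rightarrow> 'o" where
  "J k p \<delta> = \<delta>(2 * k + 1 := lo p, 2 * k + 2 := hi p)"

text \<open>As ordinals, these are the elements below \<open>\<alpha>^N\<close>.\<close>

definition supp :: "nat \<Rightarrow> (nat \<Rightarrow> 'o) set" where
  "supp N = {f \<in> F. \<forall>n\<ge>N. f n = z}"

text \<open>The 0-th power is a single point, of rank 0, so any nonzero ordinal is a start. Each
  further factor occupies two new coordinates with the digits of the top element
  \<open>None\<close>.\<close>

fun bnd :: "nat \<Rightarrow> nat \<Rightarrow> 'o" where
  "bnd 0 = (\<lambda>n. if n = 0 then o1 else z)"
| "bnd (Suc k) = J k None (bnd k)"

lemma lo_hi: "lo p \<in> Field r" "hi p \<in> Field r"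
  using z o1 by (auto simp: lo_def hi_def split: option.split)

lemma J_F: "\<delta> \<in> F \<Longrightarrow> J k p \<delta> \<in> F"
proof -
  assume \<delta>: "\<delta> \<in> F"
  have "finite ({n. \<delta> n \<noteq> z} \<union> {2 * k + 1, 2 * k + 2})" using \<delta> by (auto simp: F_def)
  then have "finite {n. J k p \<delta> n \<noteq> z}" by (rule finite_subset[rotated]) (auto simp: J_def)
  then show ?thesis using \<delta> lo_hi[of p] by (auto simp: F_def J_def)
qed

lemma bnd_supp: "bnd k \<in> supp (2 * k + 1)"
proof (induction k)
  case 0
  have "{n. bnd 0 n \<noteq> z} \<subseteq> {0}" by auto
  then have "finite {n. bnd 0 n \<noteq> z}" by (rule finite_subset) simp
  then show ?case using z o1 by (auto simp: supp_def F_def)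
next
  case (Suc k)
  then have "bnd (Suc k) \<in> F" using J_F[of "bnd k"] by (simp add: supp_def)
  moreover have "\<forall>n\<ge>2 * Suc k + 1. bnd (Suc k) n = z" using Suc by (auto simp: supp_def J_def)
  ultimately show ?case by (simp add: supp_def)
qed

lemma supp_lt: "(f, g) \<in> lt \<Longrightarrow> g \<in> supp N \<Longrightarrow> f \<in> supp N"
proof -
  assume fg: "(f, g) \<in> lt" and g: "g \<in> supp N"
  obtain n where n: "(f n, g n) \<in> r - Id" "\<forall>m>n. f m = g m" using fg by (auto simp: lt_def)
  have "n < N" using n(1) g z_least[of "f n"] by (cases "n < N") (auto simp: supp_def)
  then show ?thesis using n(2) g fg by (auto simp: supp_def lt_def)
qed

lemma J_mono1:
  assumes "(\<delta>', \<delta>) \<in> lt" "\<delta> \<in> supp (2 * k + 1)"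
  shows "(J k p \<delta>', J k p \<delta>) \<in> lt"
proof -
  obtain n where n: "(\<delta>' n, \<delta> n) \<in> r - Id" "\<forall>m>n. \<delta>' m = \<delta> m" using assms(1) by (auto simp: lt_def)
  have "n < 2 * k + 1"
    using n(1) assms(2) z_least[of "\<delta>' n"] by (cases "n < 2 * k + 1") (auto simp: supp_def)
  then have "(J k p \<delta>' n, J k p \<delta> n) \<in> r - Id" "\<forall>m>n. J k p \<delta>' m = J k p \<delta> m"
    using n by (auto simp: J_def)
  moreover have "J k p \<delta>' \<in> F" "J k p \<delta> \<in> F" using assms(1) J_F by (auto simp: lt_def)
  ultimately show ?thesis by (auto simp: lt_def)
qed

text \<open>The digits of \<open>p\<close> stand above all coordinates of \<open>\<delta>\<close>
  and so dominate. Passing from \<open>Some x\<close> to \<open>None\<close> clears the lower digit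
  but raises the higher one.\<close>

lemma J_mono2:
  assumes "(p', p) \<in> osucc r - Id" "\<delta>' \<in> supp (2 * k + 1)" "\<delta> \<in> supp (2 * k + 1)"
  shows "(J k p' \<delta>', J k p \<delta>) \<in> lt"
proof -
  have top: "J k p' \<delta>' m = J k p \<delta> m" if "m > 2 * k + 2" for m
    using that assms(2,3) by (auto simp: J_def supp_def)
  have F: "J k p' \<delta>' \<in> F" "J k p \<delta> \<in> F" using assms(2,3) J_F by (auto simp: supp_def)
  have "\<exists>n. (J k p' \<delta>' n, J k p \<delta> n) \<in> r - Id \<and> (\<forall>m>n. J k p' \<delta>' m = J k p \<delta> m)"
  proof (cases p)
    case None
    then have "p' \<noteq> None" using assms(1) by auto
    then have "(J k p' \<delta>' (2 * k + 2), J k p \<delta> (2 * k + 2)) \<in> r - Id"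
      using None least[OF o1(1)] o1(2) by (auto simp: J_def hi_def)
    then show ?thesis using top by blast
  next
    case (Some x)
    then obtain x' where x': "p' = Some x'" "(x', x) \<in> r - Id"
      using assms(1) by (auto simp: osucc_def)
    then have "(J k p' \<delta>' (2 * k + 1), J k p \<delta> (2 * k + 1)) \<in> r - Id"
      using Some by (auto simp: J_def lo_def Field_def)
    moreover have "J k p' \<delta>' m = J k p \<delta> m" if "m > 2 * k + 1" for m
      using top[of m] that x'(1) Some by (cases "m = 2 * k + 2") (auto simp: J_def hi_def)
    ultimately show ?thesis by blast
  qed
  then show ?thesis using F by (auto simp: lt_def)
qed

end

section \<open>Bounds for powers\<close>

lemma no_split_singleton: "\<not> split D S v {x}"
proof
  assume "split D S v {x}"
  then obtain F :: "nat \<Rightarrow> _" where F: "\<forall>i. F i \<subseteq> {x} \<and> mr D S v (F i)" "\<forall>i j. i \<noteq> j \<longrightarrow> F i \<inter> F j = {}"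
    unfolding split_def by blast
  have "F i = {x}" for i using F(1) mr_nonempty[of D S v "F i"] by (auto simp: subset_singleton_iff)
  then show False using F(2)[rule_format, of 0 1] by simp
qed

text \<open>The product inequality for full powers; not splitting at \<open>p\<close> says that the
  structure has rank at most \<open>p\<close>.\<close>

lemma mr_power_step:
  fixes A :: "('f, 'r, 'a) fostruct" and J :: "'v \<Rightarrow> 'w \<Rightarrow> 'u"
  assumes A: "is_fostruct L A" "aleph0_saturated L A"
    and S: "strict_wo S1" "strict_wo S2" "strict_wo S3"
    and J1: "\<And>p \<delta>' \<delta>. (\<delta>', \<delta>) \<in> S2 \<Longrightarrow> (\<delta>, dt) \<in> S2\<^sup>= \<Longrightarrow> (J p \<delta>', J p \<delta>) \<in> S3"
    and J2: "\<And>p' p \<delta>. (p', p) \<in> S1 \<Longrightarrow> (\<delta>, dt) \<in> S2\<^sup>= \<Longrightarrow> (J p' dt, J p \<delta>) \<in> S3"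
    and k: "\<not> dmr L A k S2 dt (cart A k)"
    and p: "\<not> dsplit L A 1 S1 p (cart A 1)"
  shows "\<not> dmr L A (Suc k) S3 (J p dt) (cart A (Suc k))"
proof (rule mr_product[where J = J and dt = dt, OF A S _ _ k])
  show "\<not> dsplit L A (Suc 0) S1 p (cart A (Suc 0))" using p by simp
  show "proj (cart A (Suc k)) \<subseteq> cart A (Suc 0)"
    by (auto simp: proj_def tuples_Suc)
qed (use J1 J2 in \<open>auto intro: definable_tuples[OF A(1)]\<close>)

lemma strict_wo_less: "strict_wo natLess"
  using strict_wo_Well_order[OF natLeq_Well_order] by (simp add: natLeq_natLess_Id)

text \<open>Pairs are coded as \<open>p * (nbnd a k + 1) + \<delta>\<close>, injectively because
  \<open>\<delta> \<le> nbnd a k\<close>. The recursion takes the code of the largest pair,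
  \<open>p = a\<close> and \<open>\<delta> = nbnd a k\<close>; the start 1 exceeds the rank 0 of a
  point.\<close>

fun nbnd :: "nat \<Rightarrow> nat \<Rightarrow> nat" where
  "nbnd a 0 = 1"
| "nbnd a (Suc k) = a * (nbnd a k + 1) + nbnd a k"

lemma finite_power_bound:
  fixes A :: "('f, 'r, 'a) fostruct"
  assumes A: "is_fostruct L A" "aleph0_saturated L A"
    and a: "\<not> dsplit L A 1 natLess a (cart A 1)"
  shows "\<not> dmr L A k natLess (nbnd a k) (cart A k)"
proof (induction k)
  case 0
  show ?case
    using no_split_singleton[of "definable L A 0" natLess 0 "[]"]
      mr_imp_splitD[of "definable L A 0" natLess 1 "{[]}" 0] by (auto simp: natLess_def)
next
  case (Suc k)
  have "p' * (nbnd a k + 1) + nbnd a k < p * (nbnd a k + 1) + \<delta>" if "p' < p" for p' p \<delta>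
  proof -
    have "(p' + 1) * (nbnd a k + 1) \<le> p * (nbnd a k + 1)" using that by (intro mult_right_mono) auto
    then show ?thesis by simp
  qed
  then show ?case
    using mr_power_step[OF A strict_wo_less strict_wo_less strict_wo_less _ _ Suc a,
        where J = "\<lambda>p \<delta>. p * (nbnd a k + 1) + \<delta>"] by (simp add: natLess_def)
qed

context opow_natLeq
begin

lemma power_bound:
  fixes A :: "('f, 'r, 'a) fostruct"
  assumes A: "is_fostruct L A" "aleph0_saturated L A"
    and a: "\<not> dsplit L A 1 (osucc r - Id) None (cart A 1)"
  shows "\<not> dmr L A k lt (bnd k) (cart A k)"
proof (induction k)
  case 0
  have "(\<lambda>_. z) \<in> F" "bnd 0 \<in> F" using bnd_supp[of 0] z by (auto simp: F_def supp_def)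
  then have "((\<lambda>_. z), bnd 0) \<in> lt"
    using least[OF o1(1)] o1(2) by (auto simp: lt_def intro!: exI[of _ 0])
  then show ?case
    using no_split_singleton[of "definable L A 0" lt "\<lambda>_. z" "[]"]
      mr_imp_splitD[of "definable L A 0" lt "bnd 0" "{[]}" "\<lambda>_. z"] by auto
next
  case (Suc k)
  have s: "\<delta> \<in> supp (2 * k + 1)" if "(\<delta>, bnd k) \<in> lt\<^sup>=" for \<delta>
    using that supp_lt[OF _ bnd_supp] bnd_supp by auto
  have "\<not> dmr L A (Suc k) lt (J k None (bnd k)) (cart A (Suc k))"
  proof (rule mr_power_step[OF A _ strict_wo_lt strict_wo_lt _ _ Suc a])
    show "strict_wo (osucc r - Id)" by (rule strict_wo_Well_order[OF Well_order_osucc[OF r]])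
  qed (use J_mono1 J_mono2 s bnd_supp in blast)+
  then show ?case by simp
qed

end

section \<open>Trace definability in saturated structures\<close>

lemma length_concat_uniform:
  "(\<And>xs. xs \<in> set xss \<Longrightarrow> length xs = n) \<Longrightarrow> length (concat xss) = length xss * n"
  by (induction xss) auto

lemma concat_tuples:
  "(\<And>a. a \<in> set as \<Longrightarrow> \<tau> a \<in> tuples U n) \<Longrightarrow> concat (map \<tau> as) \<in> tuples U (length as * n)"
  by (induction as) (auto simp: tuples_def)

context ultrafilter
begin

text \<open>The map \<open>\<tau>\<close> is applied at each index and every coordinate is then
  replaced by its representative, so agreement with \<open>\<tau>\<close> holds only at almost all
  indices.\<close>

definition trep :: "('g, 's, 'b) fostruct \<Rightarrow> ('a \<Rightarrow> 'b list) \<Rightarrow> nat \<Rightarrow> ((nat \<Rightarrow> 'i) \<Rightarrow> 'a) \<Rightarrow> ((nat \<Rightarrow> 'i) \<Rightarrow> 'b) list" where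
  "trep N \<tau> n g = map (\<lambda>i. rep (univ N) (\<lambda>x. \<tau> (g x) ! i)) [0..<n]"

lemma trep:
  assumes \<tau>: "\<And>a. a \<in> univ M \<Longrightarrow> \<tau> a \<in> cart N n" and g: "g \<in> univ (upow M)"
  shows "trep N \<tau> n g \<in> cart (upow N) n"
    and "large (\<lambda>x. map (\<lambda>h. h x) (trep N \<tau> n g) = \<tau> (g x))"
proof -
  have FS: "(\<lambda>x. \<tau> (g x) ! i) \<in> FS (univ N)" if "i < n" for i
  proof -
    have "\<tau> (g x) ! i \<in> univ N" for x
      using \<tau>[OF upow_apply[OF g]] that nth_mem unfolding tuples_def by fastforce
    then show ?thesis using fin_comp[OF upow_fin[OF g], of "\<lambda>a. \<tau> a ! i"] by (auto simp: FS_def)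
  qed
  show t: "trep N \<tau> n g \<in> cart (upow N) n"
    using rep_in_upow[OF FS] by (auto simp: trep_def tuples_def)
  have "large (\<lambda>x. \<forall>i\<in>{..<n}. \<tau> (g x) ! i = rep (univ N) (\<lambda>x. \<tau> (g x) ! i) x)"
    using rep(2)[OF FS] by (intro large_ball) auto
  then show "large (\<lambda>x. map (\<lambda>h. h x) (trep N \<tau> n g) = \<tau> (g x))"
  proof (rule large_mono)
    have "fin (\<lambda>x. map (\<lambda>h. h x) (trep N \<tau> n g))"
      using t by (intro upow_list(1)) (auto simp: tuples_def)
    then show "fin (\<lambda>x. map (\<lambda>h. h x) (trep N \<tau> n g) = \<tau> (g x))"
      by (rule fin_eq[OF _ fin_comp[OF upow_fin[OF g]]])
    fix x assume "\<forall>i\<in>{..<n}. \<tau> (g x) ! i = rep (univ N) (\<lambda>x. \<tau> (g x) ! i) x"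
    moreover have "length (\<tau> (g x)) = n" using \<tau>[OF upow_apply[OF g]] by (simp add: tuples_def)
    ultimately show "map (\<lambda>h. h x) (trep N \<tau> n g) = \<tau> (g x)"
      by (intro nth_equalityI) (auto simp: trep_def)
  qed
qed

lemma large_trep_concat:
  assumes \<tau>: "\<And>a. a \<in> univ M \<Longrightarrow> \<tau> a \<in> cart N n" and gs: "set gs \<subseteq> univ (upow M)"
  shows "large (\<lambda>x. map (\<lambda>h. h x) (concat (map (trep N \<tau> n) gs)) = concat (map \<tau> (map (\<lambda>g. g x) gs)))"
proof -
  have "large (\<lambda>x. \<forall>g\<in>set gs. map (\<lambda>h. h x) (trep N \<tau> n g) = \<tau> (g x))"
    using gs by (intro large_ball trep(2)[OF \<tau>]) auto
  then show ?thesis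
  proof (rule large_mono)
    have "set (concat (map (trep N \<tau> n) gs)) \<subseteq> univ (upow N)"
      using trep(1)[OF \<tau>] gs by (fastforce simp: tuples_def)
    then have 1: "fin (\<lambda>x. map (\<lambda>h. h x) (concat (map (trep N \<tau> n) gs)))" by (rule upow_list(1))
    have 2: "fin (\<lambda>x. concat (map \<tau> (map (\<lambda>g. g x) gs)))"
      by (rule fin_comp[OF upow_list(1)[OF gs], of "\<lambda>as. concat (map \<tau> as)"])
    show "fin (\<lambda>x. map (\<lambda>h. h x) (concat (map (trep N \<tau> n) gs)) = concat (map \<tau> (map (\<lambda>g. g x) gs)))"
      by (rule fin_eq[OF 1 2])
    fix x assume "\<forall>g\<in>set gs. map (\<lambda>h. h x) (trep N \<tau> n g) = \<tau> (g x)"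
    then show "map (\<lambda>h. h x) (concat (map (trep N \<tau> n) gs)) = concat (map \<tau> (map (\<lambda>g. g x) gs))"
      by (induction gs) auto
  qed
qed

text \<open>A subset of the ultrapower has parameters from outside \<open>M\<close>. They are turned
  into variables, \<open>\<phi>\<close> is traced as a relation in \<open>m\<close> variables on
  \<open>M\<close> itself, and the theorem of Los carries this equivalence up. So traces of
  relations of all arities enter, although only sets in one variable are pulled back.\<close>

lemma upow_trace:
  fixes M :: "('f, 'r, 'a) fostruct" and N :: "('g, 's, 'b) fostruct"
  assumes M: "is_fostruct L M" and N: "is_fostruct K N"
    and \<tau>: "\<And>a. a \<in> univ M \<Longrightarrow> \<tau> a \<in> cart N n"
    and tr: "\<And>m X. 1 \<le> m \<Longrightarrow> definable L M m X \<Longrightarrow>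
      \<exists>Y. definable K N (m * n) Y \<and> X = {as \<in> cart M m. concat (map \<tau> as) \<in> Y}"
    and X: "definable L (upow M) 1 X"
  shows "\<exists>Y. definable K (upow N) n Y \<and>
    X = {xs \<in> cart (upow M) 1. trep N \<tau> n (hd xs) \<in> Y}"
proof -
  obtain \<phi> e where \<phi>: "wf_fm L \<phi>" "asg (upow M) e" "X = dset (upow M) 1 \<phi> e"
    using X by (auto simp: definable_iff)
  obtain m where m: "1 \<le> m" "fv \<phi> \<subseteq> {..<m}" using fv_bounded .
  obtain d0 where "d0 \<in> univ M" using M by (auto simp: is_fostruct_def)
  define d where "d = (\<lambda>_ :: nat. d0)"
  have d: "asg M d" using \<open>d0 \<in> univ M\<close> by (auto simp: d_def)
  obtain Y where Y: "definable K N (m * n) Y"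
    "dset M m \<phi> d = {as \<in> cart M m. concat (map \<tau> as) \<in> Y}"
    using tr[OF m(1) definable_dset[OF \<phi>(1) d]] by blast
  obtain \<theta> c where \<theta>: "wf_fm K \<theta>" "asg N c" "Y = dset N (m * n) \<theta> c"
    using Y(1) by (auto simp: definable_iff)
  have key: "sat M (ovr m as d) \<phi> \<longleftrightarrow> sat N (ovr (m * n) (concat (map \<tau> as)) c) \<theta>"
    if as: "as \<in> cart M m" for as
  proof -
    have "concat (map \<tau> as) \<in> cart N (m * n)"
      using concat_tuples[of as \<tau> "univ N" n] \<tau> as by (auto simp: tuples_def)
    then have "as \<in> dset M m \<phi> d \<longleftrightarrow> sat N (ovr (m * n) (concat (map \<tau> as)) c) \<theta>"
      unfolding Y(2) \<theta>(3) using as by (simp add: dset_def)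
    then show ?thesis using as by (simp add: dset_def)
  qed
  let ?t = "trep N \<tau> n"
  have t: "?t g \<in> cart (upow N) n" if "g \<in> univ (upow M)" for g
    by (rule trep(1)[OF \<tau> that])
  define c' where "c' i = rep (univ N) (\<lambda>_. c i)" for i
  have cFS: "(\<lambda>_. c i) \<in> FS (univ N)" for i using \<theta>(2) by (auto simp: FS_def)
  have c': "asg (upow N) c'" using rep_in_upow[OF cFS] by (auto simp: c'_def)
  define tail where "tail = concat (map ?t (map e [1..<m]))"
  have tail: "tail \<in> cart (upow N) ((m - 1) * n)"
    using concat_tuples[of "map e [1..<m]" ?t "univ (upow N)" n] t \<phi>(2) unfolding tail_def by auto
  \<comment> \<open>The first \<open>n\<close> variables are left for the image of the point; up to
    \<open>m * n\<close> stand the images of the parameters \<open>e 1, ..., e (m - 1)\<close>, and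
    elsewhere the constants from \<open>N\<close>.\<close>
  define E where "E i = (if i < n then c' i else if i < m * n then tail ! (i - n) else c' i)" for i
  have "tail ! (i - n) \<in> univ (upow N)" if "n \<le> i" "i < m * n" for i
  proof -
    have "i - n < length tail" using that tail m(1) by (auto simp: tuples_def diff_mult_distrib)
    then show ?thesis using tail nth_mem unfolding tuples_def by fastforce
  qed
  then have E: "asg (upow N) E" using c' by (auto simp: E_def image_subset_iff not_less)
  have main: "sat (upow M) (ovr 1 [a] e) \<phi> \<longleftrightarrow> sat (upow N) (ovr n (?t a) E) \<theta>"
    if a: "a \<in> univ (upow M)" for a
  proof -
    define gs where "gs = a # map e [1..<m]"
    have gs: "set gs \<subseteq> univ (upow M)" "length gs = m" using a \<phi>(2) m(1) by (auto simp: gs_def)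
    have ovrE: "ovr n (?t a) E = ovr (m * n) (concat (map ?t gs)) c'"
    proof
      fix i
      have "length (?t a) = n" by (simp add: trep_def)
      moreover have "i < n \<Longrightarrow> i < m * n" using m(1) by (cases m) simp_all
      ultimately show "ovr n (?t a) E i = ovr (m * n) (concat (map ?t gs)) c' i"
        by (cases "i < n") (auto simp: ovr_def E_def gs_def tail_def nth_append)
    qed
    have rng: "asg (upow M) (ovr 1 [a] e)"
      by (rule range_ovr) (use a \<phi>(2) in \<open>auto simp: tuples_def\<close>)
    have rngE: "asg (upow N) (ovr n (?t a) E)"
      by (rule range_ovr[OF t[OF a] E])
    have as: "map (\<lambda>g. g x) gs \<in> cart M m" for x
      using upow_list(2)[OF gs(1), of x] gs(2) by (auto simp: tuples_def)
    have "sat M (\<lambda>i. ovr 1 [a] e i x) \<phi> = sat M (ovr m (map (\<lambda>g. g x) gs) d) \<phi>" for x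
    proof (rule sat_cong)
      fix i assume "i \<in> fv \<phi>"
      then have "i < m" using m(2) by auto
      then show "ovr 1 [a] e i x = ovr m (map (\<lambda>g. g x) gs) d i"
        using gs(2) by (cases i) (auto simp: ovr_def gs_def)
    qed
    then have 1: "(\<lambda>x. sat M (\<lambda>i. ovr 1 [a] e i x) \<phi>) =
        (\<lambda>x. sat N (ovr (m * n) (concat (map \<tau> (map (\<lambda>g. g x) gs))) c) \<theta>)"
      using key[OF as] by (simp add: fun_eq_iff)
    let ?P = "\<lambda>x. sat N (ovr (m * n) (concat (map \<tau> (map (\<lambda>g. g x) gs))) c) \<theta>"
    let ?R = "\<lambda>x. sat N (\<lambda>i. ovr n (?t a) E i x) \<theta>"
    have finP: "fin ?P"
      by (rule fin_comp[OF upow_list(1)[OF gs(1)], of "\<lambda>as. sat N (ovr (m * n) (concat (map \<tau> as)) c) \<theta>"])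
    have "fin (ovr n (?t a) E i)" for i using rngE upow_fin by blast
    then have finR: "fin ?R" by (rule fin_sat)
    have "large (\<lambda>x. \<forall>i\<in>fv \<theta>. c i = c' i x)"
      using rep(2)[OF cFS] by (intro large_ball) (auto simp: c'_def)
    from large_conjI[OF this large_trep_concat[OF \<tau> gs(1)]]
    have "large (\<lambda>x. ?P x = ?R x)"
    proof (rule large_mono)
      show "fin (\<lambda>x. ?P x = ?R x)" by (rule fin_comp2[OF finP finR])
      fix x assume x: "(\<forall>i\<in>fv \<theta>. c i = c' i x) \<and>
        map (\<lambda>h. h x) (concat (map ?t gs)) = concat (map \<tau> (map (\<lambda>g. g x) gs))"
      have len: "length (concat (map ?t gs)) = m * n"
      proof -
        have "length xs = n" if "xs \<in> set (map ?t gs)" for xs using that by (auto simp: trep_def)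
        from length_concat_uniform[of "map ?t gs", OF this] show ?thesis using gs(2) by simp
      qed
      show "?P x = ?R x"
        unfolding ovrE
      proof (rule sat_cong)
        fix i assume i: "i \<in> fv \<theta>"
        have "concat (map \<tau> (map (\<lambda>g. g x) gs)) ! i = (concat (map ?t gs) ! i) x" if "i < m * n"
          using that len conjunct2[OF x, symmetric] by simp
        then show "ovr (m * n) (concat (map \<tau> (map (\<lambda>g. g x) gs))) c i = ovr (m * n) (concat (map ?t gs)) c' i x"
          using x i by (auto simp: ovr_def)
      qed
    qed
    then have "large ?P \<longleftrightarrow> large ?R" by (rule large_cong[OF _ finP finR])
    then show ?thesis using los[OF M rng \<phi>(1)] los[OF N rngE \<theta>(1)] 1 by simp
  qed
  have "X = {xs \<in> cart (upow M) 1. ?t (hd xs) \<in> dset (upow N) n \<theta> E}"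
  proof -
    have "[a] \<in> X \<longleftrightarrow> ?t a \<in> dset (upow N) n \<theta> E" if "a \<in> univ (upow M)" for a
      using main[OF that] t[OF that] that unfolding \<phi>(3) by (simp add: dset_def tuples_def)
    moreover have "X \<subseteq> cart (upow M) 1" using definable_subset[OF X] .
    ultimately show ?thesis by (auto simp: tuples_1)
  qed
  then show ?thesis using definable_dset[OF \<theta>(1) E] by blast
qed

end

text \<open>The sum of both formula types lets one regular ultrafilter saturate both ultrapowers
  over a common index set.\<close>

type_synonym ('f, 'r, 'g, 's) index = "nat \<Rightarrow> (('f, 'r) fm + ('g, 's) fm) set"

lemma trace_saturated:
  fixes M :: "('f, 'r, 'a) fostruct" and N :: "('g, 's, 'b) fostruct"
  assumes M: "is_fostruct L M" and N: "is_fostruct K N" and tr: "trace_defines K N L M"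
  obtains A :: "('f, 'r, ('f, 'r, 'g, 's) index \<Rightarrow> 'a) fostruct"
    and B :: "('g, 's, ('f, 'r, 'g, 's) index \<Rightarrow> 'b) fostruct" and n
  where "is_fostruct L A" "aleph0_saturated L A" "elem_equiv L M A"
    "is_fostruct K B" "aleph0_saturated K B" "elem_equiv K N B"
    "\<And>(S :: 'w rel) w. dmr L A 1 S w (cart A 1) \<Longrightarrow>
      dmr K B n S w (cart B n)"
proof -
  obtain U and d :: "(('f, 'r) fm + ('g, 's) fm) set \<Rightarrow> (('f, 'r) fm + ('g, 's) fm) set"
    where U: "ultrafilter U" and d: "\<And>j. finite (d j)" "\<And>x. {j. x \<in> d j} \<in> U"
    using regular_ultrafilter[where 'x = "('f, 'r) fm + ('g, 's) fm"] by blast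
  interpret ultrafilter U by (rule U)
  obtain n \<tau> where \<tau>': "\<forall>a\<in>univ M. \<tau> a \<in> cart N n"
    and trace': "\<forall>m\<ge>1. \<forall>X. definable L M m X \<longrightarrow>
      (\<exists>Y. definable K N (m * n) Y \<and> X = {as \<in> cart M m. concat (map \<tau> as) \<in> Y})"
    using tr unfolding trace_defines_def by blast
  have \<tau>: "\<tau> a \<in> cart N n" if "a \<in> univ M" for a using \<tau>' that by blast
  have trace: "\<exists>Y. definable K N (m * n) Y \<and> X = {as \<in> cart M m. concat (map \<tau> as) \<in> Y}"
    if "1 \<le> m" "definable L M m X" for m X using trace' that by blast
  have sM: "aleph0_saturated L (upow M)"
    by (rule upow_saturated[OF M, of "\<lambda>j. Inl -` d j"]) (use d in \<open>auto intro: finite_vimageI\<close>)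
  have sN: "aleph0_saturated K (upow N)"
    by (rule upow_saturated[OF N, of "\<lambda>j. Inr -` d j"]) (use d in \<open>auto intro: finite_vimageI\<close>)
  show thesis
  proof (rule that[OF is_fostruct_upow[OF M] sM elementary_embedding_elem_equiv[OF upow_embedding[OF M]]
        is_fostruct_upow[OF N] sN elementary_embedding_elem_equiv[OF upow_embedding[OF N]]])
    fix S :: "'w rel" and w assume *: "dmr L (upow M) 1 S w (cart (upow M) 1)"
    show "dmr K (upow N) n S w (cart (upow N) n)"
    proof (rule mr_trace[where t = "\<lambda>x. trep N \<tau> n (hd x)",
          OF set_algebra_definable definable_subset upow_trace[OF M N \<tau> trace] *])
      show "definable K (upow N) n (cart (upow N) n)"
        by (rule definable_tuples[OF is_fostruct_upow[OF N]])
      show "(\<lambda>x. trep N \<tau> n (hd x)) ` cart (upow M) 1 \<subseteq> cart (upow N) n"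
        using trep(1)[OF \<tau>] by (auto simp: tuples_1)
    qed
  qed
qed

section \<open>Complete theories\<close>

text \<open>Entailment speaks only about models in the type of formulas. A model of any other type
  is first replaced by an elementarily equivalent one there.\<close>

lemma entails_sat:
  fixes N :: "('f, 'r, 'x) fostruct"
  assumes T: "T \<subseteq> sentences L" and \<phi>: "entails L T \<phi>" "\<phi> \<in> sentences L"
    and N: "models L N T" "asg N e"
  shows "sat N e \<phi>"
proof (rule small_elem_equiv)
  show "is_fostruct L N" using N(1) by (simp add: models_def)
  fix B :: "('f, 'r, ('f, 'r) fm) fostruct"
  assume B: "is_fostruct L B" "elem_equiv L B N"
  have eq: "sat B e' \<psi> \<longleftrightarrow> sat N e \<psi>" if "\<psi> \<in> sentences L" "asg B e'" for \<psi> e'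
    using B(2) N(2) that unfolding elem_equiv_def eqv_def sentences_def by blast
  have "models L B T"
    unfolding models_def
  proof (intro conjI ballI B(1))
    fix \<psi> assume "\<psi> \<in> T"
    moreover from this have "sat N e \<psi>" using N by (auto simp: models_def holds_def)
    ultimately show "holds B \<psi>" using eq T by (auto simp: holds_def)
  qed
  then have "holds B \<phi>" using \<phi>(1) by (auto simp: entails_def)
  moreover obtain b where "b \<in> univ B" using B(1) by (auto simp: is_fostruct_def)
  then have "asg B (\<lambda>_ :: nat. b)" by auto
  ultimately show ?thesis using eq[OF \<phi>(2)] by (auto simp: holds_def)
qed

lemma complete_theory_elem_equiv:
  assumes T: "complete_theory L T" and M: "models L M T" and N: "models L N T"
  shows "elem_equiv L M N"
  unfolding elem_equiv_def eqv_def
proof (intro allI impI)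
  fix e :: "nat \<Rightarrow> _" and e' :: "nat \<Rightarrow> _" and \<phi> assume e: "asg M e \<and> asg N e'" and \<phi>: "wf_fm L \<phi> \<and> fv \<phi> \<subseteq> {}"
  have s: "\<phi> \<in> sentences L" "Neg \<phi> \<in> sentences L" using \<phi> by (simp_all add: sentences_def)
  have T': "T \<subseteq> sentences L" using T by (simp add: complete_theory_def)
  have "entails L T \<phi> \<or> entails L T (Neg \<phi>)" using T s(1) by (simp add: complete_theory_def)
  then show "sat M e \<phi> \<longleftrightarrow> sat N e' \<phi>"
  proof
    assume "entails L T \<phi>"
    note * = entails_sat[OF T' this s(1)]
    show ?thesis using *[OF M, of e] *[OF N, of e'] e by simp
  next
    assume "entails L T (Neg \<phi>)"
    note * = entails_sat[OF T' this s(2)]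
    show ?thesis using *[OF M, of e] *[OF N, of e'] e by simp
  qed
qed

text \<open>Splitting at the top of \<open>osucc \<alpha>\<close> would pass to the extension that
  witnesses rank at least \<open>\<alpha>\<close>, where splitting below the top is known. Together
  they would give rank at least \<open>\<alpha> + 1\<close>.\<close>

lemma has_morley_rank_no_split:
  fixes N :: "('g, 's, 'b) fostruct" and \<alpha> :: "'o rel"
  assumes rk: "has_morley_rank K N \<alpha>" and N: "is_fostruct K N"
    and B: "is_fostruct K B" "elem_equiv K B N"
  shows "\<not> dsplit K B 1 (osucc \<alpha> - Id) None (cart B 1)"
proof
  assume sp: "dsplit K B 1 (osucc \<alpha> - Id) None (cart B 1)"
  have \<alpha>: "Well_order \<alpha>" using rk by (simp add: has_morley_rank_def)
  note wo = Well_order_osucc[OF \<alpha>]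
  have wf: "wf (osucc \<alpha> - Id)" using strict_wo_Well_order[OF wo] by (simp add: strict_wo_def)
  obtain N' :: "('g, 's, ('b + ('g, 's) fm) set) fostruct" and h
    where N': "is_fostruct K N'" "elementary_embedding K N N' h" "aleph0_saturated K N'"
      and ge: "rank_ge K N' 1 \<alpha> (cart N' 1)"
    using rk unfolding has_morley_rank_def morley_rank_ge_def by blast
  have "elem_equiv K B N'"
    by (rule elem_equiv_trans[OF B(2) elementary_embedding_elem_equiv[OF N'(2)] N])
  then have top: "dsplit K N' 1 (osucc \<alpha> - Id) None (cart N' 1)"
    using split_elem_equiv[OF wf N'(3) _ B(1) N'(1) sp] by blast
  have "dsplit K N' 1 (osucc \<alpha> - Id) v (cart N' 1)" if "v \<in> Field (osucc \<alpha>)" for v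
  proof (cases v)
    case None
    then show ?thesis using top by simp
  next
    case (Some x)
    then have "x \<in> Field \<alpha>" using that by (auto simp: Field_osucc)
    then have "dsplit K N' 1 (\<alpha> - Id) (the v) (cart N' 1)"
      using ge Some unfolding rank_ge_iff[OF \<alpha>] by simp
    then show ?thesis
      by (rule split_transport_on[where P = "\<lambda>p. p \<noteq> None" and f = the, rotated 3])
         (use wf Some in \<open>auto simp: osucc_def\<close>)
  qed
  then have "rank_ge K N' 1 (osucc \<alpha>) (cart N' 1)"
    using ge unfolding rank_ge_iff[OF wo] rank_ge_iff[OF \<alpha>] by blast
  then have "morley_rank_ge K N (osucc \<alpha>)"
    unfolding morley_rank_ge_def using N' by blast
  then show False using rk ordLess_osucc[OF \<alpha>] by (auto simp: has_morley_rank_def)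
qed

lemma no_split_natural:
  assumes \<alpha>: "\<alpha> =o natLeq_on a" and sp: "\<not> split D (osucc \<alpha> - Id) None X"
  shows "\<not> split D natLess a X"
proof
  assume s: "split D natLess a X"
  obtain g where g: "iso \<alpha> (natLeq_on a) g" and wo: "Well_order \<alpha>" using \<alpha> by (auto simp: ordIso_def)
  have g1: "g x < a" if "x \<in> Field \<alpha>" for x
    using iso_Field[OF g] that by (auto simp: Field_natLeq_on)
  have g2: "g x < g y" if "(x, y) \<in> \<alpha>" "x \<noteq> y" for x y
  proof -
    have "g x \<le> g y" using iso_forward[OF that(1) g] by simp
    moreover have "x \<in> Field \<alpha>" "y \<in> Field \<alpha>" using that(1) by (auto simp: Field_def)
    then have "g x \<noteq> g y" using g that(2) by (auto simp: iso_def bij_betw_def inj_on_def)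
    ultimately show ?thesis by simp
  qed
  have "split D (osucc \<alpha> - Id) None X"
  \<comment> \<open>\<open>None\<close>, the position of \<open>\<alpha>\<close> in its successor,
    corresponds to the number \<open>a\<close>.\<close>
  proof (rule split_transport[where f = "\<lambda>p. case p of None \<Rightarrow> a | Some x \<Rightarrow> g x"])
    show "wf (osucc \<alpha> - Id)"
      using strict_wo_Well_order[OF Well_order_osucc[OF wo]] by (simp add: strict_wo_def)
    fix u v assume "(u, v) \<in> osucc \<alpha> - Id"
    then show "(case u of None \<Rightarrow> a | Some x \<Rightarrow> g x, case v of None \<Rightarrow> a | Some x \<Rightarrow> g x) \<in> natLess"
      using g1 g2 by (cases u; cases v) (fastforce simp: osucc_def natLess_def)+
  qed (use s in simp)
  then show False using sp by contradiction
qed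

lemma finite_rank_exists:
  assumes A: "is_fostruct L A" "\<not> dmr L A 1 natLess b (cart A 1)"
  obtains u where "u < b" "dmr L A 1 (natLeq - Id) u (cart A 1)"
    "\<not> dsplit L A 1 (natLeq - Id) u (cart A 1)"
proof -
  have "cart A 1 \<noteq> {}" using A(1) by (auto simp: is_fostruct_def tuples_1)
  from rank_exists[OF strict_wo_less A(2) definable_tuples[OF A(1)] this]
  obtain u where "(u, b) \<in> natLess" "dmr L A 1 natLess u (cart A 1)"
    "\<not> dsplit L A 1 natLess u (cart A 1)" .
  moreover from this(1) have "u < b" by (simp add: natLess_def)
  ultimately show thesis using that[of u] unfolding natLeq_natLess_Id by blast
qed

lemma nbnd_0 [simp]: "nbnd 0 k = 1"
  by (induction k) auto

text \<open>With \<open>nbnd a n = 2 (a + 1)\<^sup>n - 1\<close> in place of \<open>\<alpha>\<^sup>\<omega>\<close>: the case where \<open>N\<close> has finite rank \<open>a\<close>.\<close>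

lemma trace_finite_rank:
  fixes M :: "('f, 'r, 'a) fostruct" and N :: "('g, 's, 'b) fostruct" and N' :: "('g, 's, 'c) fostruct"
  assumes M: "is_fostruct L M" and N: "is_fostruct K N" and tr: "trace_defines K N L M"
    and N': "is_fostruct K N'" "elem_equiv K N N'" "has_morley_rank K N' \<alpha>" "\<alpha> =o natLeq_on a"
  obtains A :: "('f, 'r, ('f, 'r, 'g, 's) index \<Rightarrow> 'a) fostruct" and n u
  where "is_fostruct L A" "aleph0_saturated L A" "elem_equiv L M A" "u < nbnd a n"
    "dmr L A 1 (natLeq - Id) u (cart A 1)"
    "\<not> dsplit L A 1 (natLeq - Id) u (cart A 1)"
proof (rule trace_saturated[OF M N tr, where 'w = nat])
  fix A :: "('f, 'r, ('f, 'r, 'g, 's) index \<Rightarrow> 'a) fostruct"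
    and B :: "('g, 's, ('f, 'r, 'g, 's) index \<Rightarrow> 'b) fostruct" and n
  assume A: "is_fostruct L A" "aleph0_saturated L A" "elem_equiv L M A"
    and B: "is_fostruct K B" "aleph0_saturated K B" "elem_equiv K N B"
    and mr: "\<And>(S :: nat rel) w. dmr L A 1 S w (cart A 1) \<Longrightarrow>
      dmr K B n S w (cart B n)"
  have "elem_equiv K B N'" by (rule elem_equiv_trans[OF elem_equiv_sym[OF B(3)] N'(2) N])
  note has_morley_rank_no_split[OF N'(3,1) B(1) this]
  note finite_power_bound[OF B(1,2) no_split_natural[OF N'(4) this]]
  then have "\<not> dmr L A 1 natLess (nbnd a n) (cart A 1)"
    using mr by blast
  from finite_rank_exists[OF A(1) this] show thesis using that[OF A] by metis
qed

lemma has_morley_rank_natI: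
  fixes M :: "('f, 'r, 'x) fostruct" and A :: "('f, 'r, 'y) fostruct"
  assumes "is_fostruct L M" "is_fostruct L A" "aleph0_saturated L A" "elem_equiv L M A"
    "dmr L A 1 (natLeq - Id) u (cart A 1)"
    "\<not> dsplit L A 1 (natLeq - Id) u (cart A 1)"
  shows "has_morley_rank L M (natLeq_on u)"
  using has_morley_rankI[OF assms(1-4) natLeq_Well_order _ assms(5,6)]
  by (simp add: Field_natLeq Restr_natLeq2)

text \<open>The rank of \<open>M\<close> appears as a point \<open>u\<close> of
  \<open>\<alpha>^\<omega>\<close> itself. Its order type is the proper initial segment below
  \<open>u\<close>, so strictness comes for free.\<close>

lemma trace_infinite_rank:
  fixes M :: "('f, 'r, 'a) fostruct" and N :: "('g, 's, 'b) fostruct" and \<alpha> :: "'o rel"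
  assumes M: "is_fostruct L M" and N: "is_fostruct K N" and tr: "trace_defines K N L M"
    and rk: "has_morley_rank K N \<alpha>" and two: "natLeq_on 2 \<le>o \<alpha>"
  shows "\<exists>\<beta> :: (nat \<Rightarrow> 'o) rel. has_morley_rank L M \<beta> \<and> \<beta> <o opow \<alpha> natLeq"
proof -
  have \<alpha>: "Well_order \<alpha>" using rk by (simp add: has_morley_rank_def)
  obtain g where g: "embed (natLeq_on 2) \<alpha> g" using two by (auto simp: ordLeq_def)
  have F: "0 \<in> Field (natLeq_on 2)" "1 \<in> Field (natLeq_on 2)" by (simp_all add: Field_natLeq_on)
  have "g 0 \<noteq> g 1" using embed_inj_on[OF natLeq_on_Well_order g] F by (auto simp: inj_on_def)
  have gF: "g 0 \<in> Field \<alpha>" "g 1 \<in> Field \<alpha>"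
    using embed_in_Field[OF g F(1)] embed_in_Field[OF g F(2)] by auto
  have "wf (\<alpha> - Id)" using \<alpha> by (simp add: well_order_on_def)
  from wfE_min[OF this gF(1)]
  obtain z where z: "z \<in> Field \<alpha>" "\<And>y. (y, z) \<in> \<alpha> - Id \<Longrightarrow> y \<notin> Field \<alpha>" by metis
  have least: "(z, x) \<in> \<alpha>" if "x \<in> Field \<alpha>" for x
  proof -
    have "total_on (Field \<alpha>) \<alpha>" "refl_on (Field \<alpha>) \<alpha>" using \<alpha> by (auto simp: order_on_defs)
    then show ?thesis using z that unfolding total_on_def refl_on_def by (cases "x = z") auto
  qed
  obtain o1 where o1: "o1 \<in> Field \<alpha>" "o1 \<noteq> z" using gF \<open>g 0 \<noteq> g 1\<close> by metis
  interpret opow_natLeq \<alpha> z o1 by unfold_locales (fact \<alpha> least o1)+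
  show ?thesis
  proof (rule trace_saturated[OF M N tr, where 'w = "nat \<Rightarrow> 'o"])
    fix A :: "('f, 'r, ('f, 'r, 'g, 's) index \<Rightarrow> 'a) fostruct"
      and B :: "('g, 's, ('f, 'r, 'g, 's) index \<Rightarrow> 'b) fostruct" and n
    assume A: "is_fostruct L A" "aleph0_saturated L A" "elem_equiv L M A"
      and B: "is_fostruct K B" "aleph0_saturated K B" "elem_equiv K N B"
      and mr: "\<And>(S :: (nat \<Rightarrow> 'o) rel) w. dmr L A 1 S w (cart A 1) \<Longrightarrow>
        dmr K B n S w (cart B n)"
    note power_bound[OF B(1,2) has_morley_rank_no_split[OF rk N B(1) elem_equiv_sym[OF B(3)]]]
    then have bound: "\<not> dmr L A 1 lt (bnd n) (cart A 1)"
      using mr by blast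
    have ne: "cart A 1 \<noteq> {}" using A(1) by (auto simp: is_fostruct_def tuples_1)
    show ?thesis
    proof (rule rank_exists[OF strict_wo_lt bound definable_tuples[OF A(1)] ne])
      fix u assume u: "(u, bnd n) \<in> lt" "dmr L A 1 lt u (cart A 1)"
        "\<not> dsplit L A 1 lt u (cart A 1)"
      have uF: "u \<in> Field (opow \<alpha> natLeq)" using u(1) by (simp add: Field_opow lt_def)
      have "has_morley_rank L M (Restr (opow \<alpha> natLeq) (underS (opow \<alpha> natLeq) u))"
        by (rule has_morley_rankI[OF M A Well_order_opow uF u(2,3)[folded opow_diff]])
      moreover have "Restr (opow \<alpha> natLeq) (underS (opow \<alpha> natLeq) u) <o opow \<alpha> natLeq"
        using underS_Restr_ordLess[OF Well_order_opow] uF by blast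
      ultimately show ?thesis by blast
    qed
  qed
qed

theorem proposition3p9:
  fixes L :: "('f, 'r) signature" and K :: "('g, 's) signature"
    and M :: "('f, 'r, 'a) fostruct" and N :: "('g, 's, 'b) fostruct"
    and \<alpha> :: "'o rel"
    and T\<^sub>1 :: "('f, 'r) fm set" and T :: "('g, 's) fm set"
  shows
    "(is_fostruct L M \<and> is_fostruct K N \<and> trace_defines K N L M \<and> has_morley_rank K N \<alpha> \<longrightarrow>
        (natLeq_on 2 \<le>o \<alpha> \<longrightarrow>
           (\<exists>\<beta> :: (nat \<Rightarrow> 'o) rel. has_morley_rank L M \<beta> \<and> \<beta> <o opow \<alpha> natLeq)) \<and>
        (\<alpha> =o natLeq_on 1 \<longrightarrow> finite_morley_rank L M) \<and>
        (\<alpha> =o natLeq_on 0 \<longrightarrow> has_morley_rank L M (natLeq_on 0))) \<and>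
     (complete_theory K T \<and> complete_theory L T\<^sub>1 \<and>
      theory_trace_definable TYPE('a) TYPE('b) L T\<^sub>1 K T \<and>
      theory_finite_morley_rank K T \<longrightarrow>
        theory_finite_morley_rank L T\<^sub>1)"
proof (intro conjI impI; elim conjE)
  assume M: "is_fostruct L M" and N: "is_fostruct K N" and tr: "trace_defines K N L M"
    and rk: "has_morley_rank K N \<alpha>"
  note NN = elem_equiv_refl[of K N]
  show "\<exists>\<beta> :: (nat \<Rightarrow> 'o) rel. has_morley_rank L M \<beta> \<and> \<beta> <o opow \<alpha> natLeq" if "natLeq_on 2 \<le>o \<alpha>"
    by (rule trace_infinite_rank[OF M N tr rk that])
  show "finite_morley_rank L M" if "\<alpha> =o natLeq_on 1"
    unfolding finite_morley_rank_def
    by (rule trace_finite_rank[OF M N tr N NN rk that]) (rule exI, rule has_morley_rank_natI[OF M])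
  show "has_morley_rank L M (natLeq_on 0)" if "\<alpha> =o natLeq_on 0"
  proof (rule trace_finite_rank[OF M N tr N NN rk that])
    fix A :: "('f, 'r, ('f, 'r, 'g, 's) index \<Rightarrow> 'a) fostruct" and n u
    assume A: "is_fostruct L A" "aleph0_saturated L A" "elem_equiv L M A" and "u < nbnd 0 n"
      and u: "dmr L A 1 (natLeq - Id) u (cart A 1)"
        "\<not> dsplit L A 1 (natLeq - Id) u (cart A 1)"
    \<comment> \<open>The bound \<open>nbnd 0 n\<close> is 1 for every \<open>n\<close>: powers of a
      finite structure are finite.\<close>
    then have "u = 0" by simp
    then show ?thesis using has_morley_rank_natI[OF M A u] by simp
  qed
next
  assume T: "complete_theory K T" and T1: "complete_theory L T\<^sub>1"
    and tr: "theory_trace_definable TYPE('a) TYPE('b) L T\<^sub>1 K T" and fin: "theory_finite_morley_rank K T"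
  obtain M :: "('f, 'r, 'a) fostruct" and N :: "('g, 's, 'b) fostruct"
    where MN: "models L M T\<^sub>1" "models K N T" "trace_defines K N L M"
    using tr unfolding theory_trace_definable_def by blast
  then have M: "is_fostruct L M" and N: "is_fostruct K N" by (simp_all add: models_def)
  \<comment> \<open>The rank of \<open>T\<close> is recorded only on models in the type of formulas.
    \<open>N0\<close> is such a model and lends its rank to the elementarily equivalent
    \<open>N\<close>.\<close>
  obtain N0 :: "('g, 's, ('g, 's) fm) fostruct" where N0: "models K N0 T"
    using T by (auto simp: complete_theory_def consistent_def)
  obtain a where a: "has_morley_rank K N0 (natLeq_on a)"
    using fin N0 by (auto simp: theory_finite_morley_rank_def theory_has_morley_rank_def)
  have "is_fostruct K N0" using N0 by (simp add: models_def)
  show "theory_finite_morley_rank L T\<^sub>1"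
  proof (rule trace_finite_rank[OF M N MN(3) \<open>is_fostruct K N0\<close>
        complete_theory_elem_equiv[OF T MN(2) N0] a ordIso_reflexive[OF natLeq_on_Well_order]])
    fix A :: "('f, 'r, ('f, 'r, 'g, 's) index \<Rightarrow> 'a) fostruct" and n u
    assume A: "is_fostruct L A" "aleph0_saturated L A" "elem_equiv L M A"
      "dmr L A 1 (natLeq - Id) u (cart A 1)"
      "\<not> dsplit L A 1 (natLeq - Id) u (cart A 1)"
    have "has_morley_rank L M0 (natLeq_on u)" if M0: "models L M0 T\<^sub>1" for M0 :: "('f, 'r, ('f, 'r) fm) fostruct"
    proof -
      \<comment> \<open>The one saturated structure \<open>A\<close> computes the rank of every
        model of \<open>T\<^sub>1\<close>, so the number \<open>u\<close> is the same for all of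
        them.\<close>
      have "elem_equiv L M0 A"
        by (rule elem_equiv_trans[OF complete_theory_elem_equiv[OF T1 M0 MN(1)] A(3) M])
      then show ?thesis using M0 A by (intro has_morley_rank_natI[of L M0 A]) (simp_all add: models_def)
    qed
    then show ?thesis by (auto simp: theory_finite_morley_rank_def theory_has_morley_rank_def)
  qed
qed

end
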